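(* Let $k \geq 2$ be an integer and let $G$ be a $(k+1)$-connected $(K_2 \cup kK_1)$-free graph with $\delta(G) \geq \frac{3k-1}{2}$ and $\alpha(G) < \frac{|V(G)|}{2}$. Then $G$ is hamiltonian-connected.
   Context: All graphs are finite, undirected and simple. $\delta(G)$ denotes the minimum degree and $\alpha(G)$ the independence number of $G$. For graphs $R, R'$, $R \cup R'$ is their disjoint union and $kR$ is the disjoint union of $k$ copies of $R$; $K_n$ is the complete graph on $n$ vertices. A graph $G$ is $R$-free if it contains no induced subgraph isomorphic to $R$. A graph $G$ is hamiltonian-connected if for every pair of distinct vertices $u,v$ of $G$ there is a path from $u$ to $v$ containing all vertices of $G$. *)

theory Defs
  imports Complex_Main
begin

definition graph :: "'a set \<Rightarrow> ('a \<Rightarrow> 'a \<Rightarrow> bool) \<Rightarrow> bool" where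
  "graph V E \<longleftrightarrow> finite V \<and> (\<forall>x y. E x y \<longrightarrow> x \<in> V \<and> y \<in> V)
     \<and> (\<forall>x y. E x y \<longrightarrow> E y x) \<and> (\<forall>x. \<not> E x x)"

definition degree :: "'a set \<Rightarrow> ('a \<Rightarrow> 'a \<Rightarrow> bool) \<Rightarrow> 'a \<Rightarrow> nat" where
  "degree V E v = card {u \<in> V. E v u}"

definition min_degree :: "'a set \<Rightarrow> ('a \<Rightarrow> 'a \<Rightarrow> bool) \<Rightarrow> nat" where
  "min_degree V E = Min (degree V E ` V)"

definition independent :: "('a \<Rightarrow> 'a \<Rightarrow> bool) \<Rightarrow> 'a set \<Rightarrow> bool" where
  "independent E I \<longleftrightarrow> (\<forall>x\<in>I. \<forall>y\<in>I. \<not> E x y)"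

definition independence_number :: "'a set \<Rightarrow> ('a \<Rightarrow> 'a \<Rightarrow> bool) \<Rightarrow> nat" where
  "independence_number V E = Max {card I | I. I \<subseteq> V \<and> independent E I}"

definition connected_on :: "'a set \<Rightarrow> ('a \<Rightarrow> 'a \<Rightarrow> bool) \<Rightarrow> bool" where
  "connected_on W E \<longleftrightarrow> W \<noteq> {} \<and>
     (\<forall>u\<in>W. \<forall>v\<in>W. (\<lambda>x y. x \<in> W \<and> y \<in> W \<and> E x y)\<^sup>*\<^sup>* u v)"

definition k_connected :: "'a set \<Rightarrow> ('a \<Rightarrow> 'a \<Rightarrow> bool) \<Rightarrow> nat \<Rightarrow> bool" where
  "k_connected V E k \<longleftrightarrow> card V > k \<and>
     (\<forall>S. S \<subseteq> V \<and> card S < k \<longrightarrow> connected_on (V - S) E)"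

definition has_induced :: "'a set \<Rightarrow> ('a \<Rightarrow> 'a \<Rightarrow> bool) \<Rightarrow> 'b set \<Rightarrow> ('b \<Rightarrow> 'b \<Rightarrow> bool) \<Rightarrow> bool" where
  "has_induced V E VH EH \<longleftrightarrow> (\<exists>f. inj_on f VH \<and> f ` VH \<subseteq> V \<and>
     (\<forall>a\<in>VH. \<forall>b\<in>VH. EH a b \<longleftrightarrow> E (f a) (f b)))"

definition induced_free :: "'a set \<Rightarrow> ('a \<Rightarrow> 'a \<Rightarrow> bool) \<Rightarrow> 'b set \<Rightarrow> ('b \<Rightarrow> 'b \<Rightarrow> bool) \<Rightarrow> bool" where
  "induced_free V E VH EH \<longleftrightarrow> \<not> has_induced V E VH EH"

definition K2_kK1_V :: "nat \<Rightarrow> nat set" where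
  "K2_kK1_V k = {0..k+1}"

definition K2_kK1_E :: "nat \<Rightarrow> nat \<Rightarrow> bool" where
  "K2_kK1_E a b \<longleftrightarrow> (a = 0 \<and> b = 1) \<or> (a = 1 \<and> b = 0)"

definition ham_path :: "'a set \<Rightarrow> ('a \<Rightarrow> 'a \<Rightarrow> bool) \<Rightarrow> 'a list \<Rightarrow> bool" where
  "ham_path V E p \<longleftrightarrow> distinct p \<and> set p = V \<and>
     (\<forall>i. Suc i < length p \<longrightarrow> E (p ! i) (p ! Suc i))"

definition hamiltonian_connected :: "'a set \<Rightarrow> ('a \<Rightarrow> 'a \<Rightarrow> bool) \<Rightarrow> bool" where
  "hamiltonian_connected V E \<longleftrightarrow> (\<forall>u\<in>V. \<forall>v\<in>V. u \<noteq> v \<longrightarrow>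
     (\<exists>p. ham_path V E p \<and> p \<noteq> [] \<and> hd p = u \<and> last p = v))"

end

theory Submission
  imports Defs
begin

text \<open>
  Join the two end vertices to a new vertex and take a longest cycle \<open>C\<close> through it; a Hamiltonian path
  exists unless \<open>C\<close> misses a vertex.  An edge outside \<open>C\<close> together with the successors of the neighbours of
  its component contains \<open>K\<^sub>2 \<union> k K\<^sub>1\<close>, so the missed vertices are independent; fix one of them, \<open>h\<close>.
  The successors of the neighbours of \<open>h\<close> form with \<open>h\<close> an independent set \<open>I\<close>, the predecessors an
  independent set \<open>J\<close>.  Let \<open>I\<^sup>*\<close> and \<open>J\<^sup>*\<close> be the sets of vertices without neighbours in \<open>I\<close> and in \<open>J\<close>.
  Both are again independent, and a vertex outside \<open>I\<^sup>*\<close> misses fewer than \<open>k\<close> vertices of any independent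
  set that contains one of its neighbours.  Since consecutive vertices of \<open>C\<close> cannot have interleaved
  neighbours in \<open>I \<union> J\<close>, a count shows that membership in \<open>I\<^sup>*\<close> and \<open>J\<^sup>*\<close> changes along \<open>C\<close> in a very
  restricted way.  If \<open>I\<^sup>*\<close> and \<open>J\<^sup>*\<close> agree on \<open>C\<close>, then \<open>I\<^sup>* \<inter> J\<^sup>*\<close> contains every second vertex of \<open>C\<close> and
  violates the bound on the independence number.  Otherwise a segment between two neighbours of \<open>h\<close> that
  alternates between \<open>I\<^sup>* - J\<^sup>*\<close> and \<open>J\<^sup>* - I\<^sup>*\<close> could be moved elsewhere to make room for \<open>h\<close>, unless
  two such segments are adjacent, and then the degree of \<open>h\<close> is the smallest possible one.  This borderline
  case is excluded by the degree of the first vertex of the second segment if \<open>k \<ge> 5\<close>, and for \<open>k = 3\<close>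
  by explicit paths in the only remaining graph structure, on eleven vertices.
\<close>

section \<open>Rerouting a maximal cycle\<close>

text \<open>The cycle is an \<open>n\<close>-periodic function on the naturals, so a turn may start
  at any position and cyclic order becomes the order of numbers. Maximality is by inclusion of
  vertex sets; a list is read as a cycle closing from its last entry to its first.\<close>

locale max_cycle =
  fixes E :: "'b \<Rightarrow> 'b \<Rightarrow> bool" and C :: "nat \<Rightarrow> 'b" and n :: nat
  assumes E_sym: "E a b \<Longrightarrow> E b a"
    and E_irrefl: "\<not> E a a"
    and n_pos: "n > 0"
    and C_period: "C (i + n) = C i"
    and C_inj: "inj_on C {..<n}"
    and C_edge: "E (C i) (C (Suc i))"
    and maximal: "\<lbrakk>distinct L; successively E L; E (last L) (hd L); range C \<subseteq> set L\<rbrakk> \<Longrightarrow> set L \<subseteq> range C"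
begin

section \<open>Cyclic positions and windows of one full turn\<close>

lemma E_comm: "E a b \<longleftrightarrow> E b a"
  by (rule iffI) (rule E_sym, assumption)+

lemma C_period_mult: "C (i + m * n) = C i"
proof (induction m)
  case (Suc m)
  have "C (i + Suc m * n) = C ((i + m * n) + n)" by (simp add: algebra_simps)
  then show ?case using C_period Suc.IH by simp
qed simp

lemma C_mod: "C i = C (i mod n)"
  using C_period_mult[of "i mod n" "i div n"] by simp

lemma C_eq_iff: "C i = C j \<longleftrightarrow> i mod n = j mod n"
proof
  assume "C i = C j"
  then have "C (i mod n) = C (j mod n)" using C_mod by metis
  then show "i mod n = j mod n" using C_inj n_pos by (auto simp: inj_on_def)
next
  assume "i mod n = j mod n"
  then show "C i = C j" using C_mod by metis
qed

lemma C_shift_cong: "C i = C j \<Longrightarrow> C (i + m) = C (j + m)"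
  by (metis C_eq_iff mod_add_left_eq)

lemma C_Suc_cong: "C i = C j \<Longrightarrow> C (Suc i) = C (Suc j)"
  using C_shift_cong[of i j 1] by simp

lemma C_pred_cong:
  assumes "C i = C j" "i \<ge> 1" "j \<ge> 1" shows "C (i - 1) = C (j - 1)"
proof -
  have "C (i + (n - 1)) = C (j + (n - 1))" using assms(1) by (rule C_shift_cong)
  moreover have "i + (n - 1) = (i - 1) + n" "j + (n - 1) = (j - 1) + n" using assms n_pos by auto
  ultimately show ?thesis by (simp add: C_period)
qed

lemma inj_on_window: "inj_on C {s<..s + n}"
proof (rule inj_onI)
  fix i j assume ij: "i \<in> {s<..s + n}" "j \<in> {s<..s + n}" "C i = C j"
  then have m: "i mod n = j mod n" by (simp add: C_eq_iff)
  have aux: "a = b" if "a \<le> b" "a \<in> {s<..s + n}" "b \<in> {s<..s + n}" "a mod n = b mod n" for a b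
  proof (rule ccontr)
    assume "a \<noteq> b"
    have "n dvd b - a" using that by (metis mod_eq_dvd_iff_nat)
    moreover have "b - a < n" "b - a > 0" using that \<open>a \<noteq> b\<close> by auto
    ultimately show False by (simp add: nat_dvd_not_less)
  qed
  show "i = j"
  proof (cases "i \<le> j")
    case True
    then show ?thesis using aux ij m by blast
  next
    case False
    then show ?thesis using aux[of j i] ij m by simp
  qed
qed

lemma range_window: "C ` {s<..s + n} = range C"
proof
  show "range C \<subseteq> C ` {s<..s + n}"
  proof
    fix v assume "v \<in> range C"
    have "range C \<subseteq> C ` {..<n}"
      using C_mod n_pos by (metis image_subsetI image_eqI lessThan_iff mod_less_divisor)
    then have fr: "finite (range C)" and le: "card (range C) \<le> n"
      using finite_subset by (blast, metis card_image_le card_lessThan card_mono finite_imageI finite_lessThan le_trans)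
    have "card (C ` {s<..s + n}) = n" using inj_on_window by (simp add: card_image)
    then have "C ` {s<..s + n} = range C"
      using fr le by (metis card_seteq image_mono top_greatest)
    then show "v \<in> C ` {s<..s + n}" using \<open>v \<in> range C\<close> by simp
  qed
qed auto

lemma bij_window: "bij_betw C {s<..s + n} (range C)"
  by (simp add: bij_betw_def inj_on_window range_window)

text \<open>Moves the second position into the turn that starts at \<open>i\<close>, so that this
  turn can be cut at both places.\<close>

lemma index_between:
  assumes "C i \<noteq> C j"
  obtains j' where "i < j'" "j' < i + n" "C j' = C j"
proof -
  have "C j \<in> C ` {i<..i + n}" by (simp add: range_window)
  then obtain j' where j': "i < j'" "j' \<le> i + n" "C j' = C j" by auto
  then have "j' \<noteq> i + n" using assms C_period by auto
  then show thesis using j' that by simp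
qed

lemma finite_range: "finite (range C)"
  using range_window[of 0] by (metis finite_imageI finite_greaterThanAtMost)

lemma card_range: "card (range C) = n"
  using bij_betw_same_card[OF bij_window[of 0]] by simp

section \<open>Cutting one turn into pieces\<close>

definition piece :: "nat \<Rightarrow> nat \<Rightarrow> 'b list" where
  "piece i j = map C [i..<j]"

lemma piece_facts:
  assumes "i < j"
  shows "piece i j \<noteq> []" "hd (piece i j) = C i" "last (piece i j) = C (j - 1)"
  using assms by (auto simp: piece_def hd_map last_map)

lemma piece_append: "i \<le> j \<Longrightarrow> j \<le> m \<Longrightarrow> piece i j @ piece j m = piece i m"
  by (metis piece_def le_add_diff_inverse map_append upt_add_eq_append)

lemma set_piece: "set (piece i j) = C ` {i..<j}"
  by (simp add: piece_def)

lemma successively_piece: "successively E (piece i j)"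
proof (induction j)
  case (Suc j)
  show ?case
  proof (cases "i < j")
    case True
    then have e: "piece i (Suc j) = piece i j @ [C j]" by (simp add: piece_def)
    have "E (C (j - 1)) (C j)" using C_edge[of "j - 1"] True by simp
    then show ?thesis using Suc True by (simp add: e successively_append_iff piece_facts)
  next
    case False
    then show ?thesis by (cases "i = j") (auto simp: piece_def)
  qed
qed (simp add: piece_def)

lemma successively_piece_conv: "successively (\<lambda>x y. E y x) (piece i j)"
  using successively_piece by (rule successively_mono) (rule E_sym)

lemma distinct_pieces2:
  assumes "s < i" "i \<le> s + n"
  shows "distinct (piece (Suc s) i @ piece i (Suc (s + n)))"
    and "set (piece (Suc s) i @ piece i (Suc (s + n))) = range C"
proof -
  have e: "piece (Suc s) i @ piece i (Suc (s + n)) = piece (Suc s) (Suc (s + n))"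
    using assms piece_append[of "Suc s" i "Suc (s + n)"] by simp
  have w: "{Suc s..<Suc (s + n)} = {s<..s + n}" by auto
  have "distinct (piece (Suc s) (Suc (s + n)))"
    unfolding piece_def distinct_map set_upt w by (intro conjI distinct_upt inj_on_window)
  then show "distinct (piece (Suc s) i @ piece i (Suc (s + n)))" unfolding e .
  show "set (piece (Suc s) i @ piece i (Suc (s + n))) = range C"
    unfolding e set_piece w by (rule range_window)
qed

lemma distinct_pieces3:
  assumes "s < i" "i \<le> j" "j \<le> s + n"
  shows "distinct (piece (Suc s) i @ piece i j @ piece j (Suc (s + n)))"
    and "set (piece (Suc s) i @ piece i j @ piece j (Suc (s + n))) = range C"
proof -
  have e: "piece i j @ piece j (Suc (s + n)) = piece i (Suc (s + n))"
    using assms by (intro piece_append) auto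
  show "distinct (piece (Suc s) i @ piece i j @ piece j (Suc (s + n)))"
    and "set (piece (Suc s) i @ piece i j @ piece j (Suc (s + n))) = range C"
    unfolding e by (rule distinct_pieces2; use assms in simp)+
qed

text \<open>Every rerouting ends here: the new cycle keeps all vertices of the old one and adds
  those of \<open>Q\<close>.\<close>

lemma no_extension:
  assumes "distinct L" "successively E L" "E (last L) (hd L)"
    and "set L = set Q \<union> range C" "set Q \<inter> range C = {}" "Q \<noteq> []"
  shows False
proof -
  have "set L \<subseteq> range C" by (rule maximal) (use assms in simp_all)
  then have "set Q = set Q \<inter> range C" using assms(4) by blast
  then show False using assms(5,6) by simp
qed

section \<open>Configurations excluded by rerouting\<close>

lemma no_insertion:
  assumes Q: "distinct Q" "successively E Q" "set Q \<inter> range C = {}" "Q \<noteq> []"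
    and e: "E (hd Q) (C i)" "E (last Q) (C (Suc i))"
  shows False
proof (rule no_extension[OF _ _ _ _ Q(3,4)])
  let ?A = "piece (Suc i) (Suc (i + n))"
  have d: "distinct ?A" "set ?A = range C"
    using distinct_pieces2[of i "Suc i"] n_pos piece_append[of "Suc i" "Suc i" "Suc (i + n)"] by auto
  show "distinct (Q @ ?A)" "set (Q @ ?A) = set Q \<union> range C" using d Q by auto
  show "successively E (Q @ ?A)"
    using Q e n_pos by (simp add: successively_append_iff successively_piece piece_facts)
  show "E (last (Q @ ?A)) (hd (Q @ ?A))"
    using Q e n_pos by (simp add: piece_facts C_period E_comm)
qed

text \<open>Run backwards from \<open>C j\<close> to \<open>C (Suc i)\<close>, take the supposed
  edge to \<open>C (Suc j)\<close>, run forwards to \<open>C i\<close> and return through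
  \<open>Q\<close>.\<close>

lemma successors_nonadjacent:
  assumes Q: "distinct Q" "successively E Q" "set Q \<inter> range C = {}" "Q \<noteq> []"
    and e: "E (hd Q) (C i)" "E (last Q) (C j)" and ij: "C i \<noteq> C j"
  shows "\<not> E (C (Suc i)) (C (Suc j))"
proof
  assume a: "E (C (Suc i)) (C (Suc j))"
  obtain j' where j': "i < j'" "j' < i + n" "C j' = C j" using index_between[OF ij] .
  let ?A = "piece (Suc i) (Suc j')" and ?B = "piece (Suc j') (Suc (i + n))"
  let ?L = "rev ?A @ ?B @ Q"
  have d: "distinct (?A @ ?B)" "set (?A @ ?B) = range C"
    using distinct_pieces2[of i "Suc j'"] j' by auto
  have a': "E (C (Suc i)) (C (Suc j'))" using a j' C_Suc_cong by metis
  show False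
  proof (rule no_extension[OF _ _ _ _ Q(3,4)])
    show "distinct ?L" "set ?L = set Q \<union> range C" using d Q by auto
    show "successively E ?L"
      using Q e j' a'
      by (simp add: successively_append_iff successively_piece successively_piece_conv piece_facts
          hd_rev last_rev C_period E_comm)
    show "E (last ?L) (hd ?L)"
      using Q e j' by (simp add: piece_facts hd_rev)
  qed
qed

text \<open>The mirror image for a single vertex: forwards from \<open>C (Suc i)\<close> to
  \<open>C j\<close>, over the edge to \<open>C i\<close>, backwards to \<open>C (Suc j)\<close>,
  then \<open>h\<close>.\<close>

lemma predecessors_nonadjacent:
  assumes e: "E h (C (Suc i))" "E h (C (Suc j))" and ij: "C i \<noteq> C j" and h: "h \<notin> range C"
  shows "\<not> E (C i) (C j)"
proof
  assume a: "E (C i) (C j)"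
  obtain j' where j': "i < j'" "j' < i + n" "C j' = C j" using index_between[OF ij] .
  let ?A = "piece (Suc i) (Suc j')" and ?B = "piece (Suc j') (Suc (i + n))"
  let ?L = "?A @ rev ?B @ [h]"
  have d: "distinct (?A @ ?B)" "set (?A @ ?B) = range C"
    using distinct_pieces2[of i "Suc j'"] j' by auto
  have e': "E h (C (Suc j'))" using e(2) j' C_Suc_cong by metis
  have a': "E (C j') (C i)" using a j' E_sym by metis
  show False
  proof (rule no_extension[of _ "[h]"])
    show "distinct ?L" "set ?L = set [h] \<union> range C" using d h by auto
    show "successively E ?L"
      using e' j' a'
      by (simp add: successively_append_iff successively_piece successively_piece_conv piece_facts
          hd_rev last_rev C_period E_comm)
    show "E (last ?L) (hd ?L)"
      using e j' by (simp add: piece_facts)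
  qed (use h in auto)
qed

text \<open>Both uncovered vertices are absorbed at once: \<open>h'\<close> joins the two successors
  in place of an edge, and \<open>h\<close> closes the cycle between \<open>C i\<close> and
  \<open>C j\<close>.\<close>

lemma two_absorbed:
  assumes h: "h \<notin> range C" "h' \<notin> range C" "h \<noteq> h'"
    and e: "E h (C i)" "E h (C j)" and ij: "C i \<noteq> C j"
    and e': "E h' (C (Suc i))" "E h' (C (Suc j))"
  shows False
proof -
  obtain j' where j': "i < j'" "j' < i + n" "C j' = C j" using index_between[OF ij] .
  let ?A = "piece (Suc i) (Suc j')" and ?B = "piece (Suc j') (Suc (i + n))"
  let ?L = "rev ?A @ [h'] @ ?B @ [h]"
  have d: "distinct (?A @ ?B)" "set (?A @ ?B) = range C"
    using distinct_pieces2[of i "Suc j'"] j' by auto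
  have a': "E h' (C (Suc j'))" "E h (C j')" using e(2) e'(2) j'(3) C_Suc_cong[of j' j] by simp_all
  show False
  proof (rule no_extension[of _ "[h, h']"])
    show "distinct ?L" "set ?L = set [h, h'] \<union> range C" using d h by auto
    show "successively E ?L"
      using j' a' e e'
      by (simp add: successively_append_iff successively_Cons successively_piece successively_piece_conv
          piece_facts hd_rev last_rev C_period E_comm)
    show "E (last ?L) (hd ?L)"
      using a' j' by (simp add: piece_facts hd_rev)
  qed (use h in auto)
qed

text \<open>The crossing lemmas exclude interleaved neighbours of the consecutive vertices
  \<open>C s\<close> and \<open>C (Suc s)\<close>; \<open>P\<close> marks a position after a
  neighbour of \<open>h\<close>, \<open>R\<close> one before such a neighbour. The cycle here:
  \<open>C (i - 1)\<close> back to \<open>C (Suc s)\<close>, \<open>C j\<close> up to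
  \<open>C s\<close>, \<open>C i\<close> up to \<open>C (j - 1)\<close>, then
  \<open>h\<close>.\<close>

lemma crossing_PP:
  assumes h: "h \<notin> range C"
    and ij: "Suc s < i" "i < j" "j \<le> s + n"
    and e: "E h (C (i - 1))" "E h (C (j - 1))" "E (C s) (C i)" "E (C (Suc s)) (C j)"
  shows False
proof -
  let ?A = "piece (Suc s) i" and ?B = "piece i j" and ?D = "piece j (Suc (s + n))"
  let ?L = "rev ?A @ ?D @ ?B @ [h]"
  have d: "distinct (?A @ ?B @ ?D)" "set (?A @ ?B @ ?D) = range C"
    using distinct_pieces3[of s i j] ij by auto
  show False
  proof (rule no_extension[of _ "[h]"])
    show "distinct ?L" "set ?L = set [h] \<union> range C" using d h by auto
    show "successively E ?L" "E (last ?L) (hd ?L)"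
      using ij e
      by (simp_all add: successively_append_iff successively_piece successively_piece_conv
          piece_facts hd_rev last_rev C_period E_comm)
  qed (use h in auto)
qed

text \<open>The cycle: \<open>C (Suc i)\<close> up to \<open>C j\<close>, \<open>C (Suc s)\<close>
  up to \<open>C i\<close>, \<open>C s\<close> back to \<open>C (Suc j)\<close>, then
  \<open>h\<close>.\<close>

lemma crossing_RR:
  assumes h: "h \<notin> range C"
    and ij: "s < i" "i < j" "j < s + n"
    and e: "E h (C (Suc i))" "E h (C (Suc j))" "E (C s) (C i)" "E (C (Suc s)) (C j)"
  shows False
proof -
  let ?A = "piece (Suc s) (Suc i)" and ?B = "piece (Suc i) (Suc j)" and ?D = "piece (Suc j) (Suc (s + n))"
  let ?L = "?B @ ?A @ rev ?D @ [h]"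
  have d: "distinct (?A @ ?B @ ?D)" "set (?A @ ?B @ ?D) = range C"
    using distinct_pieces3[of s "Suc i" "Suc j"] ij by auto
  show False
  proof (rule no_extension[of _ "[h]"])
    show "distinct ?L" "set ?L = set [h] \<union> range C" using d h by auto
    show "successively E ?L" "E (last ?L) (hd ?L)"
      using ij e
      by (simp_all add: successively_append_iff successively_piece successively_piece_conv
          piece_facts hd_rev last_rev C_period E_comm)
  qed (use h in auto)
qed

text \<open>Both ways of joining are excluded because the middle piece from \<open>C i\<close> to
  \<open>C j\<close> can be traversed in either direction.\<close>

lemma crossing_PR:
  assumes h: "h \<notin> range C"
    and ij: "Suc s < i" "i \<le> j" "j < s + n"
    and e: "E h (C (i - 1))" "E h (C (Suc j))"
    and f: "E (C s) (C i) \<and> E (C (Suc s)) (C j) \<or> E (C (Suc s)) (C i) \<and> E (C s) (C j)"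
  shows False
proof -
  let ?A = "piece (Suc s) i" and ?B = "piece i (Suc j)" and ?D = "piece (Suc j) (Suc (s + n))"
  let ?L = "?D @ ?B @ ?A @ [h]" and ?L' = "?D @ rev ?B @ ?A @ [h]"
  have d: "distinct (?A @ ?B @ ?D)" "set (?A @ ?B @ ?D) = range C"
    using distinct_pieces3[of s i "Suc j"] ij by auto
  from f show False
  proof
    assume f: "E (C s) (C i) \<and> E (C (Suc s)) (C j)"
    show False
    proof (rule no_extension[of _ "[h]"])
      show "distinct ?L" "set ?L = set [h] \<union> range C" using d h by auto
      show "successively E ?L" "E (last ?L) (hd ?L)"
        using ij e f
        by (simp_all add: successively_append_iff successively_piece successively_piece_conv
            piece_facts hd_rev last_rev C_period E_comm)
    qed (use h in auto)
  next
    assume f: "E (C (Suc s)) (C i) \<and> E (C s) (C j)"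
    show False
    proof (rule no_extension[of _ "[h]"])
      show "distinct ?L'" "set ?L' = set [h] \<union> range C" using d h by auto
      show "successively E ?L'" "E (last ?L') (hd ?L')"
        using ij e f
        by (simp_all add: successively_append_iff successively_piece successively_piece_conv
            piece_facts hd_rev last_rev C_period E_comm)
    qed (use h in auto)
  qed
qed

text \<open>The segment from \<open>C (Suc s)\<close> to \<open>C j\<close> is reversed and put
  between \<open>C m\<close> and \<open>C (Suc m)\<close>; \<open>h\<close> fills the gap left
  between \<open>C s\<close> and \<open>C (Suc j)\<close>.\<close>

lemma segment_relocation:
  assumes h: "h \<notin> range C"
    and ij: "s < j" "j < m" "Suc m < s + n"
    and e: "E h (C s)" "E h (C (Suc j))"
    and f: "E (C j) (C m)" "E (C (Suc s)) (C (Suc m))"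
  shows False
proof -
  let ?A = "piece (Suc s) (Suc j)" and ?B = "piece (Suc j) (Suc m)" and ?D = "piece (Suc m) (Suc (s + n))"
  let ?L = "?B @ rev ?A @ ?D @ [h]"
  have d: "distinct (?A @ ?B @ ?D)" "set (?A @ ?B @ ?D) = range C"
    using distinct_pieces3[of s "Suc j" "Suc m"] ij by auto
  show False
  proof (rule no_extension[of _ "[h]"])
    show "distinct ?L" "set ?L = set [h] \<union> range C" using d h by auto
    show "successively E ?L" "E (last ?L) (hd ?L)"
      using ij e f
      by (simp_all add: successively_append_iff successively_piece successively_piece_conv
          piece_facts hd_rev last_rev C_period E_comm)
  qed (use h in auto)
qed

end

section \<open>Neighbourhood of an uncovered vertex\<close>

lemma two_elements:
  assumes "2 \<le> card A" obtains p q where "p \<in> A" "q \<in> A" "p \<noteq> q"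
proof -
  have "finite A" using assms by (metis card.infinite not_numeral_le_zero)
  moreover have "\<not> card A \<le> Suc 0" using assms by simp
  ultimately show thesis using card_le_Suc0_iff_eq[of A] that by blast
qed

text \<open>\<open>C 0\<close> is the new vertex joined to the two ends, and \<open>W\<close> is the vertex set of the original graph.\<close>
locale counterexample = max_cycle E C n
  for E :: "'b \<Rightarrow> 'b \<Rightarrow> bool" and C :: "nat \<Rightarrow> 'b" and n :: nat +
  fixes W :: "'b set" and h :: 'b and k :: nat
  assumes finite_W: "finite W"
    and range_W: "range C - {C 0} \<subseteq> W"
    and C0_W: "C 0 \<notin> W"
    and edge_W: "E a b \<Longrightarrow> a = C 0 \<or> a \<in> W"
    and C0_neighbours: "E (C 0) v \<longleftrightarrow> v = C 1 \<or> v = C (n - 1)"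
    and n3: "n \<ge> 3"
    and h_W: "h \<in> W" and h_off: "h \<notin> range C"
    and off_independent: "\<lbrakk>u \<in> W - range C; v \<in> W - range C\<rbrakk> \<Longrightarrow> \<not> E u v"
    and free: "\<lbrakk>E a b; a \<in> W; b \<in> W; S \<subseteq> W; independent E S; \<forall>s\<in>S. \<not> E a s \<and> \<not> E b s\<rbrakk> \<Longrightarrow> card S < k"
    and degree_W: "v \<in> W \<Longrightarrow> 3 * k \<le> 2 * card {u \<in> W. E v u} + 1"
    and alpha: "\<lbrakk>S \<subseteq> W; independent E S\<rbrakk> \<Longrightarrow> 2 * card S < card W"
    and k2: "k \<ge> 2"
    and orientation: "E h (C (n - 1)) \<Longrightarrow> E h (C 1)"
begin

text \<open>\<open>C 0\<close> is excluded because it is no vertex of the original graph, to which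
  freeness and degrees refer. \<open>Is\<close> and \<open>Js\<close> below are the sets
  \<open>I\<^sup>*\<close> and \<open>J\<^sup>*\<close> of the overview.\<close>

definition PV where "PV = {v. \<exists>i. v = C (Suc i) \<and> E h (C i) \<and> v \<noteq> C 0}"
definition RV where "RV = {v. \<exists>i. v = C i \<and> E h (C (Suc i)) \<and> v \<noteq> C 0}"
definition I where "I = insert h PV"
definition J where "J = insert h RV"
definition Is where "Is = {v \<in> W. \<forall>s\<in>I. \<not> E v s}"
definition Js where "Js = {v \<in> W. \<forall>s\<in>J. \<not> E v s}"
definition D where "D = Is \<inter> Js"

lemma C_eq_C0_iff: "C i = C 0 \<longleftrightarrow> n dvd i"
  by (simp add: C_eq_iff dvd_eq_mod_eq_0)

lemma C_neq_C0: "0 < i \<Longrightarrow> i < n \<Longrightarrow> C i \<noteq> C 0"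
  by (simp add: C_eq_C0_iff nat_dvd_not_less)

lemma C_n: "C n = C 0"
  using C_period[of 0] by simp

lemma C_W: "C i \<noteq> C 0 \<Longrightarrow> C i \<in> W"
  using range_W by auto

lemma C_W_iff: "C i \<in> W \<longleftrightarrow> C i \<noteq> C 0"
  using C_W C0_W by auto

lemma h_neq: "C i \<noteq> h"
  using h_off by auto

lemma h_C0: "\<not> E h (C 0)" "\<not> E (C 0) h"
  using C0_neighbours[of h] h_neq E_comm by metis+

lemma PV_iff: "C (Suc i) \<in> PV \<longleftrightarrow> E h (C i) \<and> C (Suc i) \<noteq> C 0"
proof
  assume "C (Suc i) \<in> PV"
  then obtain j where j: "C (Suc i) = C (Suc j)" "E h (C j)" "C (Suc i) \<noteq> C 0" by (auto simp: PV_def)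
  have "C i = C j" using C_pred_cong[OF j(1)] by simp
  then show "E h (C i) \<and> C (Suc i) \<noteq> C 0" using j by simp
qed (auto simp: PV_def)

lemma PV_iff': "0 < i \<Longrightarrow> C i \<in> PV \<longleftrightarrow> E h (C (i - 1)) \<and> C i \<noteq> C 0"
  using PV_iff[of "i - 1"] by simp

lemma RV_iff: "C i \<in> RV \<longleftrightarrow> E h (C (Suc i)) \<and> C i \<noteq> C 0"
proof
  assume "C i \<in> RV"
  then obtain j where j: "C i = C j" "E h (C (Suc j))" "C i \<noteq> C 0" by (auto simp: RV_def)
  have "C (Suc i) = C (Suc j)" using C_Suc_cong[OF j(1)] .
  then show "E h (C (Suc i)) \<and> C i \<noteq> C 0" using j by simp
qed (auto simp: RV_def)

lemma not_consecutive: "E h (C i) \<Longrightarrow> \<not> E h (C (Suc i))"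
  using no_insertion[of "[h]" i] h_off by auto

lemma PV_not_h: "v \<in> PV \<Longrightarrow> \<not> E h v"
  using not_consecutive by (auto simp: PV_def)

lemma RV_not_h: "v \<in> RV \<Longrightarrow> \<not> E h v"
  using not_consecutive by (auto simp: RV_def)

lemma PV_range: "PV \<subseteq> range C" and RV_range: "RV \<subseteq> range C"
  by (auto simp: PV_def RV_def)

lemma PV_W: "PV \<subseteq> W" and RV_W: "RV \<subseteq> W"
  by (auto simp: PV_def RV_def C_W)

lemma finite_PV: "finite PV" and finite_RV: "finite RV"
  using PV_W RV_W finite_W finite_subset by blast+

lemma independent_I: "independent E I"
proof -
  have "\<not> E u v" if uv: "u \<in> PV" "v \<in> PV" for u v
  proof -
    obtain i j where ij: "u = C (Suc i)" "E h (C i)" "v = C (Suc j)" "E h (C j)"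
      using uv by (auto simp: PV_def)
    show ?thesis
    proof (cases "C i = C j")
      case True
      then show ?thesis using ij C_Suc_cong[OF True] E_irrefl by simp
    next
      case False
      then show ?thesis using successors_nonadjacent[of "[h]" i j] ij h_off by simp
    qed
  qed
  moreover have "\<not> E v h" if "v \<in> PV" for v using PV_not_h[OF that] E_comm[of v h] by simp
  ultimately show ?thesis using PV_not_h E_irrefl by (auto simp: independent_def I_def)
qed

lemma independent_J: "independent E J"
proof -
  have "\<not> E u v" if uv: "u \<in> RV" "v \<in> RV" for u v
  proof -
    obtain i j where ij: "u = C i" "E h (C (Suc i))" "v = C j" "E h (C (Suc j))"
      using uv by (auto simp: RV_def)
    show ?thesis
    proof (cases "C i = C j")
      case True
      then show ?thesis using ij E_irrefl by simp
    next
      case False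
      then show ?thesis using predecessors_nonadjacent[of h i j] ij h_off by simp
    qed
  qed
  moreover have "\<not> E v h" if "v \<in> RV" for v using RV_not_h[OF that] E_comm[of v h] by simp
  ultimately show ?thesis using RV_not_h E_irrefl by (auto simp: independent_def J_def)
qed

text \<open>The members of \<open>S\<close> not adjacent to \<open>v\<close> are independent and
  miss both ends of the edge from \<open>v\<close> to \<open>s\<close>, so freeness leaves fewer
  than \<open>k\<close> of them.\<close>

lemma neighbour_count:
  assumes "independent E S" "S \<subseteq> W" "v \<in> W" "s \<in> S" "E v s"
  shows "card S < k + card {t \<in> S. E v t}"
proof -
  have fS: "finite S" using assms finite_W finite_subset by blast
  have "card {t \<in> S. \<not> E v t} < k"
    using assms by (intro free[of v s]) (auto simp: independent_def)
  moreover have "card S = card {t \<in> S. E v t} + card {t \<in> S. \<not> E v t}"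
  proof -
    have "S = {t \<in> S. E v t} \<union> {t \<in> S. \<not> E v t}" by auto
    then show ?thesis using fS card_Un_disjoint[of "{t \<in> S. E v t}" "{t \<in> S. \<not> E v t}"] by auto
  qed
  ultimately show ?thesis by simp
qed

section \<open>The degree of \<open>h\<close> and the sizes of \<open>PV\<close> and
  \<open>RV\<close>\<close>

lemma h_neighbours: "{u \<in> W. E h u} = C ` {i \<in> {1..<n}. E h (C i)}"
proof
  show "{u \<in> W. E h u} \<subseteq> C ` {i \<in> {1..<n}. E h (C i)}"
  proof
    fix u assume u: "u \<in> {u \<in> W. E h u}"
    then have "u \<in> range C" using off_independent[of h u] h_W h_off by auto
    then obtain i where i: "u = C (i mod n)" using C_mod by blast
    have "i mod n \<noteq> 0" using u h_C0(1) i by (metis mem_Collect_eq)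
    moreover have "i mod n < n" using n_pos by simp
    ultimately show "u \<in> C ` {i \<in> {1..<n}. E h (C i)}" using i u by (intro image_eqI[of _ _ "i mod n"]) auto
  qed
qed (auto simp: C_W C_neq_C0)

definition d where "d = card {i \<in> {1..<n}. E h (C i)}"

lemma inj_1n: "inj_on C {1..<n}"
  using C_inj by (rule inj_on_subset) auto

lemma d_degree: "card {u \<in> W. E h u} = d"
  unfolding h_neighbours d_def by (rule card_image) (rule inj_on_subset[OF inj_1n], auto)

lemma PV_image: "PV = C ` Suc ` {i \<in> {1..<n - 1}. E h (C i)}"
proof
  show "PV \<subseteq> C ` Suc ` {i \<in> {1..<n - 1}. E h (C i)}"
  proof
    fix v assume "v \<in> PV"
    then obtain i where i: "v = C (Suc i)" "E h (C i)" "v \<noteq> C 0" by (auto simp: PV_def)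
    define j where "j = i mod n"
    have j: "C i = C j" "C (Suc i) = C (Suc j)" "j < n"
      using C_mod[of i] C_Suc_cong[of i "i mod n"] n_pos unfolding j_def by (blast, blast, simp)
    have "j \<noteq> 0" using i(2) j(1) h_C0(1) by metis
    moreover have "Suc j \<noteq> n" using i(1,3) j(2) C_n by metis
    ultimately show "v \<in> C ` Suc ` {i \<in> {1..<n - 1}. E h (C i)}" using i j by auto
  qed
qed (auto simp: PV_def C_neq_C0)

lemma RV_image: "RV = C ` (\<lambda>i. i - 1) ` {i \<in> {2..<n}. E h (C i)}"
proof
  show "RV \<subseteq> C ` (\<lambda>i. i - 1) ` {i \<in> {2..<n}. E h (C i)}"
  proof
    fix v assume "v \<in> RV"
    then obtain i where i: "v = C i" "E h (C (Suc i))" "v \<noteq> C 0" by (auto simp: RV_def)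
    define j where "j = i mod n"
    have j: "C i = C j" "C (Suc i) = C (Suc j)" "j < n"
      using C_mod[of i] C_Suc_cong[of i "i mod n"] n_pos unfolding j_def by (blast, blast, simp)
    have "j \<noteq> 0" using i(1,3) j(1) by metis
    moreover have "Suc j \<noteq> n" using i(2) j(2) C_n h_C0(1) by metis
    ultimately have "Suc j \<in> {i \<in> {2..<n}. E h (C i)}" "v = C (Suc j - 1)" using i j by auto
    then show "v \<in> C ` (\<lambda>i. i - 1) ` {i \<in> {2..<n}. E h (C i)}" by blast
  qed
qed (auto simp: RV_def C_neq_C0)

lemma card_PV: "card PV = card {i \<in> {1..<n - 1}. E h (C i)}"
proof -
  have "inj_on C (Suc ` {i \<in> {1..<n - 1}. E h (C i)})" by (rule inj_on_subset[OF inj_1n]) auto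
  then show ?thesis unfolding PV_image by (simp add: card_image)
qed

lemma card_RV: "card RV = card {i \<in> {2..<n}. E h (C i)}"
proof -
  have "inj_on C ((\<lambda>i. i - 1) ` {i \<in> {2..<n}. E h (C i)})" by (rule inj_on_subset[OF inj_1n]) auto
  moreover have "inj_on (\<lambda>i::nat. i - 1) {i \<in> {2..<n}. E h (C i)}" by (auto simp: inj_on_def)
  ultimately show ?thesis unfolding RV_image by (simp add: card_image)
qed

text \<open>Only a neighbour of \<open>h\<close> at position \<open>n - 1\<close> contributes
  nothing to \<open>PV\<close>, its successor being \<open>C 0\<close>; for \<open>RV\<close>
  position 1 has this role.\<close>

lemma card_PV_d: "d = card PV + (if E h (C (n - 1)) then 1 else 0)"
proof -
  have "{i \<in> {1..<n}. E h (C i)} =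
      {i \<in> {1..<n - 1}. E h (C i)} \<union> (if E h (C (n - 1)) then {n - 1} else {})"
    using n3 by (auto simp: less_Suc_eq) (metis One_nat_def Suc_pred less_Suc_eq n_pos)+
  moreover have "n - 1 \<notin> {i \<in> {1..<n - 1}. E h (C i)}" by auto
  ultimately show ?thesis unfolding d_def card_PV by simp
qed

lemma card_RV_d: "d = card RV + (if E h (C 1) then 1 else 0)"
proof -
  have "{i \<in> {1..<n}. E h (C i)} = {i \<in> {2..<n}. E h (C i)} \<union> (if E h (C 1) then {1} else {})"
    using n3 by (auto simp: Suc_le_eq numeral_2_eq_2) (metis Suc_lessI)+
  moreover have "1 \<notin> {i \<in> {2..<n}. E h (C i)}" by auto
  ultimately show ?thesis unfolding d_def card_RV by simp
qed

lemma d_bound: "3 * k \<le> 2 * d + 1"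
  using degree_W[OF h_W] d_degree by simp

lemma card_RV_PV: "card RV \<le> card PV"
  using card_PV_d card_RV_d orientation by (auto split: if_splits)

lemma RV_bound: "3 * k \<le> 2 * card RV + 3"
  using card_RV_d d_bound by (auto split: if_splits)

text \<open>In the second alternative less of the degree bound on \<open>h\<close> is lost when it
  is passed to \<open>PV\<close> and \<open>RV\<close>; this is what later excludes that
  alternative.\<close>

lemma end_cases:
  "(E h (C 1) \<and> E h (C (n - 1)) \<and> card RV = card PV \<and> d = card PV + 1)
   \<or> (\<not> E h (C (n - 1)) \<and> 3 * k \<le> 2 * card PV + 1 \<and> 3 * k \<le> card PV + card RV + 2)"
  using card_PV_d card_RV_d d_bound orientation by (auto split: if_splits)

lemma k_le_RV: "k \<le> card RV"
  using RV_bound k2 by simp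

lemma k_le_PV: "k \<le> card PV"
  using k_le_RV card_RV_PV by simp

lemma card_I: "card I = card PV + 1" and card_J: "card J = card RV + 1"
  using finite_PV finite_RV PV_range RV_range h_off by (auto simp: I_def J_def card_insert_if)

lemma I_W: "I \<subseteq> W" and J_W: "J \<subseteq> W"
  using PV_W RV_W h_W by (auto simp: I_def J_def)

lemma I_Is: "I \<subseteq> Is" and J_Js: "J \<subseteq> Js"
  using independent_I independent_J I_W J_W by (auto simp: Is_def Js_def independent_def)

lemma Is_W: "Is \<subseteq> W" and Js_W: "Js \<subseteq> W"
  by (auto simp: Is_def Js_def)

text \<open>\<open>I\<close> has more than \<open>k\<close> elements, so an edge inside
  \<open>Is\<close> together with \<open>I\<close> would violate freeness.\<close>

lemma independent_Is: "independent E Is"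
proof -
  have False if "u \<in> Is" "v \<in> Is" "E u v" for u v
    using free[of u v I] that I_W independent_I card_I k_le_PV by (force simp: Is_def)
  then show ?thesis by (auto simp: independent_def)
qed

lemma independent_Js: "independent E Js"
proof -
  have False if "u \<in> Js" "v \<in> Js" "E u v" for u v
    using free[of u v J] that J_W independent_J card_J k_le_RV by (force simp: Js_def)
  then show ?thesis by (auto simp: independent_def)
qed

lemma Is_edge: "u \<in> Is \<Longrightarrow> E u v \<Longrightarrow> v \<notin> Is" and Js_edge: "u \<in> Js \<Longrightarrow> E u v \<Longrightarrow> v \<notin> Js"
  using independent_Is independent_Js by (auto simp: independent_def)

lemma D_W: "D \<subseteq> W" and finite_D: "finite D" and h_D: "h \<in> D"
  using Is_W finite_W finite_subset I_Is J_Js by (auto simp: D_def I_def J_def)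

lemma not_Is_neighbour: "v \<in> W \<Longrightarrow> v \<notin> Is \<Longrightarrow> \<not> E v h \<Longrightarrow> \<exists>s\<in>PV. E v s"
  by (auto simp: Is_def I_def)

lemma not_Js_neighbour: "v \<in> W \<Longrightarrow> v \<notin> Js \<Longrightarrow> \<not> E v h \<Longrightarrow> \<exists>s\<in>RV. E v s"
  by (auto simp: Js_def J_def)

lemma neighbour_not_Is: "s \<in> PV \<Longrightarrow> E v s \<Longrightarrow> v \<notin> Is" "E h v \<Longrightarrow> v \<notin> Is"
  by (auto simp: Is_def I_def dest: E_sym)

lemma neighbour_not_Js: "s \<in> RV \<Longrightarrow> E v s \<Longrightarrow> v \<notin> Js" "E h v \<Longrightarrow> v \<notin> Js"
  by (auto simp: Js_def J_def dest: E_sym)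

text \<open>Positions in the window of length \<open>n\<close> after \<open>s\<close>: their order is the cyclic order seen from \<open>C s\<close>.\<close>
definition Np where "Np s v = {i \<in> {s<..s + n}. C i \<in> PV \<and> E v (C i)}"
definition Mp where "Mp s v = {i \<in> {s<..s + n}. C i \<in> RV \<and> E v (C i)}"

lemma card_window: "Q \<subseteq> range C \<Longrightarrow> card {i \<in> {s<..s + n}. C i \<in> Q} = card Q"
proof -
  assume Q: "Q \<subseteq> range C"
  have "C ` {i \<in> {s<..s + n}. C i \<in> Q} = C ` {s<..s + n} \<inter> Q" by auto
  then have "C ` {i \<in> {s<..s + n}. C i \<in> Q} = Q" using Q by (simp add: range_window Int_absorb1)
  moreover have "inj_on C {i \<in> {s<..s + n}. C i \<in> Q}"
    by (rule inj_on_subset[OF inj_on_window]) auto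
  ultimately show ?thesis by (metis card_image)
qed

lemma card_Np: "card (Np s v) = card {p \<in> PV. E v p}"
  using card_window[of "{p \<in> PV. E v p}" s] PV_range by (auto simp: Np_def)

lemma card_Mp: "card (Mp s v) = card {p \<in> RV. E v p}"
  using card_window[of "{p \<in> RV. E v p}" s] RV_range by (auto simp: Mp_def)

lemma finite_Np: "finite (Np s v)" and finite_Mp: "finite (Mp s v)"
  by (auto simp: Np_def Mp_def)

section \<open>Lower bounds for the numbers of neighbours in \<open>PV\<close> and
  \<open>RV\<close>\<close>

lemma Np_card_X:
  assumes "v \<in> W" "E v h" shows "card PV + 1 \<le> card (Np s v) + k"
proof -
  have "card I < k + card {t \<in> I. E v t}"
    using neighbour_count[of I v h] assms independent_I I_W by (auto simp: I_def)
  moreover have "{t \<in> I. E v t} = insert h {p \<in> PV. E v p}" using assms by (auto simp: I_def)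
  then have "card {t \<in> I. E v t} \<le> card {p \<in> PV. E v p} + 1"
    using finite_PV by (simp add: card_insert_if)
  ultimately show ?thesis using card_I card_Np by simp
qed

text \<open>All neighbours counted in \<open>I\<close> lie in \<open>PV\<close> here; in
  \<open>Np_card_X\<close> one of them is \<open>h\<close>, so the bound there is smaller by
  one.\<close>

lemma Np_card:
  assumes "v \<in> W" "v \<notin> Is" "\<not> E v h" shows "card PV + 2 \<le> card (Np s v) + k"
proof -
  obtain p where "p \<in> PV" "E v p" using not_Is_neighbour assms by blast
  then have "card I < k + card {t \<in> I. E v t}"
    using neighbour_count[of I v p] assms independent_I I_W by (auto simp: I_def)
  moreover have "{t \<in> I. E v t} = {p \<in> PV. E v p}" using assms by (auto simp: I_def)
  ultimately show ?thesis using card_I card_Np by simp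
qed

lemma Mp_card:
  assumes "v \<in> W" "v \<notin> Js" "\<not> E v h" shows "card RV + 2 \<le> card (Mp s v) + k"
proof -
  obtain p where "p \<in> RV" "E v p" using not_Js_neighbour assms by blast
  then have "card J < k + card {t \<in> J. E v t}"
    using neighbour_count[of J v p] assms independent_J J_W by (auto simp: J_def)
  moreover have "{t \<in> J. E v t} = {p \<in> RV. E v p}" using assms by (auto simp: J_def)
  ultimately show ?thesis using card_J card_Mp by simp
qed

text \<open>\<open>D\<close> lies in the independent set \<open>Js\<close>, so \<open>v\<close> has
  no neighbour in \<open>D\<close>; counting in \<open>I \<union> D\<close> instead of
  \<open>I\<close> therefore sharpens the bound.\<close>

lemma Np_card_D:
  assumes "v \<in> Js" "v \<notin> Is" shows "card (I \<union> D) + 1 \<le> card (Np s v) + k"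
proof -
  have vW: "v \<in> W" and vh: "\<not> E v h" using assms by (auto simp: Js_def J_def)
  obtain p where p: "p \<in> PV" "E v p" using not_Is_neighbour assms vW vh by blast
  have "independent E (I \<union> D)" using independent_Is I_Is by (auto simp: independent_def D_def)
  then have "card (I \<union> D) < k + card {t \<in> I \<union> D. E v t}"
    using neighbour_count[of "I \<union> D" v p] vW p I_W D_W by (auto simp: I_def)
  moreover have "{t \<in> I \<union> D. E v t} = {p \<in> PV. E v p}"
    using vh Js_edge[OF assms(1)] by (auto simp: I_def D_def)
  ultimately show ?thesis using card_Np by simp
qed

lemma Mp_card_D:
  assumes "v \<in> Is" "v \<notin> Js" shows "card (J \<union> D) + 1 \<le> card (Mp s v) + k"
proof -
  have vW: "v \<in> W" and vh: "\<not> E v h" using assms by (auto simp: Is_def I_def)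
  obtain p where p: "p \<in> RV" "E v p" using not_Js_neighbour assms vW vh by blast
  have "independent E (J \<union> D)" using independent_Js J_Js by (auto simp: independent_def D_def)
  then have "card (J \<union> D) < k + card {t \<in> J \<union> D. E v t}"
    using neighbour_count[of "J \<union> D" v p] vW p J_W D_W by (auto simp: J_def)
  moreover have "{t \<in> J \<union> D. E v t} = {p \<in> RV. E v p}"
    using vh Is_edge[OF assms(1)] by (auto simp: J_def D_def)
  ultimately show ?thesis using card_Mp by simp
qed

text \<open>An uncovered \<open>v\<close> other than \<open>h\<close> and outside \<open>Is\<close>
  would have two neighbours in \<open>PV\<close>, and \<open>two_absorbed\<close> would absorb
  \<open>v\<close> and \<open>h\<close> together. For \<open>Js\<close> the two exchange
  roles.\<close>

lemma off_D: "v \<in> W \<Longrightarrow> v \<notin> range C \<Longrightarrow> v \<in> D"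
proof -
  assume v: "v \<in> W" "v \<notin> range C"
  have nh: "\<not> E v h" using off_independent[of v h] v h_W h_off by auto
  have "v \<in> D" if vh: "v \<noteq> h"
  proof -
    have "v \<in> Is"
    proof (rule ccontr)
      assume "v \<notin> Is"
      then have "2 \<le> card {p \<in> PV. E v p}"
        using Np_card[of v 0] v nh k_le_PV card_Np[of 0 v] by simp
      then obtain p q where pq: "p \<in> PV" "E v p" "q \<in> PV" "E v q" "p \<noteq> q"
        by (rule two_elements) blast
      obtain i j where ij: "p = C (Suc i)" "E h (C i)" "q = C (Suc j)" "E h (C j)"
        using pq by (auto simp: PV_def)
      have "C i \<noteq> C j" using ij pq(5) C_Suc_cong[of i j] by blast
      then show False using two_absorbed[of h v i j] pq v vh h_off ij by simp
    qed
    moreover have "v \<in> Js"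
    proof (rule ccontr)
      assume "v \<notin> Js"
      then have "2 \<le> card {p \<in> RV. E v p}"
        using Mp_card[of v 0] v nh k_le_RV card_Mp[of 0 v] by simp
      then obtain p q where pq: "p \<in> RV" "E v p" "q \<in> RV" "E v q" "p \<noteq> q"
        by (rule two_elements) blast
      obtain i j where ij: "p = C i" "E h (C (Suc i))" "q = C j" "E h (C (Suc j))"
        using pq by (auto simp: RV_def)
      have "C i \<noteq> C j" using ij pq(5) by simp
      then show False using two_absorbed[of v h i j] pq v vh h_off ij by simp
    qed
    ultimately show ?thesis by (simp add: D_def)
  qed
  then show ?thesis using h_D by blast
qed

section \<open>Comparing \<open>PV\<close> and \<open>RV\<close> along the cycle\<close>

definition cP where "cP s b = card {i \<in> {s<..b}. C i \<in> PV}"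
definition cR where "cR s b = card {i \<in> {s<..b}. C i \<in> RV}"

lemma cP_Suc: "s \<le> b \<Longrightarrow> cP s (Suc b) = cP s b + (if C (Suc b) \<in> PV then 1 else 0)"
proof -
  assume "s \<le> b"
  then have "{i \<in> {s<..Suc b}. C i \<in> PV} =
      {i \<in> {s<..b}. C i \<in> PV} \<union> (if C (Suc b) \<in> PV then {Suc b} else {})"
    by (auto simp: le_Suc_eq)
  then show ?thesis by (simp add: cP_def)
qed

lemma cR_Suc: "s \<le> b \<Longrightarrow> cR s (Suc b) = cR s b + (if C (Suc b) \<in> RV then 1 else 0)"
proof -
  assume "s \<le> b"
  then have "{i \<in> {s<..Suc b}. C i \<in> RV} =
      {i \<in> {s<..b}. C i \<in> RV} \<union> (if C (Suc b) \<in> RV then {Suc b} else {})"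
    by (auto simp: le_Suc_eq)
  then show ?thesis by (simp add: cR_def)
qed

lemma C_Suc_C0:
  assumes "C (Suc b) = C 0" shows "C b = C (n - 1)" "C (Suc (Suc b)) = C 1"
proof -
  show "C (Suc (Suc b)) = C 1" using C_Suc_cong[OF assms] by simp
  have "C (Suc b) = C n" using assms C_n by simp
  then show "C b = C (n - 1)" using C_pred_cong[of "Suc b" n] n_pos by simp
qed

text \<open>Each segment between consecutive neighbours of \<open>h\<close> opens with an element of \<open>PV\<close> and closes
  with an element of \<open>RV\<close>; by \<open>orientation\<close> the segment through \<open>C 0\<close> cannot have the latter without
  the former.  The second conjunct covers the case that \<open>b\<close> lies inside a segment.\<close>
lemma cR_le_cP_aux:
  assumes "s \<le> b" "e = (if E h (C s) then 0 else 1)"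
  shows "cR s b \<le> cP s b + e \<and> (\<not> E h (C b) \<and> \<not> E h (C (Suc b)) \<longrightarrow> cR s b + 1 \<le> cP s b + e)"
  using assms(1)
proof (induction b rule: dec_induct)
  case base
  then show ?case using assms(2) by (simp add: cP_def cR_def)
next
  case (step b)
  have P: "C (Suc b) \<in> PV \<longleftrightarrow> E h (C b) \<and> C (Suc b) \<noteq> C 0" by (rule PV_iff)
  have R: "C (Suc b) \<in> RV \<longleftrightarrow> E h (C (Suc (Suc b))) \<and> C (Suc b) \<noteq> C 0" by (rule RV_iff)
  show ?case
  proof (cases "C (Suc b) = C 0")
    case True
    then show ?thesis
      using step P R C_Suc_C0[OF True] orientation h_C0 by (simp add: cP_Suc cR_Suc) metis
  next
    case False
    then show ?thesis
      using step P R not_consecutive[of b] not_consecutive[of "Suc b"]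
      by (auto simp: cP_Suc cR_Suc)
  qed
qed

lemma cR_le_cP: "s \<le> b \<Longrightarrow> cR s b \<le> cP s b + 1"
  using cR_le_cP_aux[of s b] by (auto split: if_splits)

lemma cR_le_cP_X: "s \<le> b \<Longrightarrow> E h (C s) \<Longrightarrow> cR s b \<le> cP s b"
  using cR_le_cP_aux[of s b] by auto

lemma cP_window: "cP s (s + n) = card PV"
  unfolding cP_def by (rule card_window[OF PV_range])

lemma cP_split: "s \<le> b \<Longrightarrow> b \<le> c \<Longrightarrow> cP s c = cP s b + cP b c"
proof -
  assume a: "s \<le> b" "b \<le> c"
  have "{i \<in> {s<..c}. C i \<in> PV} = {i \<in> {s<..b}. C i \<in> PV} \<union> {i \<in> {b<..c}. C i \<in> PV}"
    using a by auto
  moreover have "card ({i \<in> {s<..b}. C i \<in> PV} \<union> {i \<in> {b<..c}. C i \<in> PV})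
      = card {i \<in> {s<..b}. C i \<in> PV} + card {i \<in> {b<..c}. C i \<in> PV}"
    by (rule card_Un_disjoint) auto
  ultimately show ?thesis by (simp add: cP_def)
qed

section \<open>Upper bounds for ordered families of positions\<close>

lemma card_le_overlap:
  fixes A B :: "nat set"
  assumes "finite S" "A \<subseteq> S" "B \<subseteq> S" "\<forall>i\<in>A. \<forall>j\<in>B. i \<le> j"
  shows "card A + card B \<le> card S + 1"
proof -
  have f: "finite A" "finite B" using assms finite_subset by blast+
  have "x = y" if "x \<in> A \<inter> B" "y \<in> A \<inter> B" for x y using assms(4) that by (meson IntD1 IntD2 antisym)
  then have "card (A \<inter> B) \<le> 1" using f by (simp add: card_le_Suc0_iff_eq)
  moreover have "card (A \<union> B) \<le> card S" using assms by (intro card_mono) auto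
  ultimately show ?thesis using card_Un_Int[OF f] by simp
qed

text \<open>Cut just before \<open>Min A2\<close>. Up to the cut \<open>RV\<close> exceeds
  \<open>PV\<close> by at most one, and not at all if the turn starts at a neighbour of
  \<open>h\<close>; after the cut \<open>A2\<close> and \<open>A3\<close> share at most one
  position.\<close>

lemma chain_RPP:
  assumes A: "A1 \<subseteq> {i \<in> {s<..s + n}. C i \<in> RV}" "A2 \<subseteq> {i \<in> {s<..s + n}. C i \<in> PV}"
      "A3 \<subseteq> {i \<in> {s<..s + n}. C i \<in> PV}"
    and o: "\<forall>i\<in>A1. \<forall>j\<in>A2. i < j" "\<forall>i\<in>A2. \<forall>j\<in>A3. i \<le> j" "A2 \<noteq> {}"
  shows "card A1 + card A2 + card A3 \<le> card PV + (if E h (C s) then 1 else 2)"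
proof -
  define b where "b = Min A2 - 1"
  have f: "finite A2" using A(2) finite_subset by fastforce
  have m: "Min A2 \<in> A2" using f o by simp
  then have b: "s \<le> b" "b < s + n" "Suc b = Min A2" using A(2) by (auto simp: b_def)
  have "A1 \<subseteq> {i \<in> {s<..b}. C i \<in> RV}" using A(1) o(1) m b(3) by fastforce
  then have 1: "card A1 \<le> cR s b" unfolding cR_def by (intro card_mono) auto
  have "A2 \<subseteq> {i \<in> {b<..s + n}. C i \<in> PV}" using A(2) f b(3) by (auto simp: Suc_le_eq[symmetric])
  moreover have "A3 \<subseteq> {i \<in> {b<..s + n}. C i \<in> PV}" using A(3) o(2) m b(3) by fastforce
  ultimately have 2: "card A2 + card A3 \<le> cP b (s + n) + 1"
    unfolding cP_def using o by (intro card_le_overlap) auto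
  show ?thesis
    using 1 2 cP_split[of s b "s + n"] cP_window[of s] b cR_le_cP[of s b] cR_le_cP_X[of s b] by auto
qed

text \<open>The mirror image: the cut is at \<open>Max A2\<close>, and the possible overlap is
  between the two sets of \<open>RV\<close> positions.\<close>

lemma chain_RRP:
  assumes A: "A1 \<subseteq> {i \<in> {s<..s + n}. C i \<in> RV}" "A2 \<subseteq> {i \<in> {s<..s + n}. C i \<in> RV}"
      "A3 \<subseteq> {i \<in> {s<..s + n}. C i \<in> PV}"
    and o: "\<forall>i\<in>A1. \<forall>j\<in>A2. i \<le> j" "\<forall>i\<in>A2. \<forall>j\<in>A3. i < j" "A2 \<noteq> {}"
  shows "card A1 + card A2 + card A3 \<le> card PV + 2"
proof -
  define b where "b = Max A2"
  have f: "finite A2" using A(2) finite_subset by fastforce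
  have m: "b \<in> A2" using f o by (simp add: b_def)
  then have b: "s \<le> b" "b \<le> s + n" using A(2) by auto
  have "A1 \<subseteq> {i \<in> {s<..b}. C i \<in> RV}" using A(1) o(1) m by fastforce
  moreover have "A2 \<subseteq> {i \<in> {s<..b}. C i \<in> RV}" using A(2) f by (auto simp: b_def)
  ultimately have 1: "card A1 + card A2 \<le> cR s b + 1"
    unfolding cR_def using o by (intro card_le_overlap) auto
  have "A3 \<subseteq> {i \<in> {b<..s + n}. C i \<in> PV}" using A(3) o(2) m by fastforce
  then have 2: "card A3 \<le> cP b (s + n)" unfolding cP_def by (intro card_mono) auto
  show ?thesis
    using 1 2 cP_split[of s b "s + n"] cP_window[of s] b cR_le_cP[of s b] by auto
qed

text \<open>The crossing lemmas, read as statements about order. The exceptional positions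
  \<open>Suc s\<close> and \<open>s + n\<close> are those of \<open>C (Suc s)\<close> and
  \<open>C s\<close> themselves, where the rerouting degenerates.\<close>

lemma order_NN:
  assumes "i \<in> Np s (C s)" "j \<in> Np s (C (Suc s))" "i \<noteq> Suc s" shows "j \<le> i"
proof (rule ccontr)
  assume "\<not> j \<le> i"
  then show False
    using assms crossing_PP[of h s i j] h_off PV_iff'[of i] PV_iff'[of j] by (auto simp: Np_def)
qed

lemma order_MM:
  assumes "i \<in> Mp s (C s)" "j \<in> Mp s (C (Suc s))" "j \<noteq> s + n" shows "j \<le> i"
proof (rule ccontr)
  assume "\<not> j \<le> i"
  then show False
    using assms crossing_RR[of h s i j] h_off RV_iff[of i] RV_iff[of j] by (auto simp: Mp_def)
qed

lemma order_NM:
  assumes "i \<in> Np s (C s)" "j \<in> Mp s (C (Suc s))" "i \<noteq> Suc s" "j \<noteq> s + n" shows "j < i"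
proof (rule ccontr)
  assume "\<not> j < i"
  then show False
    using assms crossing_PR[of h s i j] h_off PV_iff'[of i] RV_iff[of j] by (auto simp: Np_def Mp_def)
qed

lemma order_NM':
  assumes "i \<in> Np s (C (Suc s))" "j \<in> Mp s (C s)" shows "j < i"
proof (rule ccontr)
  assume "\<not> j < i"
  moreover have "i \<noteq> Suc s" "j \<noteq> s + n" using assms E_irrefl C_period by (auto simp: Np_def Mp_def)
  ultimately show False
    using assms crossing_PR[of h s i j] h_off PV_iff'[of i] RV_iff[of j] by (auto simp: Np_def Mp_def)
qed

section \<open>Types of consecutive vertices\<close>

lemma PV_Is: "v \<in> PV \<Longrightarrow> v \<in> Is" and RV_Js: "v \<in> RV \<Longrightarrow> v \<in> Js"
  using I_Is J_Js by (auto simp: I_def J_def)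

lemma X_next_Is: "E h (C s) \<Longrightarrow> C (Suc s) \<in> W \<Longrightarrow> C (Suc s) \<in> Is"
  using PV_iff[of s] PV_Is C_W_iff by blast

lemma X_prev_Js: "E h (C (Suc s)) \<Longrightarrow> C s \<in> W \<Longrightarrow> C s \<in> Js"
  using RV_iff[of s] RV_Js C_W_iff by blast

lemma Np_window: "Np s v \<subseteq> {i \<in> {s<..s + n}. C i \<in> PV}"
  and Mp_window: "Mp s v \<subseteq> {i \<in> {s<..s + n}. C i \<in> RV}"
  by (auto simp: Np_def Mp_def)

text \<open>Otherwise the neighbours of \<open>C s\<close> in \<open>RV\<close>, of
  \<open>C (Suc s)\<close> in \<open>PV\<close> and of \<open>C s\<close> in \<open>PV\<close> come
  in this order, and their sizes give \<open>card RV + card PV + 4 \<le> 3 * k\<close>, against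
  \<open>RV_bound\<close>.\<close>

lemma both_not_Is:
  assumes W: "C s \<in> W" "C (Suc s) \<in> W" and n: "C s \<notin> Is" "C (Suc s) \<notin> Is"
  shows "C s \<in> Js"
proof (rule ccontr)
  assume nj: "C s \<notin> Js"
  have h1: "\<not> E h (C s)" "\<not> E h (C (Suc s))" using X_next_Is X_prev_Js W n nj by blast+
  then have h2: "\<not> E (C s) h" "\<not> E (C (Suc s)) h" using E_comm by metis+
  let ?A1 = "Mp s (C s)" and ?A2 = "Np s (C (Suc s))" and ?A3 = "Np s (C s)"
  have c: "card RV + 2 \<le> card ?A1 + k" "card PV + 2 \<le> card ?A2 + k" "card PV + 2 \<le> card ?A3 + k"
    using Mp_card Np_card W n nj h2 by blast+
  have A3: "Suc s \<notin> ?A3" using n PV_Is by (auto simp: Np_def)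
  have "card ?A1 + card ?A2 + card ?A3 \<le> card PV + (if E h (C s) then 1 else 2)"
  proof (rule chain_RPP[OF Mp_window Np_window Np_window])
    show "\<forall>i\<in>?A1. \<forall>j\<in>?A2. i < j" using order_NM' by blast
    show "\<forall>i\<in>?A2. \<forall>j\<in>?A3. i \<le> j" using order_NN A3 by blast
    show "?A2 \<noteq> {}" using c(2) k_le_PV by force
  qed
  then show False using c RV_bound card_RV_PV h1 by simp
qed

text \<open>The mirrored count, with two sets in \<open>RV\<close>, leads to
  \<open>2 * card RV + 4 \<le> 3 * k\<close>.\<close>

lemma both_not_Js:
  assumes W: "C s \<in> W" "C (Suc s) \<in> W" and n: "C s \<notin> Js" "C (Suc s) \<notin> Js"
  shows "C (Suc s) \<in> Is"
proof (rule ccontr)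
  assume nj: "C (Suc s) \<notin> Is"
  have h1: "\<not> E h (C s)" "\<not> E h (C (Suc s))" using X_next_Is X_prev_Js W n nj by blast+
  then have h2: "\<not> E (C s) h" "\<not> E (C (Suc s)) h" using E_comm by metis+
  let ?A1 = "Mp s (C (Suc s))" and ?A2 = "Mp s (C s)" and ?A3 = "Np s (C (Suc s))"
  have c: "card RV + 2 \<le> card ?A1 + k" "card RV + 2 \<le> card ?A2 + k" "card PV + 2 \<le> card ?A3 + k"
    using Mp_card Np_card W n nj h2 by blast+
  have A1: "s + n \<notin> ?A1" using n RV_Js C_period by (auto simp: Mp_def)
  have "card ?A1 + card ?A2 + card ?A3 \<le> card PV + 2"
  proof (rule chain_RRP[OF Mp_window Mp_window Np_window])
    show "\<forall>i\<in>?A1. \<forall>j\<in>?A2. i \<le> j" using order_MM A1 by blast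
    show "\<forall>i\<in>?A2. \<forall>j\<in>?A3. i < j" using order_NM' by blast
    show "?A2 \<noteq> {}" using c(2) k_le_RV by force
  qed
  then show False using c RV_bound card_RV_PV by simp
qed

text \<open>Vertices of type \<open>Io\<close> or \<open>Jo\<close> are the ones on which \<open>I\<^sup>*\<close> and \<open>J\<^sup>*\<close> disagree; they are called bad.\<close>
definition Io where "Io v \<longleftrightarrow> v \<in> Is \<and> v \<notin> Js"
definition Jo where "Jo v \<longleftrightarrow> v \<in> Js \<and> v \<notin> Is"
definition Yo where "Yo v \<longleftrightarrow> v \<in> W \<and> v \<notin> Is \<and> v \<notin> Js"

lemma types: "v \<in> W \<Longrightarrow> Io v \<or> Jo v \<or> Yo v \<or> v \<in> D"
  by (auto simp: Io_def Jo_def Yo_def D_def)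

lemma type_W: "Io v \<Longrightarrow> v \<in> W" "Jo v \<Longrightarrow> v \<in> W" "Yo v \<Longrightarrow> v \<in> W"
  using Is_W Js_W by (auto simp: Io_def Jo_def Yo_def)

lemma X_Yo: "E h (C s) \<Longrightarrow> Yo (C s)"
  using neighbour_not_Is(2) neighbour_not_Js(2) edge_W E_sym h_C0 unfolding Yo_def by metis

lemma bad_not_X: "Io v \<Longrightarrow> \<not> E h v" "Jo v \<Longrightarrow> \<not> E h v" "v \<in> D \<Longrightarrow> \<not> E h v"
  using neighbour_not_Is(2) neighbour_not_Js(2) by (auto simp: Io_def Jo_def D_def)

text \<open>Consequently, away from \<open>C 0\<close>, bad vertices form runs alternating between
  \<open>Io\<close> and \<open>Jo\<close> that open with \<open>Io\<close> and close with
  \<open>Jo\<close>; between the runs \<open>Yo\<close> alternates with \<open>D\<close>.\<close>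

lemma transitions:
  assumes "C s \<in> W" "C (Suc s) \<in> W"
  shows "Io (C s) \<Longrightarrow> Jo (C (Suc s))"
    and "Jo (C s) \<Longrightarrow> Io (C (Suc s)) \<or> Yo (C (Suc s))"
    and "C s \<in> D \<Longrightarrow> Yo (C (Suc s))"
    and "Yo (C s) \<Longrightarrow> Io (C (Suc s)) \<or> C (Suc s) \<in> D"
    and "Jo (C (Suc s)) \<Longrightarrow> Io (C s)"
    and "Io (C (Suc s)) \<Longrightarrow> Jo (C s) \<or> Yo (C s)"
    and "C (Suc s) \<in> D \<Longrightarrow> Yo (C s)"
  using both_not_Is[OF assms] both_not_Js[OF assms] Is_edge[OF _ C_edge[of s]] Js_edge[OF _ C_edge[of s]] assms
  by (auto simp: Io_def Jo_def Yo_def D_def)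

text \<open>The count of \<open>both_not_Is\<close> again, spread over three consecutive vertices:
  the last supplies the neighbours in \<open>RV\<close>, the other two those in
  \<open>PV\<close>.\<close>

lemma bad_Y_bad:
  assumes "Jo (C s)" "Yo (C (Suc s))" "Io (C (Suc (Suc s)))" and nh: "\<not> E h (C (Suc s))"
  shows False
proof -
  define t where "t = Suc s"
  have h2: "\<not> E (C t) h" "\<not> E (C s) h" "\<not> E (C (Suc t)) h"
    using nh bad_not_X assms E_comm unfolding t_def by metis+
  let ?A1 = "Mp t (C (Suc t))" and ?A2 = "Np t (C t)" and ?A3 = "Np t (C s)"
  have c: "card RV + 2 \<le> card ?A1 + k" "card PV + 2 \<le> card ?A2 + k" "card PV + 2 \<le> card ?A3 + k"
    using assms h2 type_W Mp_card[of "C (Suc t)" t] Np_card[of "C t" t] Np_card[of "C s" t]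
    by (auto simp: t_def Io_def Jo_def Yo_def)
  have t_PV: "C t \<notin> PV" "C t \<notin> RV" using assms PV_Is RV_Js by (auto simp: t_def Yo_def)
  \<comment> \<open>The windows after \<open>s\<close> and after \<open>t\<close> differ only in the
    two positions of \<open>C t\<close>, which is not in \<open>PV\<close>.\<close>
  have sub: "i \<in> Np s v" if "i \<in> Np t v" for i v
  proof -
    have "i \<noteq> t + n" using that t_PV C_period by (auto simp: Np_def)
    then show ?thesis using that by (auto simp: Np_def t_def)
  qed
  have o1: "\<forall>i\<in>?A1. \<forall>j\<in>?A2. i < j"
  proof (intro ballI)
    fix i j assume ij: "i \<in> ?A1" "j \<in> ?A2"
    have "j \<noteq> Suc t" using ij nh PV_iff[of t] by (auto simp: Np_def t_def)
    moreover have "i \<noteq> t + n" using ij t_PV C_period by (auto simp: Mp_def)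
    ultimately show "i < j" using order_NM ij by blast
  qed
  have o2: "\<forall>i\<in>?A2. \<forall>j\<in>?A3. i \<le> j"
  proof (intro ballI)
    fix i j assume ij: "i \<in> ?A2" "j \<in> ?A3"
    then have "j \<noteq> Suc s" by (auto simp: Np_def t_def)
    then show "i \<le> j" using order_NN[of j s i] sub ij by (auto simp: t_def)
  qed
  have "?A2 \<noteq> {}" using c(2) k_le_PV by force
  then have "card ?A1 + card ?A2 + card ?A3 \<le> card PV + (if E h (C t) then 1 else 2)"
    by (rule chain_RPP[OF Mp_window Np_window Np_window o1 o2])
  then show False using c RV_bound card_RV_PV nh by (simp add: t_def)
qed

text \<open>A neighbour of \<open>h\<close> between two bad vertices; this forces the borderline degree.\<close>
definition BXB where
  "BXB t \<longleftrightarrow> 0 < t \<and> Jo (C (t - 1)) \<and> E h (C t) \<and> Io (C (Suc t))"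

text \<open>The orders used for \<open>bad_Y_bad\<close>. Since \<open>C t\<close> is a neighbour of
  \<open>h\<close>, its successor lies in \<open>PV\<close> and is adjacent to it; this position is
  removed before comparing.\<close>

lemma BXB_order:
  assumes "BXB t"
  shows "\<forall>i\<in>Mp t (C (Suc t)). \<forall>j\<in>Np t (C t) - {Suc t}. i < j"
    and "\<forall>i\<in>Np t (C t) - {Suc t}. \<forall>j\<in>Np t (C (t - 1)). i \<le> j"
    and "Suc t \<in> Np t (C t)"
    and "t + n \<notin> Np t v" "t + n \<notin> Mp t v"
proof -
  define s where "s = t - 1"
  have t: "t = Suc s" using assms by (auto simp: s_def BXB_def)
  have Y: "Yo (C t)" using assms X_Yo by (auto simp: BXB_def)
  have t_PV: "C t \<notin> PV" "C t \<notin> RV" using Y PV_Is RV_Js by (auto simp: Yo_def)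
  show tn: "t + n \<notin> Np t v" "t + n \<notin> Mp t v" for v using t_PV C_period by (auto simp: Np_def Mp_def)
  have sub: "i \<in> Np s v" if "i \<in> Np t v" for i v
  proof -
    have "i \<noteq> t + n" using that tn by blast
    then show ?thesis using that by (auto simp: Np_def t)
  qed
  show "\<forall>i\<in>Mp t (C (Suc t)). \<forall>j\<in>Np t (C t) - {Suc t}. i < j"
    using order_NM tn by blast
  show "\<forall>i\<in>Np t (C t) - {Suc t}. \<forall>j\<in>Np t (C (t - 1)). i \<le> j"
  proof (intro ballI)
    fix i j assume ij: "i \<in> Np t (C t) - {Suc t}" "j \<in> Np t (C (t - 1))"
    then have "j \<noteq> Suc s" by (auto simp: Np_def t)
    then show "i \<le> j" using order_NN[of j s i] sub ij by (auto simp: t)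
  qed
  have "C (Suc t) \<in> W" using assms type_W by (auto simp: BXB_def)
  then have "C (Suc t) \<in> PV" using assms PV_iff[of t] C_W_iff by (auto simp: BXB_def)
  then show "Suc t \<in> Np t (C t)" using n3 C_edge by (auto simp: Np_def)
qed

text \<open>\<open>k < card PV\<close> keeps the middle set nonempty after the removal of
  \<open>Suc t\<close>, as \<open>chain_RPP\<close> demands. The outer two sets are counted with
  \<open>D\<close> included.\<close>

lemma BXB_bound:
  assumes "BXB t" "k < card PV"
  shows "card (J \<union> D) + card (I \<union> D) + 1 \<le> 3 * k"
proof -
  let ?A1 = "Mp t (C (Suc t))" and ?A2 = "Np t (C t) - {Suc t}" and ?A3 = "Np t (C (t - 1))"
  have hX: "E h (C t)" using assms by (auto simp: BXB_def)
  have c1: "card (J \<union> D) + 1 \<le> card ?A1 + k"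
    using assms Mp_card_D by (auto simp: BXB_def Io_def)
  have c3: "card (I \<union> D) + 1 \<le> card ?A3 + k"
    using assms Np_card_D by (auto simp: BXB_def Jo_def)
  have "card PV + 1 \<le> card (Np t (C t)) + k"
    using Np_card_X[of "C t" t] hX X_Yo type_W(3) E_sym by blast
  moreover have "card ?A2 + 1 = card (Np t (C t))"
    using BXB_order(3)[OF assms(1)] finite_Np by (metis Suc_eq_plus1 card_Suc_Diff1)
  ultimately have c2: "card PV \<le> card ?A2 + k" by simp
  then have ne: "?A2 \<noteq> {}" using assms(2) by force
  have w: "?A2 \<subseteq> {i \<in> {t<..t + n}. C i \<in> PV}" using Np_window by blast
  have "card ?A1 + card ?A2 + card ?A3 \<le> card PV + (if E h (C t) then 1 else 2)"
    by (rule chain_RPP[OF Mp_window w Np_window BXB_order(1,2)[OF assms(1)] ne])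
  then show ?thesis using c1 c2 c3 hX by simp
qed

section \<open>Existence of a bad vertex\<close>

lemma alternating_cover:
  assumes "Q \<subseteq> {1..m}" "\<forall>i\<in>{1..<m}. i \<in> Q \<or> Suc i \<in> Q"
  shows "m \<le> 2 * card Q + 1"
proof -
  have fQ: "finite Q" using assms(1) finite_subset by blast
  have "{1..<m} \<subseteq> Q \<union> (\<lambda>i. i - 1) ` Q"
  proof
    fix i assume "i \<in> {1..<m}"
    then have "i \<in> Q \<or> Suc i \<in> Q" using assms(2) by blast
    then show "i \<in> Q \<union> (\<lambda>i. i - 1) ` Q" by force
  qed
  then have "card {1..<m} \<le> card (Q \<union> (\<lambda>i. i - 1) ` Q)" using fQ by (intro card_mono) auto
  also have "\<dots> \<le> card Q + card ((\<lambda>i. i - 1) ` Q)" by (rule card_Un_le)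
  also have "\<dots> \<le> 2 * card Q" using card_image_le[OF fQ, of "\<lambda>i. i - 1"] by simp
  finally show ?thesis by simp
qed

lemma C_in_W: "0 < i \<Longrightarrow> i < n \<Longrightarrow> C i \<in> W"
  using C_neq_C0 C_W by blast

lemma range_index: "v \<in> range C \<Longrightarrow> \<exists>i<n. v = C i"
  using C_mod n_pos by (metis imageE mod_less_divisor)

lemma range_index_W:
  assumes "v \<in> range C" "v \<in> W" obtains i where "0 < i" "i < n" "v = C i"
proof -
  obtain i where i: "i < n" "v = C i" using range_index assms by blast
  then have "i \<noteq> 0" using assms C0_W by metis
  then show thesis using i that by blast
qed

lemma card_W: "card W = (n - 1) + card (W - range C)"
proof -
  have "(W - range C) \<union> (range C - {C 0}) = W"
  proof
    show "W \<subseteq> (W - range C) \<union> (range C - {C 0})" using C0_W by auto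
  qed (use range_W in auto)
  moreover have "card ((W - range C) \<union> (range C - {C 0})) = card (W - range C) + card (range C - {C 0})"
    using finite_W finite_range by (intro card_Un_disjoint) auto
  moreover have "card (range C - {C 0}) = n - 1" using card_range finite_range by simp
  ultimately show ?thesis by simp
qed

text \<open>Without bad vertices every \<open>Yo\<close> vertex is followed by one in
  \<open>D\<close>, so at least every second cycle vertex is in \<open>D\<close>. All uncovered
  vertices are in \<open>D\<close> as well, and \<open>h\<close> is one of them; so
  \<open>2 * card D\<close> reaches \<open>card W\<close>, against \<open>alpha\<close>.\<close>

lemma bad_exists: "\<exists>i. 0 < i \<and> i < n \<and> (Io (C i) \<or> Jo (C i))"
proof (rule ccontr)
  assume "\<not> ?thesis"
  then have nb: "\<not> Io (C i)" "\<not> Jo (C i)" if "0 < i" "i < n" for i using that by blast+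
  define Q where "Q = {i \<in> {1..n - 1}. C i \<in> D}"
  have "n - 1 \<le> 2 * card Q + 1"
  proof (rule alternating_cover)
    show "\<forall>i\<in>{1..<n - 1}. i \<in> Q \<or> Suc i \<in> Q"
    proof
      fix i assume i: "i \<in> {1..<n - 1}"
      then have W: "C i \<in> W" "C (Suc i) \<in> W" and "i < n" "Suc i < n" using C_in_W by auto
      then show "i \<in> Q \<or> Suc i \<in> Q"
        using i nb[of i] nb[of "Suc i"] types[OF W(1)] transitions(4)[OF W] by (auto simp: Q_def)
    qed
  qed (auto simp: Q_def)
  moreover have "card Q + card (W - range C) \<le> card D"
  proof -
    have "inj_on C Q" by (rule inj_on_subset[OF inj_1n]) (auto simp: Q_def)
    then have "card Q = card (C ` Q)" by (simp add: card_image)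
    moreover have "card (C ` Q) + card (W - range C) = card (C ` Q \<union> (W - range C))"
      using finite_W by (intro card_Un_disjoint[symmetric]) (auto simp: Q_def)
    moreover have "card (C ` Q \<union> (W - range C)) \<le> card D"
      using finite_D off_D by (intro card_mono) (auto simp: Q_def)
    ultimately show ?thesis by simp
  qed
  moreover have "card (W - range C) > 0" using h_W h_off finite_W by (auto simp: card_gt_0_iff)
  moreover have "2 * card D < card W"
    using alpha[of D] D_W independent_Is by (auto simp: D_def independent_def)
  ultimately show False using card_W n3 by simp
qed

section \<open>Runs of bad vertices that follow a neighbour of \<open>h\<close>\<close>

definition PVI where "PVI = {v \<in> PV. v \<notin> Js}"
definition Pos where "Pos = {i \<in> {1..<n}. C i \<in> PVI}"

lemma PVI_Io: "v \<in> PVI \<Longrightarrow> Io v"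
  using PV_Is by (auto simp: PVI_def Io_def)

lemma Jo_exists: "\<exists>v. Jo v"
proof -
  obtain i where i: "Io (C i) \<or> Jo (C i)" using bad_exists by blast
  show ?thesis
  proof (cases "Jo (C i)")
    case False
    then have I: "Io (C i)" using i by blast
    then have "C i \<in> W" "C i \<notin> Js" "\<not> E (C i) h"
      using type_W bad_not_X E_comm by (auto simp: Io_def) metis
    then obtain r where "r \<in> RV" "E (C i) r" using not_Js_neighbour by blast
    then have "Jo r" using RV_Js Is_edge I by (auto simp: Jo_def Io_def)
    then show ?thesis ..
  qed blast
qed

lemma card_I_D: "card (I \<union> D) = card PVI + card D"
proof -
  have "I \<union> D = PVI \<union> D" using PV_Is h_D by (auto simp: I_def D_def PVI_def)
  moreover have "PVI \<inter> D = {}" by (auto simp: PVI_def D_def)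
  moreover have "finite PVI" using finite_PV by (simp add: PVI_def)
  ultimately show ?thesis using finite_D by (simp add: card_Un_disjoint)
qed

text \<open>The neighbours of a \<open>Jo\<close> vertex avoid \<open>Js\<close>, so those in
  \<open>PV\<close> are in \<open>PVI\<close>, and \<open>Np_card_D\<close> bounds their number from
  below.\<close>

lemma card_PVI_ge: "card (I \<union> D) + 1 \<le> card PVI + k"
proof -
  obtain v where v: "Jo v" using Jo_exists by blast
  have "{p \<in> PV. E v p} \<subseteq> PVI" using v Js_edge by (auto simp: PVI_def Jo_def)
  then have "card {p \<in> PV. E v p} \<le> card PVI" using finite_PV by (intro card_mono) (auto simp: PVI_def)
  then show ?thesis using Np_card_D[of v 0] v card_Np[of 0 v] by (auto simp: Jo_def)
qed

lemma card_Pos: "card Pos = card PVI"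
proof -
  have "C ` Pos = PVI"
  proof
    show "PVI \<subseteq> C ` Pos"
    proof
      fix v assume v: "v \<in> PVI"
      then have "v \<in> range C" "v \<in> W" using PV_range PV_W by (auto simp: PVI_def)
      then obtain i where "0 < i" "i < n" "v = C i" by (rule range_index_W)
      then show "v \<in> C ` Pos" using v by (auto simp: Pos_def)
    qed
  qed (auto simp: Pos_def)
  moreover have "inj_on C Pos" by (rule inj_on_subset[OF inj_1n]) (auto simp: Pos_def)
  ultimately show ?thesis by (metis card_image)
qed

lemma finite_Pos: "finite Pos"
  by (simp add: Pos_def)

text \<open>The run of bad vertices starting at \<open>i\<close> ends just before this position. For
  \<open>i < n\<close> it exists because position \<open>n\<close> carries \<open>C 0\<close>, which
  is not bad.\<close>

definition bend where "bend i = (LEAST j. i < j \<and> \<not> (Io (C j) \<or> Jo (C j)))"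

lemma C0_not_bad: "\<not> Io (C 0)" "\<not> Jo (C 0)"
  using type_W C0_W by blast+

lemma bend_ex: "i < n \<Longrightarrow> i < n \<and> \<not> (Io (C n) \<or> Jo (C n))"
  using C0_not_bad C_n by simp

lemma bend_facts:
  assumes "i < n"
  shows "i < bend i" "bend i \<le> n" "\<not> Io (C (bend i))" "\<not> Jo (C (bend i))"
    and "i < m \<Longrightarrow> m < bend i \<Longrightarrow> Io (C m) \<or> Jo (C m)"
  using LeastI[of "\<lambda>j. i < j \<and> \<not> (Io (C j) \<or> Jo (C j))" n] bend_ex[OF assms]
    Least_le[of "\<lambda>j. i < j \<and> \<not> (Io (C j) \<or> Jo (C j))" n]
    not_less_Least[of m "\<lambda>j. i < j \<and> \<not> (Io (C j) \<or> Jo (C j))"]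
  unfolding bend_def by blast+

lemma bend_le: "i < j \<Longrightarrow> \<not> (Io (C j) \<or> Jo (C j)) \<Longrightarrow> bend i \<le> j"
  unfolding bend_def by (rule Least_le) simp

lemma bend_type:
  assumes "0 < i" "i < n" "Io (C i)" "bend i < n"
  shows "Jo (C (bend i - 1))" "Yo (C (bend i))"
proof -
  define j where "j = bend i - 1"
  have j: "bend i = Suc j" "i \<le> j" using bend_facts(1)[OF assms(2)] by (auto simp: j_def)
  have W: "C j \<in> W" "C (Suc j) \<in> W" using j assms by (auto intro!: C_in_W)
  have "Io (C j) \<or> Jo (C j)" using bend_facts(5)[OF assms(2), of j] j assms(3) by (cases "i = j") auto
  moreover have n: "\<not> Io (C (Suc j))" "\<not> Jo (C (Suc j))" using bend_facts(3,4)[OF assms(2)] j by auto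
  ultimately have "Jo (C j)" using transitions(1)[OF W] by blast
  then show "Jo (C (bend i - 1))" "Yo (C (bend i))" using transitions(2)[OF W] n j by auto
qed

text \<open>\<open>C (i' - 1)\<close> is a neighbour of \<open>h\<close>, hence not bad, and stops
  the run from \<open>i\<close> at the latest.\<close>

lemma bend_Pos:
  assumes "i \<in> Pos" "i' \<in> Pos" "i < i'"
  shows "bend i < i'"
proof -
  have X: "E h (C (i' - 1))" and i': "0 < i'" using assms PV_iff'[of i'] by (auto simp: Pos_def PVI_def)
  have "\<not> E h (C i)" using assms PVI_Io bad_not_X by (auto simp: Pos_def)
  then have "i \<noteq> i' - 1" using X by metis
  then have "i < i' - 1" using assms by simp
  moreover have "\<not> (Io (C (i' - 1)) \<or> Jo (C (i' - 1)))" using X bad_not_X by blast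
  ultimately show ?thesis using bend_le[of i "i' - 1"] i' by simp
qed

lemma Pos_lt_Max: "i \<in> Pos - {Max Pos} \<Longrightarrow> i < Max Pos \<and> Max Pos \<in> Pos"
  using finite_Pos by (metis DiffD1 DiffD2 Max_ge Max_in empty_iff insertI1 le_neq_implies_less)

text \<open>The last position is dropped because its run may end only at \<open>C 0\<close>.\<close>

lemma inj_bend: "inj_on (\<lambda>i. C (Suc (bend i))) (Pos - {Max Pos})"
proof -
  have n: "Suc (bend i) < n" if "i \<in> Pos - {Max Pos}" for i
  proof -
    have "bend i < Max Pos" using bend_Pos[of i "Max Pos"] Pos_lt_Max[OF that] that by blast
    moreover have "Max Pos < n" using Pos_lt_Max[OF that] by (auto simp: Pos_def)
    ultimately show ?thesis by simp
  qed
  have less: "bend i < bend i'" if "i \<in> Pos - {Max Pos}" "i' \<in> Pos - {Max Pos}" "i < i'" for i i'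
    using bend_Pos[of i i'] bend_facts(1)[of i'] that by (auto simp: Pos_def)
  show ?thesis
  proof (rule inj_onI)
    fix i i' assume a: "i \<in> Pos - {Max Pos}" "i' \<in> Pos - {Max Pos}"
      "C (Suc (bend i)) = C (Suc (bend i'))"
    then have "Suc (bend i) = Suc (bend i')" using C_inj n by (auto simp: inj_on_def)
    then show "i = i'" using less[of i i'] less[of i' i] a by (metis Suc_inject less_irrefl linorder_neqE_nat)
  qed
qed

text \<open>Moving the segment \<open>C (Suc s), \<dots>, C j\<close> elsewhere makes room for \<open>h\<close> between \<open>C s\<close> and \<open>C (Suc j)\<close>.\<close>
definition full where
  "full s j \<longleftrightarrow> 0 < s \<and> s < j \<and> Suc j < n \<and> E h (C s) \<and> E h (C (Suc j)) \<and>
     Io (C (Suc s)) \<and> Jo (C j) \<and> (\<forall>m\<in>{s<..j}. Io (C m) \<or> Jo (C m))"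

lemma full_bend:
  assumes "i \<in> Pos" "bend i < n" "E h (C (bend i))"
  shows "full (i - 1) (bend i - 1)"
proof -
  have i: "0 < i" "i < n" "C i \<in> PVI" using assms by (auto simp: Pos_def)
  then have I: "Io (C i)" and X: "E h (C (i - 1))" using PVI_Io PV_iff'[of i] by (auto simp: PVI_def)
  have "i - 1 \<noteq> 0" using X h_C0 by metis
  moreover have "Io (C m) \<or> Jo (C m)" if "m \<in> {i - 1<..bend i - 1}" for m
    using bend_facts(5)[OF i(2), of m] I that by (cases "m = i") auto
  ultimately show ?thesis
    using i I X assms bend_facts(1)[OF i(2)] bend_type[OF i(1,2) I assms(2)] by (auto simp: full_def)
qed

text \<open>Otherwise every run but the last stops at a \<open>Yo\<close> vertex not adjacent to
  \<open>h\<close>, whose successor is in \<open>D\<close> by \<open>bad_Y_bad\<close> and not in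
  \<open>I\<close>. Then \<open>card PVI - 1 \<le> card (D - I)\<close>, and
  \<open>card_PVI_ge\<close> forces \<open>card PV < k\<close>.\<close>

lemma full_exists: "\<exists>s j. full s j"
proof (rule ccontr)
  assume nf: "\<not> ?thesis"
  have "(\<lambda>i. C (Suc (bend i))) ` (Pos - {Max Pos}) \<subseteq> D - I"
  proof
    fix v assume "v \<in> (\<lambda>i. C (Suc (bend i))) ` (Pos - {Max Pos})"
    then obtain i where i: "i \<in> Pos - {Max Pos}" "v = C (Suc (bend i))" by blast
    then have b: "bend i < Max Pos" "Max Pos < n" using Pos_lt_Max bend_Pos by (blast, auto simp: Pos_def)
    have i0: "0 < i" "i < n" "Io (C i)" using i PVI_Io by (auto simp: Pos_def)
    have nX: "\<not> E h (C (bend i))" using full_bend[of i] i b nf by auto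
    have t: "Jo (C (bend i - 1))" "Yo (C (bend i))" using bend_type i0 b by auto
    have pos: "0 < bend i" using bend_facts(1)[OF i0(2)] by simp
    have W: "C (bend i) \<in> W" "C (Suc (bend i)) \<in> W" using b pos by (auto intro!: C_in_W)
    have "\<not> Io (C (Suc (bend i)))" using bad_Y_bad[of "bend i - 1"] t nX pos by auto
    then have "v \<in> D" using transitions(4)[OF W] t i by blast
    moreover have "v \<notin> I" using PV_iff[of "bend i"] nX i h_neq by (auto simp: I_def)
    ultimately show "v \<in> D - I" by blast
  qed
  then have "card (Pos - {Max Pos}) \<le> card (D - I)"
    using inj_bend finite_D by (metis card_image card_mono finite_Diff)
  moreover have "card Pos - 1 \<le> card (Pos - {Max Pos})" by (simp add: card_Diff_singleton_if)
  moreover have "card (I \<union> D) = card I + card (D - I)"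
    using finite_D I_W finite_W finite_subset by (metis Diff_disjoint Un_Diff_cancel card_Un_disjoint finite_Diff)
  ultimately show False using card_PVI_ge card_Pos card_I k_le_PV by simp
qed

text \<open>The candidate edges from \<open>C m\<close> to \<open>C (Suc m)\<close> for receiving
  the segment; the bound \<open>n - 1\<close> keeps \<open>C (Suc m)\<close> away from
  \<open>C 0\<close>.\<close>

definition Apos where "Apos s j = {m \<in> {1..<n - 1}. Io (C m) \<and> m \<notin> {s<..j}}"

text \<open>By \<open>segment_relocation\<close> each candidate lacks one of the two joining edges.
  Those lacking the edge to \<open>C j\<close> form with \<open>D\<close> an independent set that
  misses \<open>C j\<close> and a neighbour of it in \<open>PV\<close>, so freeness bounds them; the
  others are bounded symmetrically inside \<open>Js\<close>.\<close>

lemma relocation_count: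
  assumes "full s j"
  shows "card (Apos s j) + 2 * card D + 2 \<le> 2 * k"
proof -
  have f: "0 < s" "s < j" "Suc j < n" "E h (C s)" "E h (C (Suc j))" "Io (C (Suc s))" "Jo (C j)"
    using assms by (auto simp: full_def)
  let ?A = "Apos s j"
  define A1 where "A1 = {m \<in> ?A. \<not> E (C j) (C m)}"
  define A2 where "A2 = {m \<in> ?A. \<not> E (C (Suc s)) (C (Suc m))}"
  have fin: "finite ?A" "finite A1" "finite A2" by (auto simp: Apos_def A1_def A2_def)
  have nx: "Jo (C (Suc m))" if "m \<in> ?A" for m
    using transitions(1)[of m] that C_in_W[of m] C_in_W[of "Suc m"] by (auto simp: Apos_def)
  have "?A \<subseteq> A1 \<union> A2"
  proof
    fix m assume m: "m \<in> ?A"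
    show "m \<in> A1 \<union> A2"
    proof (rule ccontr)
      assume "m \<notin> A1 \<union> A2"
      then have e: "E (C j) (C m)" "E (C (Suc s)) (C (Suc m))" using m by (auto simp: A1_def A2_def)
      consider "j < m" | "m \<le> s" using m by (force simp: Apos_def)
      then show False
      proof cases
        case 1
        moreover have "Suc m < s + n" using m by (auto simp: Apos_def)
        ultimately show False using segment_relocation[of h s j m] e f h_off by blast
      next
        case 2
        \<comment> \<open>A candidate before the segment is used one turn later, at
          \<open>m + n\<close>, which requires \<open>Suc m < s\<close>.\<close>
        have "m \<noteq> s" using m f(4) bad_not_X by (auto simp: Apos_def)
        moreover have "Suc m \<noteq> s" using nx[OF m] f(4) bad_not_X by auto
        ultimately have "Suc m < s" using 2 by simp
        moreover have "C (m + n) = C m" "C (Suc (m + n)) = C (Suc m)"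
          using C_period[of m] C_period[of "Suc m"] by auto
        ultimately show False using segment_relocation[of h s j "m + n"] e f h_off by auto
      qed
    qed
  qed
  then have "card ?A \<le> card (A1 \<union> A2)" using fin by (intro card_mono) auto
  then have cA: "card ?A \<le> card A1 + card A2" using card_Un_le[of A1 A2] by simp
  have "card A1 + card D < k"
  proof -
    obtain p where p: "p \<in> PV" "E (C j) p"
      using not_Is_neighbour[of "C j"] f(7) type_W bad_not_X E_comm unfolding Jo_def by metis
    have S: "C ` A1 \<union> D \<subseteq> Is" by (auto simp: A1_def Apos_def Io_def D_def)
    have "card (C ` A1 \<union> D) < k"
    proof (rule free[OF p(2)])
      show "independent E (C ` A1 \<union> D)" using independent_Is S unfolding independent_def by blast
      show "\<forall>t\<in>C ` A1 \<union> D. \<not> E (C j) t \<and> \<not> E p t"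
        using S Is_edge[OF PV_Is[OF p(1)]] Js_edge[of "C j"] f(7) by (auto simp: A1_def Jo_def D_def)
    qed (use type_W(2)[OF f(7)] p PV_W subset_trans[OF S Is_W] in auto)
    moreover have "card (C ` A1 \<union> D) = card (C ` A1) + card D"
      using fin finite_D by (intro card_Un_disjoint) (auto simp: A1_def Apos_def Io_def D_def)
    moreover have "card (C ` A1) = card A1"
      by (rule card_image, rule inj_on_subset[OF inj_1n]) (auto simp: A1_def Apos_def)
    ultimately show ?thesis by simp
  qed
  moreover have "card A2 + card D < k"
  proof -
    let ?p = "C (Suc s)" and ?B = "C ` Suc ` A2"
    obtain r where r: "r \<in> RV" "E ?p r"
      using not_Js_neighbour[of ?p] f(6) type_W bad_not_X E_comm unfolding Io_def by metis
    have S: "?B \<union> D \<subseteq> Js" using nx by (auto simp: A2_def Jo_def D_def)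
    have "card (?B \<union> D) < k"
    proof (rule free[OF r(2)])
      show "independent E (?B \<union> D)" using independent_Js S unfolding independent_def by blast
      show "\<forall>t\<in>?B \<union> D. \<not> E ?p t \<and> \<not> E r t"
        using S Js_edge[OF RV_Js[OF r(1)]] Is_edge[of ?p] f(6) by (auto simp: A2_def Io_def D_def)
    qed (use type_W(1)[OF f(6)] r RV_W subset_trans[OF S Js_W] in auto)
    moreover have "card (?B \<union> D) = card ?B + card D"
      using fin finite_D nx by (intro card_Un_disjoint) (auto simp: A2_def Jo_def D_def)
    moreover have "card ?B = card A2"
    proof -
      have "inj_on C (Suc ` A2)" by (rule inj_on_subset[OF inj_1n]) (auto simp: A2_def Apos_def)
      then show ?thesis by (simp add: card_image)
    qed
    ultimately show ?thesis by simp
  qed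
  ultimately show ?thesis using cA by simp
qed

text \<open>A position of \<open>Pos\<close> follows a neighbour of \<open>h\<close>, so inside the
  segment only \<open>Suc s\<close> qualifies; position \<open>n - 1\<close> may be lost too, unless
  it is a neighbour of \<open>h\<close>.\<close>

lemma Pos_Apos:
  assumes "full s j"
  shows "card PVI \<le> card (Apos s j) + (if E h (C (n - 1)) then 1 else 2)"
proof -
  have f: "E h (C s)" "\<forall>m\<in>{s<..j}. Io (C m) \<or> Jo (C m)" using assms by (auto simp: full_def)
  have fA: "finite (Apos s j)" by (simp add: Apos_def)
  have "Pos \<subseteq> Apos s j \<union> {Suc s} \<union> (if E h (C (n - 1)) then {} else {n - 1})"
  proof
    fix i assume i: "i \<in> Pos"
    then have I: "Io (C i)" and X: "E h (C (i - 1))" and i0: "0 < i" "i < n"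
      using PVI_Io PV_iff'[of i] by (auto simp: Pos_def PVI_def)
    have "i = Suc s" if "i \<in> {s<..j}"
    proof (rule ccontr)
      assume "i \<noteq> Suc s"
      then have "i - 1 \<in> {s<..j}" using that by auto
      then show False using f(2) bad_not_X X by blast
    qed
    moreover have "\<not> E h (C (n - 1))" if "i = n - 1" using I that bad_not_X by blast
    ultimately show "i \<in> Apos s j \<union> {Suc s} \<union> (if E h (C (n - 1)) then {} else {n - 1})"
      using I i0 by (cases "i = n - 1") (auto simp: Apos_def)
  qed
  then have "card Pos \<le> card (Apos s j \<union> {Suc s} \<union> (if E h (C (n - 1)) then {} else {n - 1}))"
    using fA by (intro card_mono) auto
  also have "\<dots> \<le> card (Apos s j \<union> {Suc s}) + (if E h (C (n - 1)) then 0 else 1)"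
    using card_Un_le[of "Apos s j \<union> {Suc s}" "if E h (C (n - 1)) then {} else {n - 1}"] by auto
  also have "card (Apos s j \<union> {Suc s}) \<le> card (Apos s j) + 1"
    using card_Un_le[of "Apos s j" "{Suc s}"] by simp
  finally show ?thesis using card_Pos by (auto split: if_splits)
qed

text \<open>After each run but the last comes a \<open>Yo\<close> vertex and then one in
  \<open>D\<close>: an \<open>Io\<close> vertex there would give \<open>BXB\<close> or contradict
  \<open>bad_Y_bad\<close>. The missing run is made up for by \<open>h\<close>, which is in
  \<open>D\<close> but off the cycle.\<close>

lemma PVI_le_D:
  assumes "\<nexists>t. BXB t" shows "card PVI \<le> card D"
proof -
  have "(\<lambda>i. C (Suc (bend i))) ` (Pos - {Max Pos}) \<subseteq> D - {h}"
  proof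
    fix v assume "v \<in> (\<lambda>i. C (Suc (bend i))) ` (Pos - {Max Pos})"
    then obtain i where i: "i \<in> Pos - {Max Pos}" "v = C (Suc (bend i))" by blast
    then have b: "bend i < Max Pos" "Max Pos < n" using Pos_lt_Max bend_Pos by (blast, auto simp: Pos_def)
    have i0: "0 < i" "i < n" "Io (C i)" using i PVI_Io by (auto simp: Pos_def)
    have t: "Jo (C (bend i - 1))" "Yo (C (bend i))" using bend_type i0 b by auto
    have pos: "0 < bend i" using bend_facts(1)[OF i0(2)] by simp
    have W: "C (bend i) \<in> W" "C (Suc (bend i)) \<in> W" using b pos by (auto intro!: C_in_W)
    have "\<not> Io (C (Suc (bend i)))"
    proof
      assume "Io (C (Suc (bend i)))"
      then show False
        using bad_Y_bad[of "bend i - 1"] t pos assms by (cases "E h (C (bend i))") (auto simp: BXB_def)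
    qed
    then have "v \<in> D" using transitions(4)[OF W] t i by blast
    then show "v \<in> D - {h}" using i h_neq by auto
  qed
  then have "card (Pos - {Max Pos}) \<le> card (D - {h})"
    using inj_bend finite_D by (metis card_image card_mono finite_Diff)
  moreover have "card Pos - 1 \<le> card (Pos - {Max Pos})" by (simp add: card_Diff_singleton_if)
  moreover have "card (D - {h}) = card D - 1" "card D > 0" using h_D finite_D by (auto simp: card_gt_0_iff)
  ultimately show ?thesis using card_Pos by simp
qed

text \<open>Eliminating \<open>PVI\<close>, \<open>D\<close> and \<open>Apos\<close> from the four
  inequalities leaves \<open>3 * card PV + 3 \<le> 4 * k\<close>, and even
  \<open>3 * card PV + 5 \<le> 4 * k\<close> if \<open>h\<close> is adjacent to
  \<open>C (n - 1)\<close>. The degree bounds contradict both.\<close>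

lemma BXB_exists: "\<exists>t. BXB t"
proof (rule ccontr)
  assume n: "\<not> ?thesis"
  obtain s j where sj: "full s j" using full_exists by blast
  have 1: "card (Apos s j) + 2 * card D + 2 \<le> 2 * k" using relocation_count[OF sj] .
  have 2: "card PVI \<le> card (Apos s j) + (if E h (C (n - 1)) then 1 else 2)" using Pos_Apos[OF sj] .
  have 3: "card PVI \<le> card D" using PVI_le_D n by blast
  have 4: "card PV + 1 \<le> card PVI + card D"
  proof -
    have "card I \<le> card (I \<union> D)" using finite_D I_W finite_W finite_subset by (intro card_mono) blast+
    then show ?thesis using card_I card_I_D by simp
  qed
  show False using 1 2 3 4 end_cases RV_bound k2 by (auto split: if_splits)
qed

text \<open>If \<open>h\<close> missed \<open>C (n - 1)\<close>, then
  \<open>3 * k \<le> card PV + card RV + 2\<close>, one short of what \<open>BXB_bound\<close>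
  requires.\<close>

lemma ends_adjacent:
  shows "E h (C 1)" "E h (C (n - 1))" "card RV = card PV" "d = card PV + 1"
proof -
  obtain t where t: "BXB t" using BXB_exists by blast
  have "\<not> (\<not> E h (C (n - 1)) \<and> 3 * k \<le> 2 * card PV + 1 \<and> 3 * k \<le> card PV + card RV + 2)"
  proof
    assume a: "\<not> E h (C (n - 1)) \<and> 3 * k \<le> 2 * card PV + 1 \<and> 3 * k \<le> card PV + card RV + 2"
    have "finite (I \<union> D)" "finite (J \<union> D)"
      using finite_D I_W J_W finite_W finite_subset by blast+
    then have "card I \<le> card (I \<union> D)" "card J \<le> card (J \<union> D)" by (auto intro!: card_mono)
    moreover have "k < card PV" using a k2 by linarith
    ultimately show False using BXB_bound[OF t] card_I card_J a by simp
  qed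
  then show "E h (C 1)" "E h (C (n - 1))" "card RV = card PV" "d = card PV + 1" using end_cases by blast+
qed

lemma cP_mono: "s' \<le> s \<Longrightarrow> b \<le> b' \<Longrightarrow> cP s b \<le> cP s' b'"
  unfolding cP_def by (intro card_mono) auto

lemma cP_shift: "cP (s + n) (b + n) = cP s b"
proof -
  have "{i \<in> {s + n<..b + n}. C i \<in> PV} = (\<lambda>i. i + n) ` {i \<in> {s<..b}. C i \<in> PV}"
  proof
    show "{i \<in> {s + n<..b + n}. C i \<in> PV} \<subseteq> (\<lambda>i. i + n) ` {i \<in> {s<..b}. C i \<in> PV}"
    proof
      fix i assume i: "i \<in> {i \<in> {s + n<..b + n}. C i \<in> PV}"
      then have "C (i - n) = C i" using C_period[of "i - n"] by simp
      then show "i \<in> (\<lambda>i. i + n) ` {i \<in> {s<..b}. C i \<in> PV}"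
        using i by (intro image_eqI[of _ _ "i - n"]) auto
    qed
  qed (auto simp: C_period)
  then show ?thesis unfolding cP_def by (simp add: card_image)
qed

lemma BXB_representative: "\<exists>t. BXB t \<and> 1 < t \<and> Suc t < n"
proof -
  obtain t where t: "BXB t" using BXB_exists by blast
  define t' where "t' = t mod n"
  have e: "C t = C t'" "C (Suc t) = C (Suc t')" "t' < n"
    using C_mod[of t] C_Suc_cong[of t "t mod n"] n_pos unfolding t'_def by (blast, blast, simp)
  have X: "E h (C t')" using t e by (simp add: BXB_def)
  have t'0: "t' \<noteq> 0" using X h_C0 by metis
  have p: "C (t - 1) = C (t' - 1)" using C_pred_cong[OF e(1)] t t'0 by (simp add: BXB_def)
  have B: "BXB t'" using t e p t'0 by (simp add: BXB_def)
  moreover have "t' \<noteq> 1" using B C0_not_bad by (auto simp: BXB_def)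
  moreover have "Suc t' \<noteq> n" using B C0_not_bad C_n by (auto simp: BXB_def)
  ultimately show ?thesis using t'0 e(3) by (intro exI[of _ t']) auto
qed

text \<open>A \<open>Yo\<close> vertex not adjacent to \<open>h\<close> has no cycle neighbour in
  \<open>D\<close>, because such a vertex would lie in \<open>PV\<close> and \<open>RV\<close>. It
  is then enclosed by two bad vertices, against \<open>bad_Y_bad\<close>.\<close>

lemma Yo_X_if:
  assumes "D \<subseteq> I" "D \<subseteq> J" "0 < i" "i < n" "Yo (C i)" shows "E h (C i)"
proof (rule ccontr)
  assume nX: "\<not> E h (C i)"
  have "i \<noteq> 1" "i \<noteq> n - 1" using nX ends_adjacent by metis+
  then have i: "1 < i" "Suc i < n" using assms by auto
  define s where "s = i - 1"
  have s: "i = Suc s" using i by (simp add: s_def)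
  have W: "C s \<in> W" "C i \<in> W" "C (Suc i) \<in> W" using i s by (auto intro!: C_in_W)
  have "C (Suc i) \<notin> D" using assms(1) PV_iff[of i] nX h_neq by (auto simp: I_def)
  then have I: "Io (C (Suc i))" using transitions(4)[OF W(2,3)] assms(5) by blast
  have "C s \<notin> D" using assms(2) RV_iff[of s] nX h_neq s by (auto simp: J_def)
  moreover have "\<not> Io (C s)" "\<not> Yo (C s)"
    using transitions(1,4)[of s] W assms(5) s by (auto simp: Io_def Jo_def Yo_def D_def)
  ultimately have "Jo (C s)" using types[OF W(1)] by blast
  then show False using bad_Y_bad[of s] I assms(5) nX s by simp
qed

end

section \<open>The borderline minimum degree\<close>

locale tight_counterexample = counterexample +
  assumes k_less: "k < card PV"
begin

text \<open>\<open>BXB_bound\<close> and \<open>RV_bound\<close> enclose \<open>3 * k\<close>, so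
  equality holds throughout and \<open>D\<close> adds nothing to \<open>I\<close> or
  \<open>J\<close>.\<close>

lemma tight: "3 * k = 2 * card PV + 3" "D \<subseteq> I" "D \<subseteq> J"
proof -
  obtain t where t: "BXB t" using BXB_exists by blast
  have f: "finite (I \<union> D)" "finite (J \<union> D)" using finite_D I_W J_W finite_W finite_subset by blast+
  have 1: "card (J \<union> D) + card (I \<union> D) + 1 \<le> 3 * k" using BXB_bound[OF t k_less] .
  have 2: "card I \<le> card (I \<union> D)" "card J \<le> card (J \<union> D)" using f by (auto intro!: card_mono)
  show "3 * k = 2 * card PV + 3" using 1 2 card_I card_J ends_adjacent(3) RV_bound by simp
  have "card I = card (I \<union> D)" "card J = card (J \<union> D)"
    using 1 2 card_I card_J ends_adjacent(3) RV_bound by simp_all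
  then have "I = I \<union> D" "J = J \<union> D" using f by (intro card_subset_eq; simp)+
  then show "D \<subseteq> I" "D \<subseteq> J" by blast+
qed

lemma k5: "5 \<le> k"
  using tight(1) k_less by simp

lemma Yo_X: "0 < i \<Longrightarrow> i < n \<Longrightarrow> Yo (C i) \<Longrightarrow> E h (C i)"
  using Yo_X_if tight by blast

text \<open>By the equality in \<open>tight\<close> the chain of three neighbour sets has no slack.
  So \<open>C (Suc t)\<close> sees exactly an initial stretch of \<open>RV\<close>, and
  \<open>C (t - 1)\<close> exactly a final stretch of \<open>PV\<close>.\<close>

lemma BXB_tight:
  assumes t: "BXB t"
  shows "card (Mp t (C (Suc t))) + k = card PV + 2" "card (Np t (C (t - 1))) + k = card PV + 2"
    and "\<exists>b c. t \<le> b \<and> b < c \<and> c \<le> t + n \<and> cP t b + k = card PV + 2 \<and>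
      Mp t (C (Suc t)) = {i \<in> {t<..b}. C i \<in> RV} \<and> Np t (C (t - 1)) = {i \<in> {c..t + n}. C i \<in> PV}"
proof -
  let ?A1 = "Mp t (C (Suc t))" and ?A2 = "Np t (C t) - {Suc t}" and ?A3 = "Np t (C (t - 1))"
  have hX: "E h (C t)" using assms by (auto simp: BXB_def)
  have "finite (I \<union> D)" "finite (J \<union> D)" using finite_D I_W J_W finite_W finite_subset by blast+
  then have "card J \<le> card (J \<union> D)" "card I \<le> card (I \<union> D)" by (auto intro!: card_mono)
  moreover have "card (J \<union> D) + 1 \<le> card ?A1 + k"
    using assms Mp_card_D by (auto simp: BXB_def Io_def)
  moreover have "card (I \<union> D) + 1 \<le> card ?A3 + k"
    using assms Np_card_D by (auto simp: BXB_def Jo_def)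
  ultimately have c1: "card PV + 2 \<le> card ?A1 + k" and c3: "card PV + 2 \<le> card ?A3 + k"
    using card_I card_J ends_adjacent(3) by simp_all
  have "card PV + 1 \<le> card (Np t (C t)) + k"
    using Np_card_X[of "C t" t] hX X_Yo type_W(3) E_sym by blast
  moreover have "card ?A2 + 1 = card (Np t (C t))"
    using BXB_order(3)[OF assms(1)] finite_Np by (metis Suc_eq_plus1 card_Suc_Diff1)
  ultimately have c2: "card PV \<le> card ?A2 + k" by simp
  then have ne: "?A2 \<noteq> {}" using k_less by force
  have fA2: "finite ?A2" using finite_Np by simp
  \<comment> \<open>The middle set \<open>?A2\<close> separates the other two; its extreme positions
    provide the cuts.\<close>
  define b where "b = Min ?A2 - 1"
  define c where "c = Max ?A2"
  have mA: "Min ?A2 \<in> ?A2" "c \<in> ?A2"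
    unfolding c_def by (rule Min_in[OF fA2 ne], rule Max_in[OF fA2 ne])
  have w: "t < i \<and> i \<le> t + n \<and> C i \<in> PV" if "i \<in> ?A2" for i using that by (simp add: Np_def)
  have b: "t \<le> b" "Suc b = Min ?A2" and cc: "t < c" "c \<le> t + n" "C c \<in> PV"
    using w[OF mA(1)] w[OF mA(2)] by (auto simp: b_def)
  have bc: "b < c" using b mA fA2 by (metis Min_le Suc_le_eq)
  have s1: "?A1 \<subseteq> {i \<in> {t<..b}. C i \<in> RV}"
  proof
    fix i assume i: "i \<in> ?A1"
    then have "i < Suc b" using BXB_order(1)[OF t] mA(1) b(2) by auto
    then show "i \<in> {i \<in> {t<..b}. C i \<in> RV}" using i by (auto simp: Mp_def)
  qed
  have s2: "?A2 \<subseteq> {i \<in> {b<..c}. C i \<in> PV}"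
  proof
    fix i assume i: "i \<in> ?A2"
    then have "Suc b \<le> i" "i \<le> c" using fA2 b(2) by (auto simp: c_def)
    then show "i \<in> {i \<in> {b<..c}. C i \<in> PV}" using i by (auto simp: Np_def)
  qed
  have s3: "?A3 \<subseteq> {i \<in> {c..t + n}. C i \<in> PV}"
  proof
    fix i assume i: "i \<in> ?A3"
    then have "c \<le> i" using BXB_order(2)[OF t] mA(2) by auto
    then show "i \<in> {i \<in> {c..t + n}. C i \<in> PV}" using i by (auto simp: Np_def)
  qed
  have d1: "card ?A1 \<le> cR t b" unfolding cR_def by (rule card_mono[OF _ s1]) simp
  have d2: "card ?A2 \<le> cP b c" unfolding cP_def by (rule card_mono[OF _ s2]) simp
  have d3: "card ?A3 \<le> card {i \<in> {c..t + n}. C i \<in> PV}" by (rule card_mono[OF _ s3]) simp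
  have d4: "card {i \<in> {c..t + n}. C i \<in> PV} = cP c (t + n) + 1"
  proof -
    have "{i \<in> {c..t + n}. C i \<in> PV} = insert c {i \<in> {c<..t + n}. C i \<in> PV}"
      using cc by (auto simp: le_less)
    then show ?thesis unfolding cP_def by simp
  qed
  have d5: "cR t b \<le> cP t b" using cR_le_cP_X b(1) hX by blast
  have d6: "cP t b + (cP b c + cP c (t + n)) = card PV"
    using cP_split[of t b "t + n"] cP_split[of b c "t + n"] cP_window[of t] b bc cc by simp
  have e: "card ?A1 + k = card PV + 2" "card ?A3 + k = card PV + 2" "cP t b + k = card PV + 2"
     "card ?A1 = cR t b" "card ?A3 = card {i \<in> {c..t + n}. C i \<in> PV}"
    using c1 c2 c3 d1 d2 d3 d4 d5 d6 tight(1) k_less by linarith+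
  show "card ?A1 + k = card PV + 2" "card ?A3 + k = card PV + 2" using e by auto
  have "?A1 = {i \<in> {t<..b}. C i \<in> RV}" using s1 e(4) unfolding cR_def by (intro card_subset_eq) auto
  moreover have "?A3 = {i \<in> {c..t + n}. C i \<in> PV}" using s3 e(5) by (intro card_subset_eq) auto
  ultimately show "\<exists>b c. t \<le> b \<and> b < c \<and> c \<le> t + n \<and> cP t b + k = card PV + 2 \<and>
      ?A1 = {i \<in> {t<..b}. C i \<in> RV} \<and> ?A3 = {i \<in> {c..t + n}. C i \<in> PV}"
    using b(1) bc cc e(3) by blast
qed

text \<open>A missed \<open>e\<close> could be added to \<open>J\<close>, and
  \<open>neighbour_count\<close> would give \<open>C (Suc t)\<close> more neighbours in
  \<open>RV\<close> than \<open>BXB_tight\<close> allows.\<close>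

lemma BXB_Js:
  assumes "BXB t" "e \<in> Js - J" shows "E (C (Suc t)) e"
proof (rule ccontr)
  assume n: "\<not> E (C (Suc t)) e"
  let ?p = "C (Suc t)"
  have p: "Io ?p" using assms by (simp add: BXB_def)
  then have pW: "?p \<in> W" "\<not> E ?p h" using type_W bad_not_X E_comm by (blast, metis)
  obtain r where r: "r \<in> RV" "E ?p r" using not_Js_neighbour pW p by (auto simp: Io_def)
  have "card (insert e J) < k + card {v \<in> insert e J. E ?p v}"
  proof (rule neighbour_count[of _ _ r])
    have "insert e J \<subseteq> Js" using assms J_Js by blast
    then show "independent E (insert e J)" using independent_Js unfolding independent_def by blast
  qed (use assms J_W Js_W pW r in \<open>auto simp: J_def\<close>)
  moreover have "{v \<in> insert e J. E ?p v} = {v \<in> RV. E ?p v}" using n pW by (auto simp: J_def)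
  moreover have "card (insert e J) = card RV + 2"
    using assms card_J finite_subset[OF J_W finite_W] by (simp add: card_insert_if)
  ultimately show False using BXB_tight(1)[OF assms(1)] card_Mp[of t ?p] ends_adjacent(3) by simp
qed

lemma BXB_Is:
  assumes "BXB t" "e \<in> Is - I" shows "E (C (t - 1)) e"
proof (rule ccontr)
  assume n: "\<not> E (C (t - 1)) e"
  let ?p = "C (t - 1)"
  have p: "Jo ?p" using assms by (simp add: BXB_def)
  then have pW: "?p \<in> W" "\<not> E ?p h" using type_W bad_not_X E_comm by (blast, metis)
  obtain r where r: "r \<in> PV" "E ?p r" using not_Is_neighbour pW p by (auto simp: Jo_def)
  have "card (insert e I) < k + card {v \<in> insert e I. E ?p v}"
  proof (rule neighbour_count[of _ _ r])
    have "insert e I \<subseteq> Is" using assms I_Is by blast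
    then show "independent E (insert e I)" using independent_Is unfolding independent_def by blast
  qed (use assms I_W Is_W pW r in \<open>auto simp: I_def\<close>)
  moreover have "{v \<in> insert e I. E ?p v} = {v \<in> PV. E ?p v}" using n pW by (auto simp: I_def)
  moreover have "card (insert e I) = card PV + 2"
    using assms card_I finite_subset[OF I_W finite_W] by (simp add: card_insert_if)
  ultimately show False using BXB_tight(2)[OF assms(1)] card_Np[of t ?p] by simp
qed

text \<open>The first such position \<open>i0\<close> has neighbours of \<open>h\<close> on both
  sides, and the last neighbour of \<open>h\<close> before \<open>i0 - 1\<close> is again a
  \<open>BXB\<close> position \<open>s0\<close>. Since \<open>C (Suc s0)\<close> is not adjacent to
  \<open>C i0\<close>, its stretch of \<open>RV\<close> stops before \<open>i0\<close> and has at
  most one element, but \<open>card PV + 2 - k \<ge> 3\<close> are required.\<close>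

lemma no_D_after:
  assumes "BXB t" "t < i" "i < n" shows "C i \<notin> D"
proof
  assume "C i \<in> D"
  define i0 where "i0 = (LEAST i. t < i \<and> i < n \<and> C i \<in> D)"
  have i0: "t < i0" "i0 < n" "C i0 \<in> D"
    using LeastI[of "\<lambda>i. t < i \<and> i < n \<and> C i \<in> D" i] assms \<open>C i \<in> D\<close> unfolding i0_def by auto
  have least: "C m \<notin> D" if "t < m" "m < i0" for m
    using not_less_Least[of m "\<lambda>i. t < i \<and> i < n \<and> C i \<in> D"] that i0 unfolding i0_def by auto
  have t0: "0 < t" "E h (C t)" "Io (C (Suc t))" "Jo (C (t - 1))" using assms by (auto simp: BXB_def)
  define s' where "s' = i0 - 1"
  have s': "i0 = Suc s'" "t \<le> s'" using i0 by (auto simp: s'_def)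
  have "s' \<noteq> t" using t0 i0 s' by (auto simp: Io_def D_def)
  then have ts': "t < s'" using s' by simp
  have W: "C s' \<in> W" "C i0 \<in> W" using s' i0 t0 ts' by (auto intro!: C_in_W)
  have Xs': "E h (C s')" using transitions(7)[of s'] W i0 s' Yo_X[of s'] ts' by auto
  have "i0 \<noteq> n - 1" using i0 ends_adjacent(2) bad_not_X(3) by metis
  then have i0n: "Suc i0 < n" using i0 by simp
  then have "C (Suc i0) \<in> W" by (intro C_in_W) auto
  then have Xi0: "E h (C (Suc i0))" using transitions(3)[of i0] W i0 Yo_X[of "Suc i0"] i0n by auto
  define S where "S = {q \<in> {t..<s'}. E h (C q)}"
  define s0 where "s0 = Max S"
  have "finite S" "t \<in> S" using t0 ts' by (auto simp: S_def)
  then have s0: "s0 \<in> S" "\<And>q. q \<in> S \<Longrightarrow> q \<le> s0" unfolding s0_def by (blast intro: Max_in, simp)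
  then have s0': "t \<le> s0" "s0 < s'" "E h (C s0)" by (auto simp: S_def)
  have "Jo (C (s0 - 1))"
  proof (cases "s0 = t")
    case False
    then have "t \<le> s0 - 1" "s0 = Suc (s0 - 1)" using s0' by auto
    moreover have "s0 - 1 \<noteq> t" using not_consecutive[OF t0(2)] s0'(3) calculation(2) by metis
    ultimately have l: "t < s0 - 1" "s0 - 1 < i0" "s0 = Suc (s0 - 1)" using s0' s' by auto
    then have "C (s0 - 1) \<in> W" using i0 by (intro C_in_W) auto
    then have "C (s0 - 1) \<in> Js" using X_prev_Js[of "s0 - 1"] l(3) s0'(3) by auto
    then show ?thesis using least l by (auto simp: Jo_def D_def)
  qed (use t0 in simp)
  moreover have "Io (C (Suc s0))"
  proof -
    have "Suc s0 \<noteq> s'" using not_consecutive[OF s0'(3)] Xs' by metis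
    then have l: "Suc s0 < s'" using s0' by simp
    then have "C (Suc s0) \<in> W" using i0 s' by (intro C_in_W) auto
    then have "C (Suc s0) \<in> Is" using X_next_Is s0'(3) by blast
    then show ?thesis using least[of "Suc s0"] l s0' s' by (auto simp: Io_def D_def)
  qed
  ultimately have B: "BXB s0" using s0' t0 by (auto simp: BXB_def)
  obtain b where b: "s0 \<le> b" "Mp s0 (C (Suc s0)) = {i \<in> {s0<..b}. C i \<in> RV}"
    using BXB_tight(3)[OF B] by blast
  have "b < i0"
  proof (rule ccontr)
    assume "\<not> b < i0"
    moreover have "C i0 \<in> RV" using RV_iff[of i0] Xi0 W C_W_iff by auto
    ultimately have "i0 \<in> Mp s0 (C (Suc s0))" using b s0' s' by auto
    then have "E (C (Suc s0)) (C i0)" by (simp add: Mp_def)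
    then show False using Is_edge \<open>Io (C (Suc s0))\<close> i0 by (auto simp: Io_def D_def)
  qed
  have "Mp s0 (C (Suc s0)) \<subseteq> {s' - 1}"
  proof
    fix m assume "m \<in> Mp s0 (C (Suc s0))"
    then have m: "s0 < m" "m \<le> b" "E h (C (Suc m))" using b RV_iff[of m] by auto
    have "Suc m \<noteq> i0" using m(3) i0 bad_not_X by auto
    then have "Suc m \<le> s'" using m \<open>b < i0\<close> s' by simp
    moreover have "\<not> Suc m < s'" using s0(2)[of "Suc m"] m s0' by (auto simp: S_def)
    ultimately show "m \<in> {s' - 1}" by auto
  qed
  then have "card (Mp s0 (C (Suc s0))) \<le> 1" using card_mono[of "{s' - 1}"] by simp
  then show False using BXB_tight(1)[OF B] k_less by simp
qed

text \<open>The mirror image, with the last \<open>D\<close> position before \<open>t\<close> and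
  the final stretch of \<open>PV\<close>.\<close>

lemma no_D_before:
  assumes "BXB t" "0 < i" "i < t" "t < n" shows "C i \<notin> D"
proof
  assume "C i \<in> D"
  define Q where "Q = {i \<in> {0<..<t}. C i \<in> D}"
  define i0 where "i0 = Max Q"
  have "finite Q" "i \<in> Q" using assms \<open>C i \<in> D\<close> by (auto simp: Q_def)
  then have "i0 \<in> Q" and greatest: "\<And>m. m \<in> Q \<Longrightarrow> m \<le> i0" unfolding i0_def by (blast intro: Max_in, simp)
  then have i0: "0 < i0" "i0 < t" "C i0 \<in> D" by (auto simp: Q_def)
  have t0: "0 < t" "E h (C t)" "Io (C (Suc t))" "Jo (C (t - 1))" using assms by (auto simp: BXB_def)
  have gr: "C m \<notin> D" if "i0 < m" "m < t" for m using greatest[of m] that i0 by (auto simp: Q_def)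
  have "Suc i0 \<noteq> t" using t0(4) i0 by (auto simp: Jo_def D_def)
  define s' where "s' = Suc i0"
  have ts': "s' < t" using i0 \<open>Suc i0 \<noteq> t\<close> by (simp add: s'_def)
  have W: "C s' \<in> W" "C i0 \<in> W" using i0 ts' assms by (auto intro!: C_in_W simp: s'_def)
  have Xs': "E h (C s')" using transitions(3)[of i0] W i0 Yo_X[of s'] ts' assms by (auto simp: s'_def)
  have "i0 \<noteq> 1" using i0 ends_adjacent(1) bad_not_X(3) by metis
  then have i01: "1 < i0" "i0 = Suc (i0 - 1)" using i0 by auto
  then have W1: "C (i0 - 1) \<in> W" using i0 assms by (intro C_in_W) auto
  then have Xi0: "E h (C (i0 - 1))"
    using transitions(7)[of "i0 - 1"] W i0 i01 Yo_X[of "i0 - 1"] assms by auto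
  define S where "S = {q \<in> {s'<..t}. E h (C q)}"
  define s0 where "s0 = Min S"
  have "finite S" "t \<in> S" using t0 ts' by (auto simp: S_def)
  then have s0: "s0 \<in> S" "\<And>q. q \<in> S \<Longrightarrow> s0 \<le> q" unfolding s0_def by (blast intro: Min_in, simp)
  then have s0': "s0 \<le> t" "s' < s0" "E h (C s0)" by (auto simp: S_def)
  have s0S: "s0 = Suc (s0 - 1)" using s0' by simp
  have J0: "Jo (C (s0 - 1))"
  proof -
    have "s0 - 1 \<noteq> s'" using not_consecutive[OF Xs'] s0'(3) s0S by metis
    then have l: "s' < s0 - 1" using s0' by simp
    then have "C (s0 - 1) \<in> W" using s0' assms by (intro C_in_W) auto
    then have "C (s0 - 1) \<in> Js" using X_prev_Js[of "s0 - 1"] s0S s0'(3) by auto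
    then show ?thesis using gr[of "s0 - 1"] l s0' by (auto simp: Jo_def D_def s'_def)
  qed
  moreover have "Io (C (Suc s0))"
  proof (cases "s0 = t")
    case False
    have "Suc s0 \<noteq> t" using not_consecutive[OF s0'(3)] t0(2) by metis
    then have l: "Suc s0 < t" using s0' False by simp
    then have "C (Suc s0) \<in> W" using assms by (intro C_in_W) auto
    then have "C (Suc s0) \<in> Is" using X_next_Is s0'(3) by blast
    then show ?thesis using gr[of "Suc s0"] l s0' by (auto simp: Io_def D_def s'_def)
  qed (use t0 in simp)
  ultimately have B: "BXB s0" using s0' by (auto simp: BXB_def)
  obtain c where c: "Np s0 (C (s0 - 1)) = {i \<in> {c..s0 + n}. C i \<in> PV}"
    using BXB_tight(3)[OF B] by blast
  have "i0 + n < c"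
  proof (rule ccontr)
    assume "\<not> i0 + n < c"
    moreover have "C (i0 + n) \<in> PV" using PV_iff'[of i0] Xi0 W C_W_iff i0 C_period by auto
    ultimately have "i0 + n \<in> Np s0 (C (s0 - 1))" using c s0' by (auto simp: s'_def)
    then have "E (C (s0 - 1)) (C i0)" by (simp add: Np_def C_period)
    then show False using Js_edge J0 i0 by (auto simp: Jo_def D_def)
  qed
  have "Np s0 (C (s0 - 1)) \<subseteq> {Suc s' + n}"
  proof
    fix m assume "m \<in> Np s0 (C (s0 - 1))"
    then have m: "c \<le> m" "m \<le> s0 + n" "E h (C (m - 1))" using c PV_iff'[of m] \<open>i0 + n < c\<close> by auto
    define q where "q = m - 1 - n"
    have q: "m - 1 = q + n" using m \<open>i0 + n < c\<close> by (simp add: q_def)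
    have Xq: "E h (C q)" using m(3) q C_period by simp
    have "q \<noteq> i0" using Xq i0 bad_not_X by auto
    then have "s' \<le> q" using q m \<open>i0 + n < c\<close> by (simp add: s'_def)
    moreover have "q < s0" using m(2) q n_pos by linarith
    then have "\<not> s' < q" using s0(2)[of q] Xq s0' by (auto simp: S_def)
    ultimately show "m \<in> {Suc s' + n}" using q m \<open>i0 + n < c\<close> by auto
  qed
  then have "card (Np s0 (C (s0 - 1))) \<le> 1" using card_mono[of "{Suc s' + n}"] by simp
  then show False using BXB_tight(2)[OF B] k_less by simp
qed

lemma no_D:
  assumes "0 < i" "i < n" shows "C i \<notin> D"
proof -
  obtain t where t: "BXB t" "1 < t" "Suc t < n" using BXB_representative by blast
  consider "i < t" | "i = t" | "t < i" by linarith
  then show ?thesis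
  proof cases
    case 2
    then show ?thesis using t bad_not_X(3) by (auto simp: BXB_def)
  qed (use no_D_before[OF t(1)] no_D_after[OF t(1)] assms t in auto)
qed

lemma X_or_bad:
  assumes "0 < i" "i < n" shows "E h (C i) \<or> Io (C i) \<or> Jo (C i)"
  using types[OF C_in_W[OF assms]] Yo_X[OF assms] no_D[OF assms] by blast

lemma interior_BXB:
  assumes "1 < i" "Suc i < n" "E h (C i)" shows "BXB i"
proof -
  have W: "C (i - 1) \<in> W" "C (Suc i) \<in> W" using assms by (simp_all add: C_in_W)
  have "C (i - 1) \<in> Js" using X_prev_Js[of "i - 1"] W(1) assms by simp
  moreover have "C (Suc i) \<in> Is" using X_next_Is[of i] W(2) assms by simp
  moreover have "C (i - 1) \<notin> D" "C (Suc i) \<notin> D" using no_D[of "i - 1"] no_D[of "Suc i"] assms by simp_all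
  ultimately show ?thesis using assms by (auto simp: BXB_def Io_def Jo_def D_def)
qed

text \<open>Otherwise \<open>order_NN\<close>, in the turn after \<open>m\<close>, confines the
  \<open>PV\<close> neighbours of \<open>C m\<close> to the positions between \<open>t\<close> and
  \<open>m\<close>. As \<open>m'\<close> still follows inside the stretch, these are fewer than
  \<open>card PV + 2 - k\<close>, against \<open>Np_card\<close>.\<close>

lemma X_nonneighbour_after:
  assumes t: "BXB t" and b: "Mp t (C (Suc t)) = {i \<in> {t<..b}. C i \<in> RV}" "cP t b + k = card PV + 2"
      "b \<le> t + n"
    and m: "m \<in> Mp t (C (Suc t))" "m' \<in> Mp t (C (Suc t))" "m < m'"
  shows "\<not> E (C (Suc t)) (C (Suc m))"
proof
  assume e: "E (C (Suc t)) (C (Suc m))"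
  have mr: "t < m" "m \<le> b" "C m \<in> RV" using m(1) unfolding b(1) by auto
  have mp: "E (C (Suc t)) (C m)" using m(1) by (simp add: Mp_def)
  have m'r: "m' \<le> b" "C m' \<in> RV" using m(2) unfolding b(1) by auto
  have X: "E h (C (Suc m))" using mr RV_iff by blast
  have pPV: "C (Suc t) \<in> PV" using BXB_order(3)[OF t] by (simp add: Np_def)
  have j: "Suc t + n \<in> Np m (C (Suc m))"
    using pPV E_sym[OF e] mr(1,2) b(3) C_period[of "Suc t"] by (simp add: Np_def)
  have "Np m (C m) \<subseteq> {i \<in> {t + n<..m + n}. C i \<in> PV}"
  proof
    fix i assume i: "i \<in> Np m (C m)"
    have "i \<noteq> Suc m" using i X PV_not_h by (auto simp: Np_def)
    then have "Suc t + n \<le> i" using order_NN[OF i j] by blast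
    then show "i \<in> {i \<in> {t + n<..m + n}. C i \<in> PV}" using i by (auto simp: Np_def)
  qed
  then have "card (Np m (C m)) \<le> cP (t + n) (m + n)" unfolding cP_def by (intro card_mono) auto
  then have "card (Np m (C m)) \<le> cP t m" by (simp add: cP_shift)
  moreover have "card PV + 2 \<le> card (Np m (C m)) + k"
  proof (rule Np_card)
    show "C m \<in> W" using mr RV_W by auto
    show "C m \<notin> Is" using neighbour_not_Is(1)[OF pPV] E_sym[OF mp] by blast
    show "\<not> E (C m) h" using RV_not_h[OF mr(3)] E_comm by metis
  qed
  moreover have "cP m b \<ge> 1"
  proof -
    have "m' \<noteq> Suc m" using m'r X RV_not_h by blast
    then have "Suc m < m'" using m by simp
    then have "m' \<in> {i \<in> {Suc m<..m'}. C i \<in> RV}" using m'r by simp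
    then have "card {m'} \<le> card {i \<in> {Suc m<..m'}. C i \<in> RV}" by (intro card_mono) auto
    then have "cR (Suc m) m' \<ge> 1" by (simp add: cR_def)
    then have "cP (Suc m) m' \<ge> 1" using cR_le_cP_X[of "Suc m" m'] X \<open>Suc m < m'\<close> by simp
    then show ?thesis using cP_mono[of m "Suc m" m' b] m'r by simp
  qed
  moreover have "cP t b = cP t m + cP m b" using cP_split[of t m b] mr by simp
  ultimately show False using b(2) by simp
qed

text \<open>Otherwise \<open>order_NM\<close> confines the \<open>RV\<close> neighbours of
  \<open>C i\<close> to the positions from \<open>i\<close> to \<open>t + n\<close>; these are too
  few for \<open>Mp_card\<close>, because the stretch of \<open>PV\<close> also contains the earlier
  \<open>i'\<close>.\<close>

lemma X_nonneighbour_before: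
  assumes t: "BXB t" and c: "Np t (C (t - 1)) = {i \<in> {c..t + n}. C i \<in> PV}" "t < c"
    and i: "i \<in> Np t (C (t - 1))" "i' \<in> Np t (C (t - 1))" "i' < i"
  shows "\<not> E (C (Suc t)) (C (i - 1))"
proof
  assume e: "E (C (Suc t)) (C (i - 1))"
  have ir: "c \<le> i'" "i \<le> t + n" "C i \<in> PV" using i(1,2) unfolding c(1) by auto
  have ip: "E (C (t - 1)) (C i)" using i(1) by (simp add: Np_def)
  define s where "s = i - 1"
  have s: "i = Suc s" "t < s" using ir c(2) i(3) by (auto simp: s_def)
  have X: "E h (C s)" using ir(3) PV_iff s by simp
  have pPV: "C (Suc t) \<in> PV" using BXB_order(3)[OF t] by (simp add: Np_def)
  have j: "Suc t + n \<in> Np s (C s)"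
    using pPV E_sym[OF e] s ir(2) C_period[of "Suc t"] by (simp add: Np_def)
  have "Mp s (C (Suc s)) \<subseteq> {j \<in> {s<..t + n}. C j \<in> RV}"
  proof
    fix m assume m: "m \<in> Mp s (C (Suc s))"
    have "m \<noteq> s + n" using m X RV_not_h C_period by (auto simp: Mp_def)
    moreover have "Suc t + n \<noteq> Suc s" using ir(2) s by simp
    ultimately have "m < Suc t + n" using order_NM[OF j m] by blast
    then show "m \<in> {j \<in> {s<..t + n}. C j \<in> RV}" using m by (auto simp: Mp_def)
  qed
  then have "card (Mp s (C (Suc s))) \<le> cR s (t + n)" unfolding cR_def by (intro card_mono) auto
  also have "\<dots> \<le> cP s (t + n)" using cR_le_cP_X X s ir(2) by simp
  also have "\<dots> < card (Np t (C (t - 1)))"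
  proof -
    have "{j \<in> {s<..t + n}. C j \<in> PV} \<subseteq> Np t (C (t - 1))" unfolding c(1) using ir(1) i(3) s by auto
    moreover have "i' \<notin> {j \<in> {s<..t + n}. C j \<in> PV}" using i(3) s by simp
    ultimately have "{j \<in> {s<..t + n}. C j \<in> PV} \<subset> Np t (C (t - 1))" using i(2) by blast
    then show ?thesis unfolding cP_def by (rule psubset_card_mono[OF finite_Np])
  qed
  finally have "card (Mp s (C (Suc s))) < card (Np t (C (t - 1)))" .
  moreover have "card RV + 2 \<le> card (Mp s (C (Suc s))) + k"
  proof (rule Mp_card)
    show "C (Suc s) \<in> W" using ir(3) PV_W s by auto
    have "C (t - 1) \<in> W" using t type_W by (auto simp: BXB_def)
    then have "C (t - 1) \<in> RV" using RV_iff[of "t - 1"] t C_W_iff by (auto simp: BXB_def)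
    then show "C (Suc s) \<notin> Js" using neighbour_not_Js(1)[OF _ E_sym[OF ip]] s(1) by simp
    show "\<not> E (C (Suc s)) h" using PV_not_h[OF ir(3)] s E_comm by metis
  qed
  ultimately show False using BXB_tight(2)[OF t] ends_adjacent(3) by simp
qed

text \<open>Of the \<open>d\<close> neighbours of \<open>h\<close>, at least \<open>2 (u - 1)\<close> are not adjacent to the vertex after \<open>C t\<close>,
  where \<open>u = card PV + 2 - k\<close> is also its number of neighbours in \<open>J\<close>; its degree is at least \<open>d\<close>.\<close>
lemma extra_neighbour:
  assumes t: "BXB t" shows "\<exists>e\<in>Js - J. E (C (Suc t)) e"
proof (rule ccontr)
  assume "\<not> ?thesis"
  then have ne: "v \<in> J" if "v \<in> Js" "E (C (Suc t)) v" for v using that by blast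
  let ?p = "C (Suc t)" and ?A = "Mp t (C (Suc t))" and ?B = "Np t (C (t - 1))"
  obtain b c where bc: "t \<le> b" "b < c" "c \<le> t + n" "cP t b + k = card PV + 2"
      "?A = {i \<in> {t<..b}. C i \<in> RV}" "?B = {i \<in> {c..t + n}. C i \<in> PV}"
    using BXB_tight(3)[OF t] by blast
  have cA: "card ?A + k = card PV + 2" and cB: "card ?B + k = card PV + 2"
    using BXB_tight(1,2)[OF t] by auto
  have fin: "finite ?A" "finite ?B" using finite_Mp finite_Np by auto
  have ne0: "?A \<noteq> {}" "?B \<noteq> {}" using cA cB k_less by force+
  \<comment> \<open>Neighbours of \<open>h\<close> next to the two stretches. One extreme position
    of each stretch is dropped, since the two preceding lemmas need a further position beyond the
    one considered.\<close>
  define A' where "A' = Suc ` (?A - {Max ?A})"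
  define B' where "B' = (\<lambda>i. i - 1) ` (?B - {Min ?B})"
  have posB: "t < i" if "i \<in> ?B" for i using that bc by auto
  have cA': "card A' + 1 = card ?A" unfolding A'_def
    using fin(1) ne0(1) Max_in[OF fin(1) ne0(1)] by (simp add: card_image card_Suc_Diff1 del: card_Diff_insert)
  have "inj_on (\<lambda>i::nat. i - 1) (?B - {Min ?B})"
  proof (rule inj_onI)
    fix i j assume "i \<in> ?B - {Min ?B}" "j \<in> ?B - {Min ?B}" "i - 1 = j - 1"
    then show "i = j" using posB[of i] posB[of j] by simp
  qed
  then have cB': "card B' + 1 = card ?B" unfolding B'_def
    using fin(2) Min_in[OF fin(2) ne0(2)] by (simp add: card_image card_Suc_Diff1 del: card_Diff_insert)
  have A'w: "A' \<subseteq> {t<..b}"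
  proof
    fix q assume "q \<in> A'"
    then obtain m where m: "m \<in> ?A" "m \<noteq> Max ?A" "q = Suc m" by (auto simp: A'_def)
    then have "m < Max ?A" using fin by (metis Max_ge le_neq_implies_less)
    moreover have "Max ?A \<le> b" using Max_in[OF fin(1) ne0(1)] bc(5) by auto
    ultimately show "q \<in> {t<..b}" using m bc(5) by auto
  qed
  have B'w: "B' \<subseteq> {b<..t + n}"
  proof
    fix q assume "q \<in> B'"
    then obtain i where i: "i \<in> ?B" "i \<noteq> Min ?B" "q = i - 1" by (auto simp: B'_def)
    then have "Min ?B < i" using fin by (metis Min_le le_neq_implies_less)
    moreover have "c \<le> Min ?B" using Min_in[OF fin(2) ne0(2)] bc(6) by auto
    ultimately show "q \<in> {b<..t + n}" using i bc by auto
  qed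
  have nA: "E h (C q) \<and> \<not> E ?p (C q)" if qA: "q \<in> A'" for q
  proof -
    obtain m where m: "m \<in> ?A" "m \<noteq> Max ?A" "q = Suc m" using qA by (auto simp: A'_def)
    have "m < Max ?A" using m fin by (metis Max_ge le_neq_implies_less)
    then have "\<not> E ?p (C q)"
      using X_nonneighbour_after[OF t bc(5,4) _ m(1) Max_in[OF fin(1) ne0(1)]] m(3) bc(2,3) by simp
    moreover have "E h (C q)" using m(1,3) RV_iff[of m] by (simp add: Mp_def)
    ultimately show ?thesis by blast
  qed
  have nB: "E h (C q) \<and> \<not> E ?p (C q)" if qB: "q \<in> B'" for q
  proof -
    obtain i where i: "i \<in> ?B" "i \<noteq> Min ?B" "q = i - 1" using qB by (auto simp: B'_def)
    have "Min ?B < i" using i fin by (metis Min_le le_neq_implies_less)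
    then have "\<not> E ?p (C q)"
      using X_nonneighbour_before[OF t bc(6) _ i(1) Min_in[OF fin(2) ne0(2)]] i(3) bc(1,2) by simp
    moreover have "E h (C q)" using i(1,3) PV_iff'[of i] posB[OF i(1)] by (simp add: Np_def)
    ultimately show ?thesis by blast
  qed
  let ?X = "{u \<in> W. E h u}" and ?Xp = "{u \<in> W. E h u \<and> E ?p u}"
  have "C ` (A' \<union> B') \<subseteq> ?X - ?Xp" using nA nB X_Yo type_W(3) by blast
  moreover have fX: "finite ?X" using finite_W by simp
  ultimately have "card (C ` (A' \<union> B')) \<le> card (?X - ?Xp)" by (intro card_mono) auto
  moreover have "card (?X - ?Xp) = card ?X - card ?Xp" using finite_W by (intro card_Diff_subset) auto
  moreover have "card ?Xp \<le> card ?X" using fX by (intro card_mono) auto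
  moreover have "card (C ` (A' \<union> B')) = card (A' \<union> B')"
    by (rule card_image, rule inj_on_subset[OF inj_on_window[of t]]) (use A'w B'w bc in fastforce)
  moreover have "card (A' \<union> B') = card A' + card B'"
  proof (rule card_Un_disjoint)
    show "finite A'" "finite B'" using fin by (simp_all add: A'_def B'_def)
    have "{t<..b} \<inter> {b<..t + n} = {}" by auto
    then show "A' \<inter> B' = {}" using A'w B'w by blast
  qed
  ultimately have cX: "card ?Xp + card A' + card B' \<le> d" using d_degree by simp
  have p: "Io ?p" "?p \<in> W" using t type_W by (auto simp: BXB_def)
  have "{u \<in> W. E ?p u} \<subseteq> ?Xp \<union> {r \<in> RV. E ?p r}"
  proof
    fix v assume v: "v \<in> {u \<in> W. E ?p u}"
    then have vI: "v \<notin> Is" using Is_edge p(1) by (auto simp: Io_def)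
    then have "v \<in> range C" using off_D v by (auto simp: D_def)
    moreover have "v \<in> W" using v by simp
    ultimately obtain i where i: "0 < i" "i < n" "v = C i" by (rule range_index_W)
    show "v \<in> ?Xp \<union> {r \<in> RV. E ?p r}"
    proof (cases "E h v")
      case False
      then have "Jo v" using X_or_bad[OF i(1,2)] i(3) vI by (auto simp: Io_def)
      then have "v \<in> J" using ne v by (auto simp: Jo_def)
      then show ?thesis using v i(3) h_neq by (auto simp: J_def)
    qed (use v in auto)
  qed
  then have "card {u \<in> W. E ?p u} \<le> card (?Xp \<union> {r \<in> RV. E ?p r})"
    using finite_W finite_RV by (intro card_mono) auto
  also have "\<dots> \<le> card ?Xp + card {r \<in> RV. E ?p r}" by (rule card_Un_le)
  finally have "card {u \<in> W. E ?p u} \<le> card ?Xp + card ?A" using card_Mp by simp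
  \<comment> \<open>With \<open>u = card PV + 2 - k\<close> the degree of \<open>?p\<close> is at
    most \<open>d - 2 * (u - 1) + u = k + 1\<close>, which the degree bound permits for
    \<open>k \<le> 3\<close> only.\<close>
  then show False
    using degree_W[OF p(2)] cX cA' cB' cA cB ends_adjacent(4) tight(1) k_less k5 by linarith
qed

text \<open>The extra neighbour \<open>C m\<close> is followed by a vertex of \<open>Is - I\<close>.
  By \<open>BXB_Js\<close> and \<open>BXB_Is\<close>, \<open>C m\<close> is adjacent to the
  successor and \<open>C (Suc m)\<close> to the predecessor of every inner neighbour of
  \<open>h\<close>. Of three such neighbours two lie on the same side of \<open>m\<close> and yield
  the configuration of \<open>crossing_PR\<close>.\<close>

lemma tight_False: False
proof -
  obtain t where t: "BXB t" "1 < t" "Suc t < n" using BXB_representative by blast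
  obtain e where e: "e \<in> Js - J" "E (C (Suc t)) e" using extra_neighbour[OF t(1)] by blast
  have eW: "e \<in> W" using e Js_W by auto
  have "e \<notin> D" using e tight(3) by blast
  then have "e \<in> range C" using off_D eW by blast
  then obtain m where m: "0 < m" "m < n" "e = C m" using eW by (rule range_index_W)
  have Jm: "Jo (C m)" using e m \<open>e \<notin> D\<close> by (auto simp: Jo_def D_def)
  then have "m \<noteq> n - 1" using ends_adjacent(2) bad_not_X by metis
  then have mn: "Suc m < n" using m by simp
  have nX: "\<not> E h (C (Suc m))" using RV_iff[of m] e m C_neq_C0 by (auto simp: J_def)
  have W: "C m \<in> W" "C (Suc m) \<in> W" using m mn by (auto intro!: C_in_W)
  have Im: "Io (C (Suc m))" using transitions(2)[OF W Jm] Yo_X[of "Suc m"] mn nX by auto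
  have e': "C (Suc m) \<in> Is - I" using Im PV_iff[of m] bad_not_X(2)[OF Jm] h_neq by (auto simp: Io_def I_def)
  define S where "S = {q \<in> {2..<n - 1}. E h (C q)}"
  have "card S + 2 \<ge> d"
  proof -
    have "{i \<in> {1..<n}. E h (C i)} \<subseteq> S \<union> {1, n - 1}" by (auto simp: S_def)
    then have "d \<le> card (S \<union> {1, n - 1})" unfolding d_def by (intro card_mono) (auto simp: S_def)
    also have "\<dots> \<le> card S + card {1, n - 1}" by (rule card_Un_le)
    also have "card {1, n - 1} \<le> 2" by (simp add: card_insert_if)
    finally show ?thesis by simp
  qed
  then have "3 \<le> card S" using ends_adjacent(4) k_less k5 by simp
  then obtain T where T: "T \<subseteq> S" "card T = 3" by (metis obtain_subset_with_card_n)
  have sorted: "\<exists>q1 q2 q3. q1 \<in> S \<and> q2 \<in> S \<and> q3 \<in> S \<and> q1 < q2 \<and> q2 < q3"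
  proof -
    obtain a b c where "T = {a, b, c}" "a \<noteq> b" "b \<noteq> c" "a \<noteq> c" using T(2) by (auto simp: card_3_iff)
    then show ?thesis using T(1) by (metis insert_subset linorder_neqE_nat)
  qed
  then obtain q1 q2 q3 where q: "q1 \<in> S" "q2 \<in> S" "q3 \<in> S" "q1 < q2" "q2 < q3" by blast
  have B: "BXB q" if "q \<in> S" for q using that interior_BXB by (auto simp: S_def)
  have gap: "Suc q < q'" if "q \<in> S" "q' \<in> S" "q < q'" for q q'
    using that not_consecutive[of q] by (metis (no_types, lifting) S_def Suc_lessI mem_Collect_eq)
  have 1: "E (C m) (C (Suc q))" if "q \<in> S" for q using BXB_Js[OF B[OF that] e(1)] m(3) E_sym by blast
  have 2: "E (C (Suc m)) (C (q - 1))" if "q \<in> S" for q using BXB_Is[OF B[OF that] e'] E_sym by blast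
  have Xq: "E h (C q)" "2 \<le> q" "q < n - 1" if "q \<in> S" for q using that by (auto simp: S_def)
  show False
  proof (cases "m < q2")
    case True
    show False
    proof (rule crossing_PR[of h m "Suc q2" "q3 - 1"])
      show "Suc m < Suc q2" "Suc q2 \<le> q3 - 1" "q3 - 1 < m + n"
        using True gap[OF q(2,3,5)] Xq[OF q(3)] by auto
      show "E h (C (Suc q2 - 1))" "E h (C (Suc (q3 - 1)))" using Xq q by auto
      show "E (C m) (C (Suc q2)) \<and> E (C (Suc m)) (C (q3 - 1)) \<or> E (C (Suc m)) (C (Suc q2)) \<and> E (C m) (C (q3 - 1))"
        using 1[OF q(2)] 2[OF q(3)] by blast
    qed (rule h_off)
  next
    case False
    have "m \<noteq> q2" using Jm bad_not_X Xq(1)[OF q(2)] by blast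
    then have m2: "q2 < m" using False by simp
    have p: "C (Suc q1 + n) = C (Suc q1)" "C (q2 - 1 + n) = C (q2 - 1)" "C (q1 + n) = C q1" "C (q2 + n) = C q2"
      by (rule C_period)+
    have g: "Suc q1 < q2" using gap[OF q(1,2,4)] .
    show False
    proof (rule crossing_PR[of h m "Suc q1 + n" "q2 - 1 + n"])
      show "Suc m < Suc q1 + n" "Suc q1 + n \<le> q2 - 1 + n" "q2 - 1 + n < m + n"
        using m2 mn g by auto
      have "Suc (q2 - 1 + n) = q2 + n" using g by simp
      then show "E h (C (Suc q1 + n - 1))" "E h (C (Suc (q2 - 1 + n)))" using Xq q p by auto
      show "E (C m) (C (Suc q1 + n)) \<and> E (C (Suc m)) (C (q2 - 1 + n)) \<or> E (C (Suc m)) (C (Suc q1 + n)) \<and> E (C m) (C (q2 - 1 + n))"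
        using 1[OF q(1)] 2[OF q(2)] p by metis
    qed (rule h_off)
  qed
qed

end

section \<open>The case of eleven vertices\<close>

context counterexample
begin

text \<open>Such a path closes through \<open>C 0\<close> to a cycle that also covers
  \<open>h\<close>.\<close>

lemma no_spanning_path:
  assumes "distinct xs" "successively E xs" "hd xs = C 1" "last xs = C (n - 1)"
    and "set xs = insert h (C ` {1..<n})"
  shows False
proof (rule no_extension[of "C 0 # xs" "[h]"])
  have ne: "xs \<noteq> []" using assms(5) by auto
  have "C 0 \<notin> C ` {1..<n}"
  proof
    assume "C 0 \<in> C ` {1..<n}"
    then obtain i where "C 0 = C i" "i \<in> {1..<n}" by (rule imageE)
    then show False using C_neq_C0[of i] by simp
  qed
  then show "distinct (C 0 # xs)" using assms(1,5) h_neq[of 0] by simp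
  show "successively E (C 0 # xs)" using assms ne C_edge[of 0] by (simp add: successively_Cons)
  show "E (last (C 0 # xs)) (hd (C 0 # xs))" using ne assms C_edge[of "n - 1"] n_pos C_n by simp
  have "C ` {..<n} = range C" using range_index by auto
  moreover have "{..<n} = insert 0 {1..<n}" using n_pos by auto
  ultimately have "range C = insert (C 0) (C ` {1..<n})" by auto
  then show "set (C 0 # xs) = set [h] \<union> range C" using assms by auto
qed (use h_off in auto)

text \<open>\<open>RV_bound\<close> gives \<open>k \<le> 3\<close>, and the relocation count gives
  \<open>card D \<le> k - 2\<close>. Since \<open>h\<close> is in \<open>D\<close>, all bounds are
  attained.\<close>

lemma small_cases:
  assumes "card PV = k" shows "k = 3" "D = {h}" "PVI = PV" "full s j \<Longrightarrow> card (Apos s j) \<le> 2"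
proof -
  have "card {h} \<le> card D" using h_D finite_D by (intro card_mono) auto
  then have D1: "card D \<ge> 1" by simp
  obtain s' j' where sj: "full s' j'" using full_exists by blast
  have k3: "k \<le> 3" using assms RV_bound card_RV_PV by simp
  have 4: "k + 1 \<le> card PVI + card D"
  proof -
    have "card I \<le> card (I \<union> D)" using finite_D I_W finite_W finite_subset by (intro card_mono) blast+
    then show ?thesis using card_I card_I_D assms by simp
  qed
  have 1: "card PVI \<le> card (Apos s' j') + 1" using Pos_Apos[OF sj] ends_adjacent(2) by simp
  have 2: "card (Apos s' j') + 2 * card D + 2 \<le> 2 * k" using relocation_count[OF sj] .
  show "k = 3" using 1 2 4 D1 k3 k2 by linarith
  then have D: "card D = 1" and P: "card PVI = 3" using 1 2 4 D1 by linarith+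
  show "D = {h}" using D h_D by (auto simp: card_1_singleton_iff)
  show "PVI = PV" using P assms \<open>k = 3\<close> finite_PV by (intro card_subset_eq) (auto simp: PVI_def)
  show "card (Apos s j) \<le> 2" if "full s j" using relocation_count[OF that] D \<open>k = 3\<close> by simp
qed

text \<open>The segment after \<open>s\<close> has length two: otherwise it continues with an
  \<open>Io\<close> vertex. The segment of another run \<open>i'\<close> is full, and outside it the
  positions \<open>i''\<close>, \<open>Suc s\<close> and the continuation are three candidates,
  while at most two are possible.\<close>

lemma small_step:
  assumes k: "card PV = k" and s: "0 < s" "s < n - 1" "E h (C s)"
  shows "Suc (Suc (Suc s)) < n" "E h (C (Suc (Suc (Suc s))))"
    and "Io (C (Suc s))" "Jo (C (Suc (Suc s)))"
proof -
  note sc = small_cases[OF k]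
  have DIJ: "D \<subseteq> I" "D \<subseteq> J" using sc(2) by (auto simp: I_def J_def)
  have Xn: "E h (C (n - 1))" by (rule ends_adjacent)
  have less: "i < n - 1" if "i < n" "Io (C i) \<or> Jo (C i)" for i
  proof -
    have "i \<noteq> n - 1" using that Xn bad_not_X by blast
    then show ?thesis using that by simp
  qed
  have "Suc s \<noteq> n - 1" using not_consecutive[OF s(3)] Xn by metis
  then have s1: "Suc s < n - 1" using s by simp
  have "C (Suc s) \<in> PV" using PV_iff[of s] s C_neq_C0[of "Suc s"] s1 by auto
  then have SP: "Suc s \<in> Pos" using sc(3) s1 by (auto simp: Pos_def)
  show I1: "Io (C (Suc s))" using SP PVI_Io by (auto simp: Pos_def)
  have W: "C (Suc s) \<in> W" "C (Suc (Suc s)) \<in> W" using s1 by (auto intro!: C_in_W)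
  show J2: "Jo (C (Suc (Suc s)))" using transitions(1)[OF W I1] .
  then have s2: "Suc (Suc s) < n - 1" using less[of "Suc (Suc s)"] s1 by simp
  then show s3: "Suc (Suc (Suc s)) < n" by simp
  then have W3: "C (Suc (Suc (Suc s))) \<in> W" by (intro C_in_W) auto
  show "E h (C (Suc (Suc (Suc s))))"
  proof (rule ccontr)
    let ?q = "Suc (Suc (Suc s))"
    assume "\<not> E h (C ?q)"
    then have I3: "Io (C ?q)" using transitions(2)[OF W(2) W3 J2] Yo_X_if[OF DIJ, of ?q] s3 by blast
    have q3: "?q < n - 1" using less[of ?q] I3 s3 by simp
    have bq: "?q < bend (Suc s)"
    proof (rule ccontr)
      assume "\<not> ?q < bend (Suc s)"
      moreover have sn: "Suc s < n" using s1 by simp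
      ultimately have "bend (Suc s) = Suc (Suc s) \<or> bend (Suc s) = ?q"
        using bend_facts(1)[OF sn] by linarith
      then show False using bend_facts(3,4)[OF sn] J2 I3 by auto
    qed
    have "card Pos = 3" using card_Pos sc(1,3) k by simp
    then have "card (Pos - {Suc s}) = 2" using SP finite_Pos by simp
    then obtain i' i'' where i: "i' \<in> Pos - {Suc s}" "i'' \<in> Pos - {Suc s}" "i' \<noteq> i''"
      using two_elements[of "Pos - {Suc s}"] by auto
    have i'0: "0 < i'" "i' < n" "Io (C i')" using i PVI_Io by (auto simp: Pos_def)
    have i''0: "0 < i''" "i'' < n" "Io (C i'')" using i PVI_Io by (auto simp: Pos_def)
    have "\<not> (Io (C (n - 1)) \<or> Jo (C (n - 1)))" using Xn bad_not_X by blast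
    then have "bend i' \<le> n - 1" using bend_le[of i' "n - 1"] less[OF i'0(2)] i'0 by blast
    then have bn: "bend i' < n" using n_pos by simp
    have "E h (C (bend i'))"
      using bend_type(2)[OF i'0 bn] Yo_X_if[OF DIJ, of "bend i'"] bn bend_facts(1)[OF i'0(2)] by simp
    then have full: "full (i' - 1) (bend i' - 1)" using full_bend[of i'] i bn by simp
    have out: "m \<notin> {i' - 1<..bend i' - 1}" if "m < i' \<or> bend i' < m" for m using that by auto
    have 1: "i'' < i' \<or> bend i' < i''" using bend_Pos[of i' i''] i by (cases "i' < i''") auto
    have 2: "Suc s < i' \<or> bend i' < Suc s" using bend_Pos[of i' "Suc s"] i SP by (cases "i' < Suc s") auto
    then have 3: "?q < i' \<or> bend i' < ?q" using bend_Pos[of "Suc s" i'] bq i(1) SP by (cases "Suc s < i'") auto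
    have "{i'', Suc s, ?q} \<subseteq> Apos (i' - 1) (bend i' - 1)"
      using out[OF 1] out[OF 2] out[OF 3] i''0 less[of i''] I1 I3 s1 q3 by (auto simp: Apos_def)
    moreover have "finite (Apos (i' - 1) (bend i' - 1))" by (simp add: Apos_def)
    ultimately have "card {i'', Suc s, ?q} \<le> card (Apos (i' - 1) (bend i' - 1))" by (intro card_mono)
    moreover have "i'' \<noteq> ?q"
    proof
      assume "i'' = ?q"
      then have "E h (C (Suc (Suc s)))" using i PV_iff[of "Suc (Suc s)"] by (auto simp: Pos_def PVI_def)
      then show False using J2 bad_not_X by blast
    qed
    then have "card {i'', Suc s, ?q} = 3" using i by auto
    ultimately show False using sc(4)[OF full] by simp
  qed
qed

text \<open>From \<open>C 1\<close> onwards \<open>small_step\<close> produces the neighbours of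
  \<open>h\<close> at 4, 7 and 10; as \<open>d = 4\<close> there are no others, and the last
  position \<open>n - 1\<close> must be 10.\<close>

lemma small_structure:
  assumes k: "card PV = k"
  shows "n = 11" "E h (C 1)" "E h (C 4)" "E h (C 7)" "E h (C 10)"
    and "PV = {C 2, C 5, C 8}" "RV = {C 3, C 6, C 9}"
    and "Io (C 2)" "Io (C 5)" "Jo (C 6)"
proof -
  have d4: "d = 4" using ends_adjacent(4) small_cases(1)[OF k] k by simp
  have Xn: "E h (C (n - 1))" by (rule ends_adjacent)
  show X1: "E h (C 1)" by (rule ends_adjacent)
  have nX: "\<not> E h (C v)" if "Io (C v) \<or> Jo (C v)" for v using that bad_not_X by blast
  have s1: "Suc (Suc (Suc 1)) < n" "E h (C 4)" "Io (C 2)" "Jo (C 3)"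
    using small_step[OF k _ _ X1] n3 by (auto simp: numeral_eq_Suc)
  have "n - 1 \<noteq> 4"
  proof
    assume "n - 1 = 4"
    then have "{1..<n} = {1, 2, 3, 4}" by auto
    then have "{i \<in> {1..<n}. E h (C i)} \<subseteq> {1, 4}"
      using nX[of 2] nX[of 3] s1 by auto
    then have "d \<le> card {1, 4::nat}" unfolding d_def by (intro card_mono) auto
    then show False using d4 by simp
  qed
  then have "4 < n - 1" using s1 by simp
  then have s2: "7 < n" "E h (C 7)" "Io (C 5)" "Jo (C 6)"
    using small_step[OF k _ _ s1(2)] by (auto simp: numeral_eq_Suc)
  have "n - 1 \<noteq> 7"
  proof
    assume "n - 1 = 7"
    then have "{1..<n} = {1, 2, 3, 4, 5, 6, 7}" by auto
    then have "{i \<in> {1..<n}. E h (C i)} \<subseteq> {1, 4, 7}"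
      using nX[of 2] nX[of 3] nX[of 5] nX[of 6] s1 s2 by auto
    then have "d \<le> card {1, 4, 7::nat}" unfolding d_def by (intro card_mono) auto
    then show False using d4 by simp
  qed
  then have "7 < n - 1" using s2 by simp
  then have s3: "10 < n" "E h (C 10)" "Io (C 8)" "Jo (C 9)"
    using small_step[OF k _ _ s2(2)] by (auto simp: numeral_eq_Suc)
  have "{1, 4, 7, 10} \<subseteq> {i \<in> {1..<n}. E h (C i)}" using X1 s1 s2 s3 by auto
  moreover have "card {i \<in> {1..<n}. E h (C i)} = card {1, 4, 7, 10::nat}" using d4 by (simp add: d_def)
  ultimately have Xset: "{1, 4, 7, 10} = {i \<in> {1..<n}. E h (C i)}" by (intro card_subset_eq) auto
  have "n - 1 \<in> {i \<in> {1..<n}. E h (C i)}" using Xn n3 by auto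
  then have "n - 1 \<in> {1, 4, 7, 10}" by (subst Xset)
  then show n11: "n = 11" using s3(1) by auto
  show "E h (C 4)" "E h (C 7)" "E h (C 10)" "Io (C 2)" "Io (C 5)" "Jo (C 6)" using s1 s2 s3 by auto
  have "{i \<in> {1..<n - 1}. E h (C i)} = {i \<in> {1..<n}. E h (C i)} \<inter> {..<n - 1}" by auto
  also have "\<dots> = {1, 4, 7}" unfolding Xset[symmetric] using n11 by auto
  finally have "{i \<in> {1..<n - 1}. E h (C i)} = {1, 4, 7}" .
  then show "PV = {C 2, C 5, C 8}" using PV_image by (simp add: numeral_eq_Suc)
  have "{i \<in> {2..<n}. E h (C i)} = {i \<in> {1..<n}. E h (C i)} \<inter> {2..}" by auto
  also have "\<dots> = {4, 7, 10}" unfolding Xset[symmetric] by auto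
  finally have "{i \<in> {2..<n}. E h (C i)} = {4, 7, 10}" .
  then show "RV = {C 3, C 6, C 9}" using RV_image by (simp add: numeral_eq_Suc)
qed

lemma small_False:
  assumes k: "card PV = k" shows False
proof -
  note st = small_structure[OF k]
  have n11: "n = 11" by (rule st)
  have k3: "k = 3" by (rule small_cases[OF k])
  have S: "{1..<n} = {1, 2, 3, 4, 5, 6, 7, 8, 9, 10}"
    unfolding n11 by (auto simp: atLeastLessThan_nat_numeral)
  have ne: "C i \<noteq> C j" if "i < 11" "j < 11" "i \<noteq> j" for i j
    using that n11 by (simp add: C_eq_iff)
  have con: "E (C 1) (C 2)" "E (C 2) (C 3)" "E (C 3) (C 4)" "E (C 4) (C 5)" "E (C 5) (C 6)"
      "E (C 6) (C 7)" "E (C 7) (C 8)" "E (C 8) (C 9)" "E (C 9) (C 10)"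
    using C_edge[of 1] C_edge[of 2] C_edge[of 3] C_edge[of 4] C_edge[of 5] C_edge[of 6] C_edge[of 7]
      C_edge[of 8] C_edge[of 9] by (simp_all add: numeral_eq_Suc)
  note adj = con con[THEN E_sym] st(2-5) st(2-5)[THEN E_sym]
  have sp: False if "distinct xs" "successively E xs" "hd xs = C 1" "last xs = C 10"
      "set xs = insert h (C ` {1, 2, 3, 4, 5, 6, 7, 8, 9, 10})" for xs
    by (rule no_spanning_path[OF that(1-3)]) (use that(4,5) n11 S in simp_all)
  \<comment> \<open>Each list is a path from \<open>C 1\<close> to \<open>C 10\<close> through all
    cycle vertices other than \<open>C 0\<close> and through \<open>h\<close>; so the additional
    edges it uses cannot occur together.\<close>
  have h1: False if "E (C 2) (C 9)" "E (C 6) (C 8)"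
    by (rule sp[of "[C 1, h, C 7, C 8, C 6, C 5, C 4, C 3, C 2, C 9, C 10]"])
      (use adj that[THEN E_sym] that h_neq ne in auto)
  have h2: False if "E (C 2) (C 6)" "E (C 3) (C 5)"
    by (rule sp[of "[C 1, C 2, C 6, C 5, C 3, C 4, h, C 7, C 8, C 9, C 10]"])
      (use adj that[THEN E_sym] that h_neq ne in auto)
  have h3: False if "E (C 2) (C 6)" "E (C 1) (C 5)"
    by (rule sp[of "[C 1, C 5, C 6, C 2, C 3, C 4, h, C 7, C 8, C 9, C 10]"])
      (use adj that[THEN E_sym] that h_neq ne in auto)
  have h4: False if "E (C 2) (C 6)" "E (C 5) (C 7)"
    by (rule sp[of "[C 1, h, C 4, C 3, C 2, C 6, C 5, C 7, C 8, C 9, C 10]"])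
      (use adj that[THEN E_sym] that h_neq ne in auto)
  have h5: False if "E (C 2) (C 6)" "E (C 5) (C 9)" "E (C 5) (C 10)"
    by (rule sp[of "[C 1, h, C 4, C 3, C 2, C 6, C 7, C 8, C 9, C 5, C 10]"])
      (use adj that[THEN E_sym] that h_neq ne in auto)
  have cN: "2 \<le> card {p \<in> PV. E v p}" if "Jo v" for v
    using Np_card[of v 0] that type_W(2)[OF that] bad_not_X(2)[OF that] E_comm[of h v] k card_Np[of 0 v]
    by (simp add: Jo_def)
  have cM: "2 \<le> card {p \<in> RV. E v p}" if "Io v" for v
    using Mp_card[of v 0] that type_W(1)[OF that] bad_not_X(1)[OF that] E_comm[of h v] k card_Mp[of 0 v]
      ends_adjacent(3) by (simp add: Io_def)
  have other: "\<exists>q\<in>{p \<in> Q. E v p}. q \<noteq> w" if "2 \<le> card {p \<in> Q. E v p}" for Q v w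
    using two_elements[OF that] by metis
  \<comment> \<open>\<open>C 6\<close> has two neighbours in \<open>PV\<close>, so one besides
    \<open>C 5\<close>; likewise \<open>C 2\<close> and \<open>C 5\<close> have one in
    \<open>RV\<close> besides \<open>C 3\<close> and \<open>C 6\<close>.\<close>
  have n6: "E (C 2) (C 6) \<or> E (C 6) (C 8)"
    using other[OF cN[OF st(10)], of "C 5"] st(6) E_sym by auto
  have n2: "E (C 2) (C 6) \<or> E (C 2) (C 9)"
    using other[OF cM[OF st(8)], of "C 3"] st(7) by auto
  have n5: "E (C 3) (C 5) \<or> E (C 5) (C 9)"
    using other[OF cM[OF st(9)], of "C 6"] st(7) E_sym by auto
  have e26: "E (C 2) (C 6)" using n6 n2 h1 by blast
  \<comment> \<open>From here on \<open>C 5\<close> loses all possible neighbours but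
    \<open>C 4\<close>, \<open>C 6\<close> and \<open>C 9\<close>, while \<open>k = 3\<close>
    demands degree four.\<close>
  have no: "\<not> E (C 5) (C 3)" "\<not> E (C 5) (C 1)" "\<not> E (C 5) (C 7)" using h2 h3 h4 e26 E_sym by blast+
  moreover have "\<not> E (C 5) (C 10)" using h5 e26 n5 h2 by blast
  moreover have "\<not> E (C 5) (C 2)" "\<not> E (C 5) (C 8)" "\<not> E (C 5) h"
    using independent_I st(6) by (auto simp: independent_def I_def)
  moreover have "W \<subseteq> insert h (C ` {1..<n})"
  proof
    fix v assume v: "v \<in> W"
    show "v \<in> insert h (C ` {1..<n})"
    proof (cases "v \<in> range C")
      case True
      then obtain i where "0 < i" "i < n" "v = C i" using v by (rule range_index_W)
      then show ?thesis by auto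
    next
      case False
      then show ?thesis using off_D[OF v] small_cases(2)[OF k] by simp
    qed
  qed
  ultimately have "{u \<in> W. E (C 5) u} \<subseteq> {C 4, C 6, C 9}" using E_irrefl unfolding S by auto
  then have "card {u \<in> W. E (C 5) u} \<le> card {C 4, C 6, C 9}" by (intro card_mono) auto
  also have "\<dots> \<le> 3" by (simp add: card_insert_if)
  finally have "card {u \<in> W. E (C 5) u} \<le> 3" .
  moreover have "C 5 \<in> W" using C_in_W n11 by simp
  ultimately show False using degree_W[of "C 5"] k3 by simp
qed

lemma contradiction: False
proof (cases "k < card PV")
  case True
  then interpret tight_counterexample E C n W h k by unfold_locales
  show False by (rule tight_False)
next
  case False
  then show False using small_False k_le_PV by simp
qed

end

section \<open>From paths to cycles\<close>

lemma K2_kK1_free_card: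
  assumes g: "graph V E" and f: "induced_free V E (K2_kK1_V k) K2_kK1_E"
    and e: "E a b" and S: "S \<subseteq> V" "independent E S" "\<forall>s\<in>S. \<not> E a s \<and> \<not> E b s"
  shows "card S < k"
proof (rule ccontr)
  assume "\<not> card S < k"
  then obtain T where T: "T \<subseteq> S" "card T = k" by (metis not_less obtain_subset_with_card_n)
  have sym: "E u v \<Longrightarrow> E v u" and irr: "\<not> E u u" and inV: "E u v \<Longrightarrow> u \<in> V" for u v
    using g by (auto simp: graph_def)
  have "finite V" using g by (simp add: graph_def)
  then have "finite T" using T S by (meson finite_subset)
  then obtain c where c: "bij_betw c {0..<k} T" using T ex_bij_betw_nat_finite by blast
  \<comment> \<open>Pattern vertices 0 and 1 go to the edge; the others, shifted by two, enumerate
    \<open>k\<close> elements of \<open>S\<close>.\<close>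
  define F where "F i = (if i = 0 then a else if i = 1 then b else c (i - 2))" for i :: nat
  have cT: "c (i - 2) \<in> T" if "i \<in> K2_kK1_V k" "i \<noteq> 0" "i \<noteq> 1" for i
    using c that by (auto simp: bij_betw_def K2_kK1_V_def)
  have aT: "a \<notin> T" "b \<notin> T" using e S(3) T sym by blast+
  have TE: "\<not> E a t" "\<not> E b t" "\<not> E t a" "\<not> E t b" if "t \<in> T" for t
    using that S(3) T sym by blast+
  have TT: "\<not> E t t'" if "t \<in> T" "t' \<in> T" for t t' using that S(2) T by (auto simp: independent_def)
  have "inj_on F (K2_kK1_V k)"
  proof (rule inj_onI)
    fix i j assume ij: "i \<in> K2_kK1_V k" "j \<in> K2_kK1_V k" "F i = F j"
    have ab: "a \<noteq> b" using e irr by auto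
    have big: "i = j" if "i \<noteq> 0" "i \<noteq> 1" "j \<noteq> 0" "j \<noteq> 1"
    proof -
      have "c (i - 2) = c (j - 2)" "i - 2 \<in> {0..<k}" "j - 2 \<in> {0..<k}"
        using ij that by (auto simp: F_def K2_kK1_V_def)
      then have "i - 2 = j - 2" using c by (auto simp: bij_betw_def inj_on_def)
      then show ?thesis using that by linarith
    qed
    have small: "F m \<in> {a, b}" if "m = 0 \<or> m = 1" for m using that by (auto simp: F_def)
    have FT: "F m \<in> T" if "m \<in> K2_kK1_V k" "\<not> (m = 0 \<or> m = 1)" for m
      using cT[of m] that by (simp add: F_def)
    have ne: "\<not> (F m \<in> T \<and> F m \<in> {a, b})" for m using aT by auto
    have F01: "F 0 = a" "F 1 = b" by (simp_all add: F_def)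
    show "i = j"
    proof (cases "i = 0 \<or> i = 1")
      case True
      then have "j = 0 \<or> j = 1" using small[of i] FT[OF ij(2)] ne[of j] ij(3) by metis
      then show ?thesis using True F01 ij(3) ab by metis
    next
      case False
      then have "\<not> (j = 0 \<or> j = 1)" using small[of j] FT[OF ij(1)] ne[of i] ij(3) by metis
      then show ?thesis using False by (intro big) simp_all
    qed
  qed
  moreover have "F ` K2_kK1_V k \<subseteq> V"
  proof
    fix v assume "v \<in> F ` K2_kK1_V k"
    then obtain i where i: "i \<in> K2_kK1_V k" "v = F i" by blast
    have "a \<in> V" "b \<in> V" using inV e sym by blast+
    then show "v \<in> V" using i cT[OF i(1)] T(1) S(1) by (auto simp: F_def)
  qed
  moreover have "K2_kK1_E i j \<longleftrightarrow> E (F i) (F j)" if "i \<in> K2_kK1_V k" "j \<in> K2_kK1_V k" for i j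
  proof -
    have "E b a" using e sym by blast
    then show ?thesis
      using e irr TE[OF cT[OF that(1)]] TE[OF cT[OF that(2)]] TT[OF cT[OF that(1)] cT[OF that(2)]]
      by (cases "i = 0"; cases "i = 1"; cases "j = 0"; cases "j = 1") (simp_all add: F_def K2_kK1_E_def)
  qed
  ultimately have "has_induced V E (K2_kK1_V k) K2_kK1_E" unfolding has_induced_def by blast
  then show False using f by (simp add: induced_free_def)
qed

lemma min_degree_le:
  assumes "graph V E" "v \<in> V" shows "min_degree V E \<le> card {u \<in> V. E v u}"
  using assms by (auto simp: min_degree_def degree_def graph_def)

lemma independence_number_ge:
  assumes "graph V E" "S \<subseteq> V" "independent E S" shows "card S \<le> independence_number V E"
proof -
  have "finite V" using assms by (simp add: graph_def)
  then have "finite (card ` Pow V)" by simp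
  moreover have "{card I |I. I \<subseteq> V \<and> independent E I} \<subseteq> card ` Pow V" by auto
  ultimately have "finite {card I |I. I \<subseteq> V \<and> independent E I}" by (rule rev_finite_subset)
  then show ?thesis unfolding independence_number_def by (rule Max_ge) (use assms in auto)
qed

text \<open>The path grows along the walk; when the walk returns to a vertex of the path, the path
  is cut back to that vertex.\<close>

lemma rtranclp_path:
  assumes "(\<lambda>a b. a \<in> U \<and> b \<in> U \<and> E a b)\<^sup>*\<^sup>* u v" "u \<in> U"
  shows "\<exists>p. p \<noteq> [] \<and> hd p = u \<and> last p = v \<and> distinct p \<and> set p \<subseteq> U \<and> successively E p"
  using assms(1)
proof (induction rule: rtranclp_induct)
  case base
  then show ?case using assms(2) by (intro exI[of _ "[u]"]) simp
next
  case (step v w)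
  then obtain p where p: "p \<noteq> []" "hd p = u" "last p = v" "distinct p" "set p \<subseteq> U" "successively E p"
    by blast
  show ?case
  proof (cases "w \<in> set p")
    case True
    then obtain q r where qr: "p = q @ w # r" by (meson split_list)
    let ?q = "q @ [w]"
    have "hd ?q = u" using p qr by (cases q) auto
    moreover have "successively E ?q" using p(6) qr by (auto simp: successively_append_iff)
    ultimately show ?thesis using p qr by (intro exI[of _ ?q]) auto
  next
    case False
    then show ?thesis using p step.hyps
      by (intro exI[of _ "p @ [w]"]) (auto simp: successively_append_iff)
  qed
qed

section \<open>Cycles given as lists, and the added vertex\<close>

lemma successively_nth:
  "successively P xs \<Longrightarrow> Suc i < length xs \<Longrightarrow> P (xs ! i) (xs ! Suc i)"
proof (induction xs arbitrary: i rule: induct_list012)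
  case (3 a b xs)
  then show ?case by (cases i) auto
qed auto

lemma rotate_cycle:
  assumes "distinct (A @ B)" "successively E (A @ B)" "E (last (A @ B)) (hd (A @ B))" "A \<noteq> []" "B \<noteq> []"
  shows "distinct (B @ A)" "successively E (B @ A)" "E (last (B @ A)) (hd (B @ A))"
  using assms by (auto simp: successively_append_iff)

text \<open>A cycle covering \<open>L\<close> passes through \<open>hd L\<close>, so it is not
  longer than \<open>L\<close> and has no further vertex.\<close>

lemma list_cycle_max_cycle:
  fixes L :: "'b list"
  assumes sym: "\<And>a b. E a b \<Longrightarrow> E b a" and irr: "\<And>a. \<not> E a a"
    and L: "distinct L" "successively E L" "E (last L) (hd L)" "L \<noteq> []"
    and max: "\<And>M. \<lbrakk>distinct M; successively E M; E (last M) (hd M); hd L \<in> set M\<rbrakk> \<Longrightarrow> length M \<le> length L"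
  shows "max_cycle E (\<lambda>i. L ! (i mod length L)) (length L)"
    and "range (\<lambda>i. L ! (i mod length L)) = set L"
proof -
  let ?C = "\<lambda>i. L ! (i mod length L)" and ?n = "length L"
  have n: "?n > 0" using L by simp
  show r: "range ?C = set L"
  proof
    show "range ?C \<subseteq> set L" using n by auto
    show "set L \<subseteq> range ?C"
    proof
      fix v assume "v \<in> set L"
      then obtain i where "i < ?n" "v = L ! i" by (auto simp: in_set_conv_nth)
      then have "v = ?C i" by simp
      then show "v \<in> range ?C" by blast
    qed
  qed
  note suc = successively_nth[OF L(2)]
  show "max_cycle E ?C ?n"
  proof
    show "E (?C i) (?C (Suc i))" for i
    proof (cases "Suc (i mod ?n) = ?n")
      case True
      then have "Suc i mod ?n = 0" by (simp add: mod_Suc)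
      moreover have "i mod ?n = ?n - 1" using True by simp
      ultimately show ?thesis using L(3,4) by (simp add: hd_conv_nth last_conv_nth)
    next
      case False
      then have "Suc i mod ?n = Suc (i mod ?n)" by (simp add: mod_Suc)
      moreover have "Suc (i mod ?n) < ?n" using False n by (metis Suc_lessI mod_less_divisor)
      ultimately show ?thesis using suc by simp
    qed
    show "inj_on ?C {..<?n}" using L(1) by (auto simp: inj_on_def nth_eq_iff_index_eq)
    show "set M \<subseteq> range ?C"
      if M: "distinct M" "successively E M" "E (last M) (hd M)" "range ?C \<subseteq> set M" for M
    proof -
      have "hd L \<in> set M" using M(4) r L(4) by auto
      then have "length M \<le> ?n" using max M by blast
      then have "card (set M) \<le> card (set L)" using M(1) L(1) by (simp add: distinct_card)
      then have "set L = set M" using M(4) r by (intro card_seteq) auto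
      then show ?thesis using r by simp
    qed
  qed (use sym irr n in auto)
qed

text \<open>\<open>None\<close> is the new vertex; a Hamiltonian path from \<open>x\<close> to
  \<open>y\<close> corresponds to a Hamiltonian cycle through it.\<close>

definition add_vertex :: "('a \<Rightarrow> 'a \<Rightarrow> bool) \<Rightarrow> 'a \<Rightarrow> 'a \<Rightarrow> 'a option \<Rightarrow> 'a option \<Rightarrow> bool" where
  "add_vertex E x y a b \<longleftrightarrow> (case a of
     None \<Rightarrow> b = Some x \<or> b = Some y
   | Some u \<Rightarrow> (case b of None \<Rightarrow> u = x \<or> u = y | Some v \<Rightarrow> E u v))"

lemma add_vertex_simps [simp]:
  "add_vertex E x y None b \<longleftrightarrow> b = Some x \<or> b = Some y"
  "add_vertex E x y (Some u) None \<longleftrightarrow> u = x \<or> u = y"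
  "add_vertex E x y (Some u) (Some v) \<longleftrightarrow> E u v"
  by (auto simp: add_vertex_def)

lemma successively_add_vertex [simp]: "successively (add_vertex E x y) (map Some p) \<longleftrightarrow> successively E p"
  by (simp add: successively_map)

text \<open>If an off-cycle component had an edge, it would have more than \<open>k\<close> neighbours on the cycle, and
  their successors would complete that edge to an induced \<open>K2 \<union> k K1\<close>.\<close>
lemma off_cycle_independent:
  fixes V :: "'a set"
  assumes g: "graph V E" and conn: "k_connected V E (k + 1)"
    and free: "\<And>a b S. \<lbrakk>E a b; S \<subseteq> V; independent E S; \<forall>s\<in>S. \<not> E a s \<and> \<not> E b s\<rbrakk> \<Longrightarrow> card S < k"
    and mc: "max_cycle (add_vertex E x y) C n" and C0: "C 0 = None" and n3: "n \<ge> 3"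
    and rV: "range C \<subseteq> insert None (Some ` V)"
    and a: "a \<in> V" "Some a \<notin> range C" and b: "b \<in> V" "Some b \<notin> range C" and ab: "E a b"
  shows False
proof -
  interpret max_cycle "add_vertex E x y" C n by (rule mc)
  have Esym: "E u v \<Longrightarrow> E v u" and fV: "finite V" for u v using g by (auto simp: graph_def)
  define U where "U = {v \<in> V. Some v \<notin> range C}"
  define r where "r = (\<lambda>u v. u \<in> U \<and> v \<in> U \<and> E u v)"
  define H where "H = {w. r\<^sup>*\<^sup>* a w}"
  have aU: "a \<in> U" "b \<in> U" using a b by (auto simp: U_def)
  have "w \<in> U" if "r\<^sup>*\<^sup>* a w" for w using that by (induction) (auto simp: r_def aU)
  then have HU: "H \<subseteq> U" by (auto simp: H_def)
  have abH: "a \<in> H" "b \<in> H" using ab aU by (auto simp: H_def r_def)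
  have path: "\<exists>Q. Q \<noteq> [] \<and> hd Q = Some u \<and> last Q = Some v \<and> distinct Q \<and> set Q \<inter> range C = {} \<and>
      successively (add_vertex E x y) Q" if "u \<in> H" "v \<in> H" for u v
  proof -
    have "symp r" using Esym by (auto simp: symp_def r_def)
    then have "symp r\<^sup>*\<^sup>*" by (rule symp_rtranclp)
    then have "r\<^sup>*\<^sup>* u a" using that by (auto simp: H_def symp_def)
    then have "r\<^sup>*\<^sup>* u v" using that by (auto simp: H_def)
    moreover have "u \<in> U" using that HU by blast
    ultimately obtain p where p: "p \<noteq> []" "hd p = u" "last p = v" "distinct p" "set p \<subseteq> U" "successively E p"
      using rtranclp_path[of U E u v] unfolding r_def by blast
    then show ?thesis
      by (intro exI[of _ "map Some p"]) (auto simp: hd_map last_map distinct_map U_def)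
  qed
  define N where "N = {v \<in> V - U. \<exists>w\<in>H. E w v}"
  have insertion: False if uv: "u \<in> H" "v \<in> H" and e: "add_vertex E x y (Some u) (C i)"
      "add_vertex E x y (Some v) (C (Suc i))" for u v i
  proof -
    obtain Q where Q: "Q \<noteq> []" "hd Q = Some u" "last Q = Some v" "distinct Q" "set Q \<inter> range C = {}"
      "successively (add_vertex E x y) Q" using path[OF uv] by blast
    show False using no_insertion[OF Q(4,6,5,1)] Q(2,3) e by metis
  qed
  have neq0: "C i \<noteq> C 0" if "0 < i" "i < n" for i
    using that C_eq_iff by simp
  have on_cycle: "\<exists>v\<in>V - U. C i = Some v" if "0 < i" "i < n" for i
  proof -
    have "C i \<in> insert None (Some ` V)" using rV by blast
    moreover have "C i \<noteq> None" using neq0[OF that] C0 by simp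
    ultimately obtain v where "v \<in> V" "C i = Some v" by auto
    moreover have "Some v \<in> range C" using calculation(2) by (metis rangeI)
    ultimately show ?thesis by (auto simp: U_def)
  qed
  \<comment> \<open>Fewer than \<open>k + 1\<close> neighbours cannot separate \<open>H\<close> from
    a vertex outside \<open>U\<close>, so all these vertices are in \<open>N\<close>. Among them are
    the consecutive \<open>C 1\<close> and \<open>C 2\<close>, between which a path of
    \<open>H\<close> could be inserted.\<close>
  have N: "k + 1 \<le> card N"
  proof (rule ccontr)
    assume "\<not> k + 1 \<le> card N"
    then have c: "connected_on (V - N) E" using conn by (auto simp: k_connected_def N_def)
    have stay: "w \<in> H" if "(\<lambda>x y. x \<in> V - N \<and> y \<in> V - N \<and> E x y)\<^sup>*\<^sup>* a w" for w
      using that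
    proof (induction rule: rtranclp_induct)
      case (step v w)
      then have "w \<in> U" by (auto simp: N_def)
      then have "r v w" using step HU by (auto simp: r_def)
      then show ?case using step.IH by (auto simp: H_def)
    qed (use abH in simp)
    have "V - U \<subseteq> N"
    proof
      fix v assume v: "v \<in> V - U"
      show "v \<in> N"
      proof (rule ccontr)
        assume "v \<notin> N"
        moreover have "a \<in> V - N" using a aU by (auto simp: N_def)
        ultimately have "v \<in> H" using c v stay by (auto simp: connected_on_def)
        then show False using HU v by blast
      qed
    qed
    then obtain c1 c2 where "c1 \<in> N" "C 1 = Some c1" "c2 \<in> N" "C 2 = Some c2"
      using on_cycle[of 1] on_cycle[of 2] n3 by auto
    then show False using insertion[of _ _ 1] by (auto simp: N_def numeral_2_eq_2)
  qed
  \<comment> \<open>Position \<open>n - 1\<close> is left out because its successor is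
    \<open>None\<close>; of the \<open>k + 1\<close> neighbours \<open>k\<close> remain.\<close>
  define P where "P = {i \<in> {1..<n - 1}. \<exists>v\<in>N. C i = Some v}"
  define S where "S = {v. \<exists>i\<in>P. C (Suc i) = Some v}"
  have SS: "\<exists>v\<in>V. C (Suc i) = Some v" if "i \<in> P" for i
  proof -
    have "Suc i < n" using that by (auto simp: P_def)
    then show ?thesis using on_cycle[of "Suc i"] by blast
  qed
  have SV: "S \<subseteq> V" using SS by (force simp: S_def)
  have "N \<subseteq> (the \<circ> C) ` P \<union> {the (C (n - 1))}"
  proof
    fix v assume v: "v \<in> N"
    then have "Some v \<in> range C" by (auto simp: N_def U_def)
    then obtain i where i: "i < n" "C i = Some v" using C_mod n_pos by (metis imageE mod_less_divisor)
    then have "i \<noteq> 0" using C0 by (metis option.distinct(1))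
    show "v \<in> (the \<circ> C) ` P \<union> {the (C (n - 1))}"
    proof (cases "i = n - 1")
      case True
      then show ?thesis using i by (simp flip: True)
    next
      case False
      then have "i \<in> P" using i v \<open>i \<noteq> 0\<close> by (auto simp: P_def)
      moreover have "v = (the \<circ> C) i" using i by simp
      ultimately show ?thesis by blast
    qed
  qed
  then have "card N \<le> card ((the \<circ> C) ` P \<union> {the (C (n - 1))})" by (intro card_mono) (auto simp: P_def)
  also have "\<dots> \<le> card ((the \<circ> C) ` P) + 1" using card_Un_le[of "(the \<circ> C) ` P" "{the (C (n - 1))}"] by simp
  also have "card ((the \<circ> C) ` P) \<le> card P" by (rule card_image_le) (simp add: P_def)
  finally have "k \<le> card P" using N by simp
  also have "card P \<le> card S"
  proof -
    have "inj_on (C \<circ> Suc) P"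
    proof (rule comp_inj_on)
      show "inj_on C (Suc ` P)" by (rule inj_on_subset[OF C_inj]) (auto simp: P_def)
    qed simp
    then have "card P = card ((C \<circ> Suc) ` P)" by (rule card_image[symmetric])
    also have "\<dots> \<le> card (Some ` S)"
    proof (rule card_mono)
      show "finite (Some ` S)" using SV fV finite_subset by blast
      show "(C \<circ> Suc) ` P \<subseteq> Some ` S"
      proof
        fix w assume "w \<in> (C \<circ> Suc) ` P"
        then obtain i where i: "i \<in> P" "w = C (Suc i)" by auto
        then obtain v where "C (Suc i) = Some v" using SS by blast
        then show "w \<in> Some ` S" using i by (auto simp: S_def)
      qed
    qed
    finally show ?thesis by (simp add: card_image)
  qed
  finally have kS: "k \<le> card S" .
  have Pn: "\<exists>w\<in>H. add_vertex E x y (Some w) (C i)" if "i \<in> P" for i using that by (auto simp: P_def N_def)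
  note SV
  moreover have "independent E S"
    unfolding independent_def
  proof (intro ballI notI)
    fix s t assume st: "s \<in> S" "t \<in> S" "E s t"
    obtain i j where ij: "i \<in> P" "C (Suc i) = Some s" "j \<in> P" "C (Suc j) = Some t"
      using st by (auto simp: S_def)
    have "s \<noteq> t" using st(3) g by (auto simp: graph_def)
    then have "C i \<noteq> C j" using C_Suc_cong[of i j] ij by auto
    obtain u v where uv: "u \<in> H" "v \<in> H" "add_vertex E x y (Some u) (C i)" "add_vertex E x y (Some v) (C j)"
      using Pn ij by blast
    obtain Q where Q: "Q \<noteq> []" "hd Q = Some u" "last Q = Some v" "distinct Q" "set Q \<inter> range C = {}"
      "successively (add_vertex E x y) Q" using path[OF uv(1,2)] by blast
    have "\<not> add_vertex E x y (C (Suc i)) (C (Suc j))"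
      using successors_nonadjacent[OF Q(4,6,5,1) _ _ \<open>C i \<noteq> C j\<close>] Q(2,3) uv(3,4) by simp
    then show False using ij st(3) by simp
  qed
  moreover have "\<not> E w s" if "w \<in> H" "s \<in> S" for w s
  proof
    assume "E w s"
    obtain i where i: "i \<in> P" "C (Suc i) = Some s" using \<open>s \<in> S\<close> by (auto simp: S_def)
    obtain u where "u \<in> H" "add_vertex E x y (Some u) (C i)" using Pn i by blast
    then show False using insertion[of u w i] \<open>w \<in> H\<close> i \<open>E w s\<close> by simp
  qed
  ultimately show False using free[OF ab, of S] abH kS by auto
qed

lemma hamiltonian_path_exists:
  fixes V :: "'a set"
  assumes g: "graph V E" and k2: "k \<ge> 2" and conn: "k_connected V E (k + 1)"
    and free: "\<And>a b S. \<lbrakk>E a b; S \<subseteq> V; independent E S; \<forall>s\<in>S. \<not> E a s \<and> \<not> E b s\<rbrakk> \<Longrightarrow> card S < k"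
    and deg: "\<And>v. v \<in> V \<Longrightarrow> 3 * k \<le> 2 * card {u \<in> V. E v u} + 1"
    and alpha: "\<And>S. \<lbrakk>S \<subseteq> V; independent E S\<rbrakk> \<Longrightarrow> 2 * card S < card V"
    and xy: "x \<in> V" "y \<in> V" "x \<noteq> y"
  shows "\<exists>p. distinct p \<and> set p = V \<and> successively E p \<and> p \<noteq> [] \<and> hd p = x \<and> last p = y"
proof (rule ccontr)
  assume no: "\<not> ?thesis"
  have sym: "E u v \<Longrightarrow> E v u" and irr: "\<not> E u u" and inV: "E u v \<Longrightarrow> u \<in> V" and fV: "finite V" for u v
    using g by (auto simp: graph_def)
  let ?E = "add_vertex E x y"
  have Esym: "?E a b \<Longrightarrow> ?E b a" for a b using sym by (cases a; cases b) auto
  have Eirr: "\<not> ?E a a" for a using irr by (cases a) auto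
  have EV: "?E a b \<Longrightarrow> a = None \<or> a \<in> Some ` V" for a b using inV xy by (cases a; cases b) auto
  define cyc where "cyc L \<longleftrightarrow> distinct L \<and> successively ?E L \<and> ?E (last L) (hd L) \<and> None \<in> set L" for L
  have cycV: "set L \<subseteq> insert None (Some ` V)" if "cyc L" for L
  proof
    fix v assume "v \<in> set L"
    then obtain A B where L: "L = A @ v # B" by (meson split_list)
    show "v \<in> insert None (Some ` V)"
    proof (cases B)
      case Nil
      then have "?E v (hd L)" using that L by (simp add: cyc_def)
      then show ?thesis using EV by blast
    next
      case (Cons w B')
      then have "?E v w" using that L by (simp add: cyc_def successively_append_iff)
      then show ?thesis using EV by blast
    qed
  qed
  \<comment> \<open>Lengths are bounded, so a longest cycle through \<open>None\<close>
    exists.\<close>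
  have bound: "length L < card V + 2" if "cyc L" for L
  proof -
    have "length L = card (set L)" using that by (simp add: cyc_def distinct_card)
    also have "\<dots> \<le> card (insert None (Some ` V))" using cycV[OF that] fV by (intro card_mono) auto
    also have "\<dots> \<le> card V + 1" using fV by (simp add: card_insert_if card_image)
    finally show ?thesis by simp
  qed
  have "\<exists>L. cyc L \<and> length L \<ge> 3"
  proof -
    \<comment> \<open>Connectedness yields a path from \<open>x\<close> to \<open>y\<close>; closed
      through \<open>None\<close> it has at least three vertices because
      \<open>x \<noteq> y\<close>.\<close>
    have "connected_on (V - {}) E" using conn unfolding k_connected_def by auto
    then have "(\<lambda>a b. a \<in> V \<and> b \<in> V \<and> E a b)\<^sup>*\<^sup>* x y" using xy by (simp add: connected_on_def)
    from rtranclp_path[OF this xy(1)]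
    obtain p where p: "p \<noteq> []" "hd p = x" "last p = y" "distinct p" "successively E p" by blast
    have "length p \<noteq> 1" using p xy(3) by (auto simp: length_Suc_conv)
    then have "length p \<ge> 2" using p(1) by (cases p) (auto simp: Suc_le_eq)
    moreover have "cyc (None # map Some p)"
      using p by (auto simp: cyc_def successively_Cons hd_map last_map distinct_map)
    ultimately show ?thesis by (intro exI[of _ "None # map Some p"]) simp
  qed
  then obtain L0 where L0: "cyc L0" "length L0 \<ge> 3" by blast
  obtain L where L: "cyc L" "\<And>M. cyc M \<Longrightarrow> length M \<le> length L"
    using ex_has_greatest_nat[of cyc L0 length "card V + 2"] L0(1) bound by blast
  have L3: "length L \<ge> 3" using L(2)[OF L0(1)] L0(2) by simp
  \<comment> \<open>Rotating \<open>None\<close> to the front makes the rest a path of the original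
    graph between \<open>x\<close> and \<open>y\<close>.\<close>
  obtain A B where AB: "L = A @ None # B" using L(1) by (auto simp: cyc_def dest: split_list)
  have "cyc (None # B @ A)"
  proof (cases "A = []")
    case True
    then show ?thesis using L(1) AB by simp
  next
    case False
    then show ?thesis using rotate_cycle[of A "None # B" ?E] L(1) AB by (simp add: cyc_def)
  qed
  then obtain q where q: "cyc (None # q)" "length q + 1 = length L" using AB by (intro that[of "B @ A"]) auto
  have "None \<notin> set q" using q(1) by (simp add: cyc_def)
  then have "set q \<subseteq> Some ` V" using cycV[OF q(1)] by auto
  then have "\<forall>v\<in>set q. v = Some (the v)" by auto
  then have "q = map Some (map the q)" by (simp add: map_idI)
  then obtain p where p: "q = map Some p" by blast
  have pne: "length p \<ge> 2" using p q(2) L3 by simp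
  then have p0: "p \<noteq> []" by auto
  have pc: "distinct p" "successively E p" "hd p \<in> {x, y}" "last p \<in> {x, y}"
    using q(1) p p0 by (auto simp: cyc_def distinct_map successively_Cons hd_map last_map)
  have hl: "hd p \<noteq> last p"
    using pc(1) pne by (cases p) (auto split: if_splits simp: Suc_le_eq)
  have pV: "set p \<subseteq> V" using \<open>set q \<subseteq> Some ` V\<close> p by auto
  have revp: "distinct (rev p)" "successively E (rev p)"
    using pc sym by (auto intro: successively_mono)
  have "set p \<noteq> V"
  proof
    assume "set p = V"
    then show False
    proof (cases "hd p = x")
      case True
      then show False using no \<open>set p = V\<close> pc hl p0 by auto
    next
      case False
      then have "hd (rev p) = x" "last (rev p) = y" using pc hl p0 by (auto simp: hd_rev last_rev)
      then show False using no \<open>set p = V\<close> revp p0 by (metis rev_is_Nil_conv set_rev)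
    qed
  qed
  then obtain h where h: "h \<in> V" "h \<notin> set p" using pV by blast
  \<comment> \<open>Reversing the path if necessary secures the assumption
    \<open>orientation\<close>.\<close>
  obtain r where r: "distinct r" "successively E r" "set r = set p" "length r = length p"
      "{hd r, last r} = {x, y}" "E h (last r) \<Longrightarrow> E h (hd r)"
  proof (cases "E h (last p) \<longrightarrow> E h (hd p)")
    case True
    then show thesis using that[of p] pc hl by auto
  next
    case False
    have "{hd (rev p), last (rev p)} = {x, y}" using pc hl p0 by (auto simp: hd_rev last_rev)
    then show thesis using that[of "rev p"] False revp p0 by (simp add: hd_rev last_rev)
  qed
  have r0: "r \<noteq> []" using r(4) pne by auto
  define M where "M = None # map Some r"
  define n where "n = length M"
  define C where "C = (\<lambda>i. M ! (i mod length M))"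
  have M: "distinct M" "successively ?E M" "?E (last M) (hd M)" "M \<noteq> []"
    using r r0 by (auto simp: M_def distinct_map successively_Cons hd_map last_map doubleton_eq_iff)
  have n: "n = length r + 1" "length M = length L" using r(4) q(2) p by (simp_all add: M_def n_def)
  have n3: "n \<ge> 3" using n L3 n_def by simp
  have mc: "max_cycle ?E C n" and rC: "range C = set M"
    unfolding C_def n_def
    by (rule list_cycle_max_cycle[OF Esym Eirr M]; use L(2) n(2) in \<open>auto simp: cyc_def M_def\<close>)+
  have C0: "C 0 = None" using n3 by (simp add: C_def M_def)
  have lM: "length M = Suc (length r)" by (simp add: M_def)
  have "C 1 = M ! 1" using n3 unfolding C_def n_def by simp
  then have C1: "C 1 = Some (hd r)" using r0 by (simp add: M_def hd_conv_nth)
  have "C (n - 1) = M ! length r" unfolding C_def n(1) lM by simp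
  then have Cn: "C (n - 1) = Some (last r)" using r0 by (simp add: M_def last_conv_nth nth_Cons')
  have off: "Some v \<in> range C \<longleftrightarrow> v \<in> set r" for v by (auto simp: rC M_def)
  have off_ind: "\<not> E a b" if "a \<in> V" "a \<notin> set r" "b \<in> V" "b \<notin> set r" for a b
  proof
    assume e: "E a b"
    show False
    proof (rule off_cycle_independent[OF g conn _ mc C0 n3 _ that(1) _ that(3) _ e])
      show "range C \<subseteq> insert None (Some ` V)" using pV r(3) by (auto simp: rC M_def)
      show "Some a \<notin> range C" "Some b \<notin> range C" using that off by simp_all
    qed (rule free)
  qed
  interpret max_cycle ?E C n by (rule mc)
  interpret counterexample ?E C n "Some ` V" "Some h" k
  proof
    show "finite (Some ` V)" using fV by simp
    show "range C - {C 0} \<subseteq> Some ` V" using pV r(3) by (auto simp: rC M_def C0)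
    show "C 0 \<notin> Some ` V" using C0 by auto
    show "?E a b \<Longrightarrow> a = C 0 \<or> a \<in> Some ` V" for a b using EV C0 by simp
    show "?E (C 0) v \<longleftrightarrow> v = C 1 \<or> v = C (n - 1)" for v
      unfolding C0 C1 Cn using r(5) by (auto simp: doubleton_eq_iff)
    show "n \<ge> 3" by (rule n3)
    show "Some h \<in> Some ` V" using h by simp
    show "Some h \<notin> range C" using h r(3) off by simp
    show "\<not> ?E u v" if uv: "u \<in> Some ` V - range C" "v \<in> Some ` V - range C" for u v
    proof -
      obtain u' v' where "u = Some u'" "v = Some v'" "u' \<in> V" "v' \<in> V" using uv by auto
      then show ?thesis using off_ind[of u' v'] uv off by auto
    qed
    have pre: "T = Some ` {v. Some v \<in> T}" if "T \<subseteq> Some ` V" for T using that by auto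
    have preV: "{v. Some v \<in> T} \<subseteq> V" if "T \<subseteq> Some ` V" for T using that by auto
    have cpre: "card T = card {v. Some v \<in> T}" if "T \<subseteq> Some ` V" for T
      using pre[OF that] by (metis card_image inj_Some)
    have ind: "independent E {v. Some v \<in> T}" if "independent ?E T" for T
      using that by (auto simp: independent_def) (metis add_vertex_simps(3))
    show "card S < k" if fr: "?E a b" "a \<in> Some ` V" "b \<in> Some ` V" "S \<subseteq> Some ` V" "independent ?E S"
      "\<forall>s\<in>S. \<not> ?E a s \<and> \<not> ?E b s" for a b S
    proof -
      obtain a' b' where ab: "a = Some a'" "b = Some b'" using fr by auto
      have "card {v. Some v \<in> S} < k"
      proof (rule free[of a' b'])
        show "E a' b'" using that(1) ab by simp
        show "\<forall>s\<in>{v. Some v \<in> S}. \<not> E a' s \<and> \<not> E b' s" using that(6) ab by auto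
      qed (use preV ind that in blast)+
      then show ?thesis using cpre that(4) by simp
    qed
    show "3 * k \<le> 2 * card {u \<in> Some ` V. ?E v u} + 1" if vV: "v \<in> Some ` V" for v
    proof -
      obtain v' where v': "v = Some v'" "v' \<in> V" using vV by auto
      have "{u \<in> Some ` V. ?E v u} = Some ` {u \<in> V. E v' u}" using v' by auto
      then have "card {u \<in> Some ` V. ?E v u} = card {u \<in> V. E v' u}" by (simp add: card_image)
      then show ?thesis using deg[OF v'(2)] by simp
    qed
    show "2 * card S < card (Some ` V)" if "S \<subseteq> Some ` V" "independent ?E S" for S
      using alpha[OF preV[OF that(1)] ind[OF that(2)]] cpre[OF that(1)] by (simp add: card_image)
    show "k \<ge> 2" by (rule k2)
    show "?E (Some h) (C (n - 1)) \<Longrightarrow> ?E (Some h) (C 1)" unfolding C1 Cn using r(6) by simp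
  qed
  show False by (rule contradiction)
qed

theorem theorem1p9:
  fixes V :: "'a set" and E :: "'a \<Rightarrow> 'a \<Rightarrow> bool" and k :: nat
  assumes "graph V E"
    and "k \<ge> 2"
    and "k_connected V E (k + 1)"
    and "induced_free V E (K2_kK1_V k) K2_kK1_E"
    and "real (min_degree V E) \<ge> (3 * real k - 1) / 2"
    and "real (independence_number V E) < real (card V) / 2"
  shows "hamiltonian_connected V E"
  unfolding hamiltonian_connected_def
proof (intro ballI impI)
  fix x y assume xy: "x \<in> V" "y \<in> V" "x \<noteq> y"
  have "\<exists>p. distinct p \<and> set p = V \<and> successively E p \<and> p \<noteq> [] \<and> hd p = x \<and> last p = y"
  proof (rule hamiltonian_path_exists[OF assms(1-3) _ _ _ xy])
    show "card S < k" if "E a b" "S \<subseteq> V" "independent E S" "\<forall>s\<in>S. \<not> E a s \<and> \<not> E b s" for a b S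
      using K2_kK1_free_card[OF assms(1,4) that] .
    show "3 * k \<le> 2 * card {u \<in> V. E v u} + 1" if "v \<in> V" for v
    proof -
      have "real (min_degree V E) \<le> real (card {u \<in> V. E v u})" using min_degree_le[OF assms(1) that] by simp
      then have "real (3 * k) \<le> real (2 * card {u \<in> V. E v u} + 1)" using assms(5) by simp
      then show ?thesis by linarith
    qed
    show "2 * card S < card V" if "S \<subseteq> V" "independent E S" for S
    proof -
      have "real (card S) \<le> real (independence_number V E)" using independence_number_ge[OF assms(1) that] by simp
      then have "real (2 * card S) < real (card V)" using assms(6) by simp
      then show ?thesis by linarith
    qed
  qed
  then obtain p where p: "distinct p" "set p = V" "successively E p" "p \<noteq> []" "hd p = x" "last p = y"
    by blast
  have "E (p ! i) (p ! Suc i)" if "Suc i < length p" for i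
    using p(3) that by (rule successively_nth)
  then show "\<exists>p. ham_path V E p \<and> p \<noteq> [] \<and> hd p = x \<and> last p = y"
    using p by (auto simp: ham_path_def)
qed

end
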